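(* Let $N\in\{1,2,3\}$ and $0<\kappa_0<1$. Suppose that either $\beta_0\ge3$, or $-1<\beta_0<3$ and $w(0)\le\sqrt{\frac{2\kappa_0(1+\beta_0)}{(3-\beta_0)(1-\kappa_0)}}$. Then the solution $$z_1(x)=\Big(\sqrt{\tfrac{1-\kappa_0}{1+\beta_0}}\,w(\sqrt{1-\kappa_0}\,x),\ \sqrt{\tfrac{1-\kappa_0}{1+\beta_0}}\,w(\sqrt{1-\kappa_0}\,x)\Big)$$ of the system $$\begin{cases}-\Delta u+u=u^3+\beta_0v^2u+\kappa_0v,\\ -\Delta v+v=v^3+\beta_0u^2v+\kappa_0u,\end{cases}\quad\text{in }\mathbb{R}^N,$$ is nondegenerate in the space of radial functions.
   Context: $w$ denotes the unique positive solution, radial about the origin, of $-\Delta w+w=w^3$, $w\in H^1(\mathbb{R}^N)$, and $w(0)=\max w$. A radial solution $(U_1,U_2)$ of the system is nondegenerate in the space of radial functions if the only pair $(\phi_1,\phi_2)\in H^1(\mathbb{R}^N)\times H^1(\mathbb{R}^N)$ of radial functions solving the linearized system $$\begin{cases}\Delta\phi_1-\phi_1+\kappa_0\phi_2+3U_1^2\phi_1+\beta_0U_2^2\phi_1+2\beta_0U_1U_2\phi_2=0,\\ \Delta\phi_2-\phi_2+\kappa_0\phi_1+3U_2^2\phi_2+\beta_0U_1^2\phi_2+2\beta_0U_1U_2\phi_1=0\end{cases}$$ is $(\phi_1,\phi_2)=(0,0)$. *)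

theory Defs
  imports "HOL-Analysis.Analysis"
begin

primrec C_k :: "nat \<Rightarrow> ('a::euclidean_space \<Rightarrow> real) \<Rightarrow> bool" where
  "C_k 0 f \<longleftrightarrow> continuous_on UNIV f"
| "C_k (Suc k) f \<longleftrightarrow>
     f differentiable_on UNIV \<and> (\<forall>b\<in>Basis. C_k k (\<lambda>x. frechet_derivative f (at x) b))"

definition test_function :: "('a::euclidean_space \<Rightarrow> real) \<Rightarrow> bool" where
  "test_function \<psi> \<longleftrightarrow> (\<forall>k. C_k k \<psi>) \<and> compact (closure {x. \<psi> x \<noteq> 0})"

definition L2 :: "('a::euclidean_space \<Rightarrow> real) \<Rightarrow> bool" where
  "L2 u \<longleftrightarrow> u \<in> borel_measurable lborel \<and> integrable lborel (\<lambda>x. (u x)\<^sup>2)"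

text \<open>Elements of \<open>L\<^sup>2\<close> and \<open>H\<^sup>1\<close> are represented by Borel functions, not by
  equivalence classes; the gradient \<open>g\<close> below is determined only almost everywhere.\<close>

definition has_H1_gradient :: "('a::euclidean_space \<Rightarrow> real) \<Rightarrow> ('a \<Rightarrow> 'a) \<Rightarrow> bool" where
  "has_H1_gradient u g \<longleftrightarrow>
     L2 u \<and> (\<forall>b\<in>Basis. L2 (\<lambda>x. g x \<bullet> b)) \<and>
     (\<forall>\<psi>. test_function \<psi> \<longrightarrow> (\<forall>b\<in>Basis.
        (\<integral>x. u x * frechet_derivative \<psi> (at x) b \<partial>lborel) = - (\<integral>x. (g x \<bullet> b) * \<psi> x \<partial>lborel)))"

definition H1 :: "('a::euclidean_space \<Rightarrow> real) \<Rightarrow> bool" where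
  "H1 u \<longleftrightarrow> (\<exists>g. has_H1_gradient u g)"

text \<open>\<open>weak_solution u f\<close>: the function \<open>u \<in> H\<^sup>1\<close> is a weak solution of \<open>-\<Delta>u + u = f\<close>.
  The term \<open>frechet_derivative \<psi> (at x) (g x)\<close> is \<open>\<nabla>u \<bullet> \<nabla>\<psi>\<close>. Integrability on the right-hand
  side is demanded because the Bochner integral of a non-integrable function is 0; in
  dimension at most 3 it is automatic for the cubic right-hand sides below
  (where \<open>H\<^sup>1\<close> embeds into \<open>L\<^sup>4\<close>).\<close>

definition weak_solution :: "('a::euclidean_space \<Rightarrow> real) \<Rightarrow> ('a \<Rightarrow> real) \<Rightarrow> bool" where
  "weak_solution u f \<longleftrightarrow>
     (\<exists>g. has_H1_gradient u g \<and>
       (\<forall>\<psi>. test_function \<psi> \<longrightarrow>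
          integrable lborel (\<lambda>x. f x * \<psi> x) \<and>
          (\<integral>x. frechet_derivative \<psi> (at x) (g x) + u x * \<psi> x \<partial>lborel)
            = (\<integral>x. f x * \<psi> x \<partial>lborel)))"

definition radial :: "('a::euclidean_space \<Rightarrow> real) \<Rightarrow> bool" where
  "radial u \<longleftrightarrow> (\<forall>x y. norm x = norm y \<longrightarrow> u x = u y)"

text \<open>The properties by which the ground state \<open>w\<close> is characterised. It is unique (Kwong), but
  uniqueness is not part of the predicate. Continuity selects the representative for which
  the value \<open>w 0\<close> is meaningful.\<close>

definition ground_state :: "('a::euclidean_space \<Rightarrow> real) \<Rightarrow> bool" where
  "ground_state w \<longleftrightarrow>
     continuous_on UNIV w \<and> H1 w \<and> radial w \<and> (\<forall>x. 0 < w x) \<and> (\<forall>x. w x \<le> w 0) \<and>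
     weak_solution w (\<lambda>x. (w x) ^ 3)"

definition radial_solution ::
  "real \<Rightarrow> real \<Rightarrow> ('a::euclidean_space \<Rightarrow> real) \<Rightarrow> ('a \<Rightarrow> real) \<Rightarrow> bool" where
  "radial_solution \<kappa> \<beta> u v \<longleftrightarrow>
     H1 u \<and> H1 v \<and> radial u \<and> radial v \<and>
     weak_solution u (\<lambda>x. (u x) ^ 3 + \<beta> * (v x)\<^sup>2 * u x + \<kappa> * v x) \<and>
     weak_solution v (\<lambda>x. (v x) ^ 3 + \<beta> * (u x)\<^sup>2 * v x + \<kappa> * u x)"

text \<open>The linearised equations \<open>\<Delta>\<phi> - \<phi> + f = 0\<close> are written as \<open>-\<Delta>\<phi> + \<phi> = f\<close>.\<close>

definition linearized_solution ::
  "real \<Rightarrow> real \<Rightarrow> ('a::euclidean_space \<Rightarrow> real) \<Rightarrow> ('a \<Rightarrow> real) \<Rightarrow> ('a \<Rightarrow> real) \<Rightarrow> ('a \<Rightarrow> real) \<Rightarrow> bool"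
  where
  "linearized_solution \<kappa> \<beta> U1 U2 \<phi>1 \<phi>2 \<longleftrightarrow>
     weak_solution \<phi>1 (\<lambda>x. \<kappa> * \<phi>2 x + 3 * (U1 x)\<^sup>2 * \<phi>1 x + \<beta> * (U2 x)\<^sup>2 * \<phi>1 x
                          + 2 * \<beta> * U1 x * U2 x * \<phi>2 x) \<and>
     weak_solution \<phi>2 (\<lambda>x. \<kappa> * \<phi>1 x + 3 * (U2 x)\<^sup>2 * \<phi>2 x + \<beta> * (U1 x)\<^sup>2 * \<phi>2 x
                          + 2 * \<beta> * U1 x * U2 x * \<phi>1 x)"

text \<open>Nondegeneracy in the space of radial functions is defined for radial solutions only, so
  being such a solution is part of the predicate. The zero pair is the zero element of
  \<open>H\<^sup>1 \<times> H\<^sup>1\<close>, hence equality almost everywhere.\<close>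

definition radially_nondegenerate ::
  "real \<Rightarrow> real \<Rightarrow> ('a::euclidean_space \<Rightarrow> real) \<Rightarrow> ('a \<Rightarrow> real) \<Rightarrow> bool" where
  "radially_nondegenerate \<kappa> \<beta> U1 U2 \<longleftrightarrow>
     radial_solution \<kappa> \<beta> U1 U2 \<and>
     (\<forall>\<phi>1 \<phi>2. H1 \<phi>1 \<and> H1 \<phi>2 \<and> radial \<phi>1 \<and> radial \<phi>2 \<and> linearized_solution \<kappa> \<beta> U1 U2 \<phi>1 \<phi>2 \<longrightarrow>
        (AE x in lborel. \<phi>1 x = 0 \<and> \<phi>2 x = 0))"

end

(*
  Sum and difference of a kernel pair decouple. The difference satisfies an equation with a
  uniformly positive potential, so it vanishes. The sum, rescaled, lies in the kernel of the
  linearisation L = -Laplace + 1 - 3 w^2 of the scalar equation at w.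

  A radial weak solution coincides almost everywhere with a solution of the radial ODE. For
  the ground state the energy gives w' < 0, and the Pohozaev function is nonnegative because
  it vanishes at both ends and its derivative changes sign at most once, from + to -. Hence
  theta = - r w' / w is increasing. Choose R with (1 - theta(R)) w(R)^2 = 1 and put
  c = theta(R), v = r w' + c w. Then L v = 2 w ((1 - c) w^2 - 1), and both v and L v change
  sign exactly at R, from + to -. A radial element y of the kernel with y(0) > 0 has a zero,
  because L w = - 2 w^3 is orthogonal to it, and the Wronskian of y and v excludes a zero of y
  before R as well as one after R.
*)

theory Submission
  imports Defs
begin

section \<open>Smooth functions and test functions\<close>

text \<open>The shape of \<open>v\<close> comes from scaling: L (r w') = 2 (w^3 - w) and L w = - 2
  w^3. Thus r w' + c w vanishes where theta = c, and its image under L where (1 - c) w^2 = 1; the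
  Wronskian argument needs these two radii to coincide, and that is the equation for R. The bound on
  w(0) has an equally direct source: for beta < 3 it says that the coefficient 1 + kappa - (3 -
  beta) (1 - kappa) / (1 + beta) w^2 in the equation of the difference is at least 1 - kappa even at
  the maximum of w; for beta >= 3 the w^2 term has the good sign. The obstacle in front of all ODE
  arguments is that elements of H^1 are Borel functions with a weak gradient, so a kernel pair has
  neither derivatives nor a value at 0. Testing with functions z (|x|^2), smooth at the origin and
  allowed to be nonzero there, yields the flux r^n u' as an integral from 0 without a free constant,
  which rules out the singularity of the fundamental solution. The dimension enters twice: n <= 2
  makes the first bound on u' integrable at 0, and 3 - n is the coefficient of the positive part in
  the derivative of the Pohozaev function.\<close>

lemma C_k_SucI:
  assumes "\<And>x. (f has_derivative f' x) (at x)" "\<And>b. b \<in> Basis \<Longrightarrow> C_k k (\<lambda>x. f' x b)"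
  shows "C_k (Suc k) f"
proof -
  have "frechet_derivative f (at x) = f' x" for x
    using frechet_derivative_at[OF assms(1)] by metis
  then show ?thesis
    using assms by (auto simp: differentiable_on_def differentiable_def)
qed

lemma C_k_SucD:
  assumes "C_k (Suc k) f"
  shows "(f has_derivative frechet_derivative f (at x)) (at x)"
  using assms by (auto simp: differentiable_on_def frechet_derivative_works)

lemma C_k_Suc_imp: "C_k (Suc k) f \<Longrightarrow> C_k k f"
proof (induction k arbitrary: f)
  case 0
  then show ?case by (auto intro: differentiable_imp_continuous_on)
next
  case (Suc k)
  then show ?case by auto
qed

lemma C_k_const: "C_k k (\<lambda>x. c)"
  by (induction k arbitrary: c) (auto intro!: C_k_SucI[where f'="\<lambda>x h. 0"] simp del: C_k.simps(2))

lemma C_k_add: "C_k k f \<Longrightarrow> C_k k g \<Longrightarrow> C_k k (\<lambda>x. f x + g x)"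
proof (induction k arbitrary: f g)
  case 0
  then show ?case by (auto intro: continuous_intros)
next
  case (Suc k)
  show ?case
    by (rule C_k_SucI[OF has_derivative_add[OF C_k_SucD[OF Suc.prems(1)] C_k_SucD[OF Suc.prems(2)]]])
       (use Suc in auto)
qed

lemma C_k_mult: "C_k k f \<Longrightarrow> C_k k g \<Longrightarrow> C_k k (\<lambda>x. f x * g x)"
proof (induction k arbitrary: f g)
  case 0
  then show ?case by (auto intro: continuous_intros)
next
  case (Suc k)
  have 1: "C_k k f" "C_k k g"
    using Suc.prems C_k_Suc_imp by blast+
  show ?case
    by (rule C_k_SucI[OF has_derivative_mult[OF C_k_SucD[OF Suc.prems(1)] C_k_SucD[OF Suc.prems(2)]]])
       (intro C_k_add Suc.IH 1; use Suc.prems in auto)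
qed

lemma C_k_inner: "C_k k (\<lambda>x. x \<bullet> b)"
proof (cases k)
  case 0
  then show ?thesis by (auto intro: continuous_intros)
next
  case (Suc l)
  have "C_k (Suc l) (\<lambda>x. x \<bullet> b)"
    by (rule C_k_SucI[where f'="\<lambda>x h. h \<bullet> b"])
       (auto intro!: derivative_eq_intros C_k_const)
  then show ?thesis using Suc by simp
qed

lemma C_k_affine:
  fixes f :: "'a::euclidean_space \<Rightarrow> real"
  shows "C_k k f \<Longrightarrow> C_k k (\<lambda>x. f (c *\<^sub>R x + d))"
proof (induction k arbitrary: f)
  case 0
  then have "continuous_on UNIV f" by simp
  then show ?case
    by (auto intro!: continuous_intros continuous_on_compose2[where g=f and t=UNIV])
next
  case (Suc k)
  have *: "((\<lambda>x. f (c *\<^sub>R x + d)) has_derivative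
        (\<lambda>h. frechet_derivative f (at (c *\<^sub>R x + d)) (c *\<^sub>R h))) (at x)" for x
    by (rule has_derivative_compose[OF _ C_k_SucD[OF Suc.prems], where f="\<lambda>x. c *\<^sub>R x + d"])
       (auto intro!: derivative_eq_intros)
  have lin: "linear (frechet_derivative f (at y))" for y
    using C_k_SucD[OF Suc.prems] has_derivative_linear by blast
  show ?case
    by (rule C_k_SucI[OF *])
       (use Suc in \<open>auto simp: linear_cmul[OF lin] intro!: C_k_mult C_k_const\<close>)
qed

definition smooth :: "('a::euclidean_space \<Rightarrow> real) \<Rightarrow> bool" where
  "smooth f \<longleftrightarrow> (\<forall>k. C_k k f)"

lemma smooth_const: "smooth (\<lambda>x. c)"
  and smooth_add: "smooth f \<Longrightarrow> smooth g \<Longrightarrow> smooth (\<lambda>x. f x + g x)"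
  and smooth_mult: "smooth f \<Longrightarrow> smooth g \<Longrightarrow> smooth (\<lambda>x. f x * g x)"
  and smooth_affine: "smooth f \<Longrightarrow> smooth (\<lambda>x. f (c *\<^sub>R x + d))"
  by (simp_all add: smooth_def C_k_const C_k_add C_k_mult C_k_affine)

lemma smooth_continuous: "smooth f \<Longrightarrow> continuous_on UNIV f"
  unfolding smooth_def by (metis C_k.simps(1))

lemma smooth_frechet: "smooth f \<Longrightarrow> b \<in> Basis \<Longrightarrow> smooth (\<lambda>x. frechet_derivative f (at x) b)"
  unfolding smooth_def by (metis C_k.simps(2))

lemma smooth_has_derivative:
  "smooth f \<Longrightarrow> (f has_derivative frechet_derivative f (at x)) (at x)"
  unfolding smooth_def by (metis C_k_SucD)

lemma C_k_real_SucI: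
  fixes f :: "real \<Rightarrow> real"
  assumes "\<And>x. (f has_real_derivative f' x) (at x)" "C_k k f'"
  shows "C_k (Suc k) f"
  by (rule C_k_SucI[where f'="\<lambda>x h. f' x * h"]) (use assms in \<open>auto simp: has_field_derivative_def\<close>)

lemma smooth_realI:
  fixes f :: "real \<Rightarrow> real"
  assumes "\<And>x. (f has_real_derivative f' x) (at x)" "smooth f'"
  shows "smooth f"
  unfolding smooth_def
proof
  fix k
  have "C_k (Suc k) f" using assms C_k_real_SucI unfolding smooth_def by blast
  then show "C_k k f" by (rule C_k_Suc_imp)
qed

lemma smooth_realE:
  fixes f :: "real \<Rightarrow> real"
  assumes "smooth f"
  obtains f' where "\<And>x. (f has_real_derivative f' x) (at x)" "smooth f'"
proof
  show "smooth (\<lambda>x. frechet_derivative f (at x) 1)"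
    using smooth_frechet[OF assms] by simp
  fix x
  have 1: "(f has_derivative frechet_derivative f (at x)) (at x)"
    by (rule smooth_has_derivative[OF assms])
  have "frechet_derivative f (at x) h = frechet_derivative f (at x) 1 * h" for h
    using linear_cmul[OF has_derivative_linear[OF 1], of h 1] by simp
  then show "(f has_real_derivative frechet_derivative f (at x) 1) (at x)"
    using 1 unfolding has_field_derivative_def by (metis (no_types, lifting) ext)
qed

section \<open>Functions of the squared norm\<close>

lemma has_derivative_norm_square:
  fixes f :: "real \<Rightarrow> real"
  assumes "\<And>x. (f has_real_derivative f' x) (at x)"
  shows "((\<lambda>x::'a::euclidean_space. f (x \<bullet> x)) has_derivative (\<lambda>h. f' (x \<bullet> x) * (2 * (x \<bullet> h)))) (at x)"
  by (rule has_derivative_compose[where f="\<lambda>x. x \<bullet> x" and g=f])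
     (auto intro!: derivative_eq_intros assms[unfolded has_field_derivative_def] simp: inner_commute)

text \<open>The squared norm is a polynomial, so the origin is not special, unlike for the norm
  itself. The induction runs over all \<open>f\<close> at once because a partial derivative is
  \<open>f'\<close> of the squared norm times a coordinate.\<close>

lemma C_k_norm_square:
  fixes f :: "real \<Rightarrow> real"
  shows "smooth f \<Longrightarrow> C_k k (\<lambda>x::'a::euclidean_space. f (x \<bullet> x))"
proof (induction k arbitrary: f)
  case 0
  have "continuous_on UNIV (\<lambda>x::'a. f (x \<bullet> x))"
    by (rule continuous_on_compose2[OF smooth_continuous[OF 0]]) (auto intro!: continuous_intros)
  then show ?case by simp
next
  case (Suc k)
  obtain f' where f': "\<And>x. (f has_real_derivative f' x) (at x)" "smooth f'"
    using smooth_realE[OF Suc.prems] by blast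
  have "C_k k (\<lambda>x. f' (x \<bullet> x) * (2 * (x \<bullet> b)))" for b :: 'a
    by (intro C_k_mult Suc.IH f' C_k_const C_k_inner)
  then show ?case by (rule C_k_SucI[OF has_derivative_norm_square[OF f'(1)]])
qed

lemma frechet_norm_square:
  fixes f :: "real \<Rightarrow> real"
  assumes "\<And>x. (f has_real_derivative f' x) (at x)"
  shows "frechet_derivative (\<lambda>x::'a::euclidean_space. f (x \<bullet> x)) (at x) h = 2 * (x \<bullet> h) * f' (x \<bullet> x)"
  unfolding frechet_derivative_at[OF has_derivative_norm_square[OF assms], symmetric] by simp

text \<open>Summed over the basis this is the Laplacian of f (|x|^2), namely 2 N f' + 4 |x|^2 f'' in
  dimension N; it reappears as the bracket in \<open>distr_eq\<close>.\<close>

lemma frechet2_norm_square: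
  fixes f :: "real \<Rightarrow> real"
  assumes f': "\<And>x. (f has_real_derivative f' x) (at x)"
    and f'': "\<And>x. (f' has_real_derivative f'' x) (at x)"
    and b: "b \<in> Basis"
  shows "frechet_derivative (\<lambda>x::'a::euclidean_space. frechet_derivative (\<lambda>x. f (x \<bullet> x)) (at x) b) (at x) b
    = 2 * f' (x \<bullet> x) + 4 * (x \<bullet> b)\<^sup>2 * f'' (x \<bullet> x)"
proof -
  have *: "((\<lambda>x::'a. 2 * (x \<bullet> b) * f' (x \<bullet> x)) has_derivative
      (\<lambda>h. 2 * (x \<bullet> b) * (f'' (x \<bullet> x) * (2 * (x \<bullet> h))) + 2 * (h \<bullet> b) * f' (x \<bullet> x))) (at x)"
    by (rule has_derivative_mult[OF _ has_derivative_norm_square[OF f'']])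
       (auto intro!: derivative_eq_intros)
  show ?thesis
    unfolding frechet_norm_square[OF f'] frechet_derivative_at[OF *, symmetric]
    using b by (simp add: power2_eq_square)
qed

text \<open>Only large arguments decide about the support. In particular \<open>f 0\<close> may be
  nonzero, which admits test functions that do not vanish at the origin.\<close>

lemma test_function_norm_square:
  fixes f :: "real \<Rightarrow> real"
  assumes "smooth f" "\<And>t. t \<ge> b \<Longrightarrow> f t = 0"
  shows "test_function (\<lambda>x::'a::euclidean_space. f (x \<bullet> x))"
proof -
  have "{x::'a. f (x \<bullet> x) \<noteq> 0} \<subseteq> cball 0 (sqrt (max b 0))"
  proof
    fix x :: 'a assume "x \<in> {x. f (x \<bullet> x) \<noteq> 0}"
    then have "x \<bullet> x < b" using assms(2) not_le by blast
    then show "x \<in> cball 0 (sqrt (max b 0))"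
      by (auto simp: norm_eq_sqrt_inner)
  qed
  then have "compact (closure {x::'a. f (x \<bullet> x) \<noteq> 0})"
    by (meson bounded_cball bounded_subset compact_closure)
  then show ?thesis
    using C_k_norm_square[OF assms(1)] unfolding test_function_def by blast
qed

text \<open>The flat function exp (- 1 / t) with a power of 1 / t in front: the span of the family
  over \<open>j\<close> is closed under differentiation, which carries the induction for
  smoothness.\<close>

definition exp_inv :: "nat \<Rightarrow> real \<Rightarrow> real" where
  "exp_inv j t = (if t > 0 then (1 / t) ^ j * exp (- (1 / t)) else 0)"

lemma exp_inv_tendsto: "(exp_inv j \<longlongrightarrow> 0) (at 0)"
proof -
  have "((\<lambda>s::real. s ^ j / exp s) \<longlongrightarrow> 0) at_top"
    by (rule tendsto_power_div_exp_0)
  then have "((\<lambda>t::real. inverse t ^ j / exp (inverse t)) \<longlongrightarrow> 0) (at_right 0)"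
    using filterlim_compose[OF _ filterlim_inverse_at_top_right] by blast
  then have 1: "(exp_inv j \<longlongrightarrow> 0) (at_right 0)"
    by (rule Lim_transform_eventually)
       (auto simp: eventually_at_filter exp_inv_def exp_minus field_simps)
  have 2: "(exp_inv j \<longlongrightarrow> 0) (at_left 0)"
    by (rule Lim_transform_eventually[OF tendsto_const])
       (auto simp: eventually_at_filter exp_inv_def)
  show ?thesis using 1 2 filterlim_split_at by blast
qed

lemma exp_inv_deriv:
  "(exp_inv j has_real_derivative (exp_inv (j+2) t - j * exp_inv (j+1) t)) (at t)"
proof -
  consider "t > 0" | "t < 0" | "t = 0" by linarith
  then show ?thesis
  proof cases
    case 1
    have pw: "j = 0 \<or> t * t ^ (j - Suc 0) = t ^ j"
      by (cases j) auto
    have "((\<lambda>t. (1 / t) ^ j * exp (- (1 / t))) has_real_derivative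
        (exp_inv (j+2) t - j * exp_inv (j+1) t)) (at t)"
      using 1 by (auto intro!: derivative_eq_intros simp: exp_inv_def)
         (use pw in \<open>simp add: field_simps power2_eq_square\<close>)
    then show ?thesis
      by (rule has_field_derivative_transform_within_open[where S="{0<..}"])
         (use 1 in \<open>auto simp: exp_inv_def\<close>)
  next
    case 2
    have "((\<lambda>t. 0) has_real_derivative (exp_inv (j+2) t - j * exp_inv (j+1) t)) (at t)"
      using 2 by (auto simp: exp_inv_def)
    then show ?thesis
      by (rule has_field_derivative_transform_within_open[where S="{..<0}"])
         (use 2 in \<open>auto simp: exp_inv_def\<close>)
  next
    case 3
    \<comment> \<open>The difference quotient of \<open>exp_inv j\<close> at 0 is
      \<open>exp_inv (Suc j)\<close>, whose limit is already known.\<close>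
    have "((\<lambda>h. (exp_inv j (0 + h) - exp_inv j 0) / h) \<longlongrightarrow> 0) (at 0)"
      by (rule Lim_transform_eventually[OF exp_inv_tendsto[of "Suc j"]])
         (auto simp: eventually_at_filter exp_inv_def)
    then show ?thesis
      using 3 by (simp add: DERIV_def exp_inv_def)
  qed
qed

lemma smooth_exp_inv: "smooth (exp_inv j)"
proof -
  have "C_k k (exp_inv j)" for k
  proof (induction k arbitrary: j)
    case 0
    show ?case
      by (auto intro!: continuous_at_imp_continuous_on DERIV_isCont[OF exp_inv_deriv])
  next
    case (Suc k)
    have "C_k k (\<lambda>t. exp_inv (j+2) t + (- real j) * exp_inv (j+1) t)"
      by (intro C_k_add C_k_mult C_k_const Suc)
    then show ?case
      by (intro C_k_real_SucI[OF exp_inv_deriv]) simp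
  qed
  then show ?thesis by (simp add: smooth_def)
qed

text \<open>The parameter \<open>c\<close> stretches the arguments: as it grows, the bump tends to
  the indicator of the open interval while staying between 0 and 1, which prepares dominated
  convergence.\<close>

definition bump :: "real \<Rightarrow> real \<Rightarrow> real \<Rightarrow> real \<Rightarrow> real" where
  "bump c a b t = exp_inv 0 (c * (t - a)) * exp_inv 0 (c * (b - t))"

lemma smooth_bump: "smooth (bump c a b)"
proof -
  have "smooth (\<lambda>t. exp_inv 0 (c *\<^sub>R t + (- c * a)) * exp_inv 0 ((- c) *\<^sub>R t + c * b))"
    by (intro smooth_mult smooth_affine smooth_exp_inv)
  then show ?thesis
    unfolding bump_def by (simp add: algebra_simps)
qed

lemma bump_bounds: "0 \<le> bump c a b t" "bump c a b t \<le> 1"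
  unfolding bump_def exp_inv_def by (auto intro!: mult_le_one)

lemma bump_pos: "c > 0 \<Longrightarrow> a < t \<Longrightarrow> t < b \<Longrightarrow> 0 < bump c a b t"
  unfolding bump_def exp_inv_def by auto

lemma bump_outside: "c > 0 \<Longrightarrow> t \<le> a \<or> b \<le> t \<Longrightarrow> bump c a b t = 0"
  unfolding bump_def exp_inv_def by (auto simp: zero_less_mult_iff)

lemma bump_tendsto:
  "(\<lambda>k. bump (real (Suc k)) a b t) \<longlonglongrightarrow> indicator {a<..<b} t"
proof (cases "a < t \<and> t < b")
  case True
  have *: "(\<lambda>k. exp (- (1 / (real (Suc k) * d)))) \<longlonglongrightarrow> exp (- 0)" if "d > 0" for d
  proof -
    have "(\<lambda>k. (1 / d) * (1 / real (Suc k))) \<longlonglongrightarrow> (1 / d) * 0"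
      by (intro tendsto_mult tendsto_const LIMSEQ_Suc[OF lim_1_over_n])
    then have "(\<lambda>k. 1 / (real (Suc k) * d)) \<longlonglongrightarrow> 0"
      by (simp add: field_simps)
    then show ?thesis by (intro tendsto_exp tendsto_minus)
  qed
  have "(\<lambda>k. exp (- (1 / (real (Suc k) * (t - a)))) * exp (- (1 / (real (Suc k) * (b - t)))))
      \<longlonglongrightarrow> exp (- 0) * exp (- 0)"
    by (intro tendsto_mult *) (use True in auto)
  then show ?thesis
    using True by (simp add: bump_def exp_inv_def)
next
  case False
  then have "bump (real (Suc k)) a b t = 0" for k
    by (intro bump_outside) auto
  then show ?thesis using False by simp
qed

lemma antiderivative_exists:
  fixes f :: "real \<Rightarrow> real"
  assumes "continuous_on UNIV f"
  obtains F where "\<And>x. (F has_real_derivative f x) (at x)"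
proof -
  have "\<exists>F. \<forall>x. - \<infinity> < ereal x \<longrightarrow> ereal x < \<infinity> \<longrightarrow> (F has_vector_derivative f x) (at x)"
    by (rule einterval_antiderivative)
       (use assms in \<open>auto simp: continuous_on_eq_continuous_at\<close>)
  then show ?thesis
    using that by (auto simp: has_real_derivative_iff_has_vector_derivative)
qed

lemma constant_if_deriv_zero:
  fixes F :: "real \<Rightarrow> real"
  assumes "\<And>x. (F has_real_derivative f x) (at x)" "\<And>x. x \<in> {c..d} \<Longrightarrow> f x = 0" "c \<le> d"
  shows "F d = F c"
proof (cases "c = d")
  case False
  then show ?thesis
    using DERIV_isconst_end[of c d F] assms
    by (metis DERIV_isCont atLeastAtMost_iff continuous_at_imp_continuous_on less_eq_real_def)
qed simp

text \<open>The power can be singular at 0 only, and \<open>f\<close> vanishes up to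
  \<open>a > 0\<close>. Its derivative vanishes there too, so differentiating produces two terms of
  the same shape and the induction closes.\<close>

lemma smooth_powr_mult:
  fixes f :: "real \<Rightarrow> real"
  assumes "smooth f" "a > 0" "\<And>t. t \<le> a \<Longrightarrow> f t = 0"
  shows "smooth (\<lambda>t. t powr p * f t)"
proof -
  have der: "((\<lambda>t. t powr p * f t) has_real_derivative
      (p * (t powr (p - 1) * f t) + t powr p * f' t)) (at t)"
    if "\<And>t. (f has_real_derivative f' t) (at t)" "\<And>t. t \<le> a \<Longrightarrow> f t = 0" "\<And>t. t \<le> a \<Longrightarrow> f' t = 0"
    for p t and f f' :: "real \<Rightarrow> real"
  proof (cases "t > 0")
    case True
    then show ?thesis
      by (auto intro!: derivative_eq_intros that(1) has_real_derivative_powr)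
  next
    case False
    have "((\<lambda>t. 0) has_real_derivative (p * (t powr (p - 1) * f t) + t powr p * f' t)) (at t)"
      using False that assms by auto
    then show ?thesis
      by (rule has_field_derivative_transform_within_open[where S="{..<a}"])
         (use False that assms in auto)
  qed
  have ex: "\<exists>f'. (\<forall>t. (f has_real_derivative f' t) (at t)) \<and> smooth f' \<and> (\<forall>t\<le>a. f' t = 0)"
    if f: "smooth f" "\<And>t. t \<le> a \<Longrightarrow> f t = 0" for f :: "real \<Rightarrow> real"
  proof -
    obtain f' where f': "\<And>x. (f has_real_derivative f' x) (at x)" "smooth f'"
      using smooth_realE[OF f(1)] by blast
    have lt: "f' t = 0" if "t < a" for t
    proof -
      have "(f has_real_derivative 0) (at t)"
        by (rule has_field_derivative_transform_within_open[where S="{..<a}" and f="\<lambda>_. 0"])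
           (use that f in auto)
      then show ?thesis using DERIV_unique f' by blast
    qed
    \<comment> \<open>At the end point \<open>a\<close> itself the derivative vanishes by
      continuity.\<close>
    have "closed {t. f' t = 0}"
      using smooth_continuous[OF f'(2)] by (intro closed_Collect_eq) auto
    moreover have "{..<a} \<subseteq> {t. f' t = 0}" using lt by auto
    ultimately have "closure {..<a} \<subseteq> {t. f' t = 0}" by (rule closure_minimal[rotated])
    then have "f' a = 0" by auto
    then show ?thesis using f' lt by (metis order_le_less)
  qed
  have "C_k k (\<lambda>t. t powr p * f t)"
    if "smooth f" "\<And>t. t \<le> a \<Longrightarrow> f t = 0" for k f p
    using that
  proof (induction k arbitrary: f p)
    case 0
    obtain f' where "\<forall>t. (f has_real_derivative f' t) (at t)" "\<forall>t\<le>a. f' t = 0"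
      using ex[OF 0] by blast
    then have "isCont (\<lambda>t. t powr p * f t) t" for t
      using DERIV_isCont[OF der[of f f' p t]] 0 by blast
    then show ?case
      by (auto intro!: continuous_at_imp_continuous_on)
  next
    case (Suc k)
    obtain f' where f': "\<And>t. (f has_real_derivative f' t) (at t)" "smooth f'" "\<And>t. t \<le> a \<Longrightarrow> f' t = 0"
      using ex[OF Suc.prems] by blast
    show ?case
      by (rule C_k_real_SucI[OF der[OF f'(1)]])
         (intro Suc.prems f' C_k_add C_k_mult[OF C_k_const] Suc.IH; assumption)+
  qed
  then show ?thesis using assms by (auto simp: smooth_def)
qed

section \<open>Integration of radial functions\<close>

text \<open>Here and below \<open>n\<close> is the dimension minus one.\<close>

definition sphere_area :: "nat \<Rightarrow> real" where
  "sphere_area n = real (Suc n) * unit_ball_vol (real (Suc n))"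

lemma sphere_area_pos: "sphere_area n > 0"
  unfolding sphere_area_def by simp

text \<open>Polar coordinates for radial integrands. The half-lines generate the Borel sets and are
  stable under intersection, so it suffices to compare there: the preimage of \<open>{..a}\<close>
  is a ball, whose volume is an antiderivative of the density.\<close>

lemma distr_norm_lborel:
  assumes n: "DIM('a::euclidean_space) = Suc n"
  shows "distr (lborel :: 'a measure) borel norm
    = density lborel (\<lambda>r. ennreal (sphere_area n * (indicator {0<..} r * r ^ n)))"
    (is "_ = density lborel ?d")
proof (rule measure_eqI_generator_eq[where E="range atMost" and \<Omega>=UNIV and A="\<lambda>i. {..real i}"])
  show "Int_stable (range (atMost :: real \<Rightarrow> _))"
    by (auto simp: Int_stable_def min_def[symmetric] simp del: min_def)
  show "sets (distr (lborel :: 'a measure) borel norm) = sigma_sets UNIV (range atMost)"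
    "sets (density lborel ?d) = sigma_sets UNIV (range atMost)"
    by (simp_all add: borel_eq_atMost)
  show "(\<Union>i. {..real i}) = UNIV"
    using real_arch_simple by auto
  show "emeasure (distr (lborel :: 'a measure) borel norm) {..real i} \<noteq> \<infinity>" for i
  proof -
    have "norm -` {..real i} \<inter> space lborel = cball (0::'a) (real i)" by auto
    then show ?thesis by (simp add: emeasure_distr emeasure_cball)
  qed
  fix X :: "real set"
  assume "X \<in> range atMost"
  then obtain a where X: "X = {..a}" by auto
  have L: "emeasure (distr (lborel :: 'a measure) borel norm) X = emeasure lborel (cball (0::'a) a)"
  proof -
    have "norm -` {..a} \<inter> space lborel = cball (0::'a) a" by auto
    then show ?thesis by (simp add: X emeasure_distr)
  qed
  show "emeasure (distr (lborel :: 'a measure) borel norm) X = emeasure (density lborel ?d) X"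
  proof (cases "a > 0")
    case True
    have "emeasure (density lborel ?d) X = (\<integral>\<^sup>+ r. ?d r * indicator {..a} r \<partial>lborel)"
      by (simp add: X emeasure_density)
    \<comment> \<open>The integrands differ at most at the single point 0.\<close>
    also have "\<dots> = (\<integral>\<^sup>+ r. ennreal (sphere_area n * r ^ n) * indicator {0..a} r \<partial>lborel)"
      by (rule nn_integral_cong_AE, use AE_lborel_singleton[of 0] in eventually_elim)
         (auto simp: indicator_def)
    also have "\<dots> = ennreal (unit_ball_vol (real (Suc n)) * a ^ Suc n - unit_ball_vol (real (Suc n)) * 0 ^ Suc n)"
    proof (rule nn_integral_FTC_Icc)
      show "((\<lambda>r. unit_ball_vol (real (Suc n)) * r ^ Suc n) has_real_derivative sphere_area n * r ^ n) (at r)" for r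
        using DERIV_cmult[OF DERIV_pow[of "Suc n" r UNIV], of "unit_ball_vol (real (Suc n))"]
        by (simp add: sphere_area_def mult_ac)
    qed (use True in \<open>auto simp: less_imp_le[OF sphere_area_pos]\<close>)
    also have "\<dots> = emeasure lborel (cball (0::'a) a)"
      using True by (simp add: emeasure_cball n)
    finally show ?thesis using L by simp
  next
    case False
    have "emeasure (density lborel ?d) X = (\<integral>\<^sup>+ r. ?d r * indicator {..a} r \<partial>lborel)"
      by (simp add: X emeasure_density)
    also have "\<dots> = (\<integral>\<^sup>+ r. 0 \<partial>(lborel :: real measure))"
      by (rule nn_integral_cong) (use False in \<open>auto simp: indicator_def\<close>)
    finally have "emeasure (density lborel ?d) X = 0" by simp
    moreover have "emeasure lborel (cball (0::'a) a) = 0"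
    proof (cases "a = 0")
      case True then show ?thesis by simp
    next
      case False with \<open>\<not> a > 0\<close> have "cball (0::'a) a = {}" by auto
      then show ?thesis by simp
    qed
    ultimately show ?thesis using L by simp
  qed
qed auto

lemma integral_norm:
  fixes F :: "real \<Rightarrow> real"
  assumes n: "DIM('a::euclidean_space) = Suc n" and [measurable]: "F \<in> borel_measurable borel"
  shows "(\<integral>x. F (norm (x::'a)) \<partial>lborel) = sphere_area n * (\<integral>r. indicator {0<..} r * (r ^ n * F r) \<partial>lborel)"
proof -
  have "(\<integral>x. F (norm (x::'a)) \<partial>lborel) = (\<integral>r. F r \<partial>distr (lborel :: 'a measure) borel norm)"
    by (subst integral_distr) auto
  also have "\<dots> = (\<integral>r. (sphere_area n * (indicator {0<..} r * r ^ n)) *\<^sub>R F r \<partial>lborel)"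
    unfolding distr_norm_lborel[OF n]
    by (rule integral_density) (auto simp: indicator_def less_imp_le[OF sphere_area_pos])
  finally show ?thesis
    by (simp add: mult.assoc)
qed

lemma integrable_norm_iff:
  fixes F :: "real \<Rightarrow> real"
  assumes n: "DIM('a::euclidean_space) = Suc n" and [measurable]: "F \<in> borel_measurable borel"
  shows "integrable lborel (\<lambda>x::'a. F (norm x)) \<longleftrightarrow> integrable lborel (\<lambda>r. indicator {0<..} r * (r ^ n * F r))"
proof -
  have "integrable lborel (\<lambda>x::'a. F (norm x)) \<longleftrightarrow> integrable (distr (lborel :: 'a measure) borel norm) F"
    by (subst integrable_distr_eq) auto
  also have "\<dots> \<longleftrightarrow> integrable lborel (\<lambda>r. (sphere_area n * (indicator {0<..} r * r ^ n)) *\<^sub>R F r)"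
    unfolding distr_norm_lborel[OF n]
    by (rule integrable_density) (auto simp: indicator_def less_imp_le[OF sphere_area_pos])
  also have "\<dots> \<longleftrightarrow> integrable lborel (\<lambda>r. sphere_area n * (indicator {0<..} r * (r ^ n * F r)))"
    by (simp add: mult.assoc)
  also have "\<dots> \<longleftrightarrow> integrable lborel (\<lambda>r. indicator {0<..} r * (r ^ n * F r))"
    using sphere_area_pos[of n] by (subst integrable_mult_left_iff) auto
  finally show ?thesis .
qed

lemma AE_norm:
  assumes [measurable]: "Measurable.pred borel P" and "AE r in lborel. r > 0 \<longrightarrow> P r"
  shows "AE x in (lborel :: 'a::euclidean_space measure). P (norm x)"
proof -
  obtain n where n: "DIM('a) = Suc n"
    using DIM_positive[where 'a='a] gr0_implies_Suc by blast
  have "AE r in distr (lborel :: 'a measure) borel norm. P r"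
    unfolding distr_norm_lborel[OF n]
    using assms(2) by (subst AE_density) (auto simp: indicator_def split: if_splits elim!: eventually_mono)
  then show ?thesis
    by (subst (asm) AE_distr_iff) (auto simp: pred_def)
qed

text \<open>Since \<open>f\<close> is merely integrable, its indefinite integral need not be
  differentiable everywhere. Instead G r is written as minus the integral of \<open>g\<close> over
  [r, R], and Fubini on the triangle 0 <= r <= s <= R exchanges the order.\<close>

lemma integral_parts_indefinite:
  fixes f g G :: "real \<Rightarrow> real"
  assumes f: "integrable lborel (\<lambda>r. indicator {0..R} r * f r)"
    and [measurable]: "f \<in> borel_measurable borel"
    and G: "\<And>r. (G has_real_derivative g r) (at r)" and g: "continuous_on UNIV g"
    and GR: "G R = 0"
  shows "(\<integral>r. indicator {0..R} r * f r * G r \<partial>lborel)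
     = - (\<integral>s. indicator {0..R} s * (\<integral>r. indicator {0..s} r * f r \<partial>lborel) * g s \<partial>lborel)"
proof -
  have [measurable]: "g \<in> borel_measurable borel"
    using g by (rule borel_measurable_continuous_onI)
  have gi: "integrable lborel (\<lambda>s. indicator {0..R} s * g s)"
    using borel_integrable_atLeastAtMost'[of 0 R g] continuous_on_subset[OF g]
    unfolding set_integrable_def by simp
  define H where "H = (\<lambda>(r, s). indicator {0..R} r * f r * (indicator {0..R} s * g s) * (if r \<le> s then 1 else (0::real)))"
  have H: "integrable (lborel \<Otimes>\<^sub>M lborel) H"
  proof (rule lborel_pair.Fubini_integrable)
    show "H \<in> borel_measurable (lborel \<Otimes>\<^sub>M lborel)"
      unfolding H_def by measurable
    have bnd: "norm (\<integral>s. norm (H (r, s)) \<partial>lborel) \<le> norm (indicator {0..R} r * f r) * (\<integral>s. norm (indicator {0..R} s * g s) \<partial>lborel)" for r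
    proof -
      have gi': "integrable lborel (\<lambda>s. norm (indicator {0..R} r * f r) * norm (indicator {0..R} s * g s))"
        by (intro integrable_mult_right integrable_norm gi)
      have "norm (\<integral>s. norm (H (r, s)) \<partial>lborel) = (\<integral>s. norm (H (r, s)) \<partial>lborel)"
        by simp
      also have "\<dots> \<le> (\<integral>s. norm (indicator {0..R} r * f r) * norm (indicator {0..R} s * g s) \<partial>lborel)"
        by (rule integral_mono_AE'[OF gi']) (auto simp: H_def abs_mult intro!: AE_I2)
      finally show ?thesis by simp
    qed
    show "integrable lborel (\<lambda>r. \<integral>s. norm (H (r, s)) \<partial>lborel)"
      by (rule Bochner_Integration.integrable_bound[OF integrable_mult_left[OF integrable_norm[OF f],
            of "\<integral>s. norm (indicator {0..R} s * g s) \<partial>lborel"]])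
         (use bnd in \<open>auto simp: H_def abs_mult intro!: AE_I2\<close>)
    show "AE r in lborel. integrable lborel (\<lambda>s. H (r, s))"
      by (rule AE_I2, rule Bochner_Integration.integrable_bound[OF integrable_mult_right[OF gi]])
         (auto simp: H_def intro!: AE_I2)
  qed
  have 1: "indicator {0..R} r * f r * G r = - (\<integral>s. H (r, s) \<partial>lborel)" for r
  proof (cases "r \<in> {0..R}")
    case True
    have "(\<integral>s. g s * indicator {r..R} s \<partial>lborel) = G R - G r"
      by (rule integral_FTC_Icc_real)
         (use True g G in \<open>auto simp: continuous_on_eq_continuous_at\<close>)
    moreover have "(\<integral>s. H (r, s) \<partial>lborel) = (\<integral>s. f r * (g s * indicator {r..R} s) \<partial>lborel)"
      by (rule Bochner_Integration.integral_cong) (use True in \<open>auto simp: H_def indicator_def\<close>)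
    ultimately show ?thesis
      using True GR by simp
  next
    case False
    then show ?thesis by (simp add: H_def)
  qed
  have 2: "indicator {0..R} s * (\<integral>r. indicator {0..s} r * f r \<partial>lborel) * g s = (\<integral>r. H (r, s) \<partial>lborel)" for s
  proof (cases "s \<in> {0..R}")
    case True
    have "(\<integral>r. H (r, s) \<partial>lborel) = (\<integral>r. g s * (indicator {0..s} r * f r) \<partial>lborel)"
      by (rule Bochner_Integration.integral_cong) (use True in \<open>auto simp: H_def indicator_def\<close>)
    then show ?thesis using True by simp
  next
    case False
    then show ?thesis by (simp add: H_def)
  qed
  have "(\<integral>r. \<integral>s. H (r, s) \<partial>lborel \<partial>lborel) = (\<integral>s. \<integral>r. H (r, s) \<partial>lborel \<partial>lborel)"
    using lborel_pair.Fubini_integral[of "\<lambda>r s. H (r, s)"] H by simp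
  then show ?thesis unfolding 1 2 by simp
qed

text \<open>Cut off to (a, b), \<open>X\<close> is integrable with integral 0 over every interval,
  and by Lebesgue differentiation it is almost everywhere the limit of its averages. Countably many
  such intervals exhaust the half-line.\<close>

lemma AE_zero_if_interval_integrals_zero:
  fixes X :: "real \<Rightarrow> real"
  assumes int: "\<And>a b. 0 < a \<Longrightarrow> a < b \<Longrightarrow> integrable lborel (\<lambda>r. indicator {a<..<b} r * X r)"
    and zero: "\<And>a b. 0 < a \<Longrightarrow> a < b \<Longrightarrow> (\<integral>r. indicator {a<..<b} r * X r \<partial>lborel) = 0"
  shows "AE r in lborel. r > 0 \<longrightarrow> X r = 0"
proof -
  have main: "AE r in lborel. r \<in> {a<..<b} \<longrightarrow> X r = 0" if ab: "0 < a" "a < b" for a b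
  proof -
    define Y where "Y = (\<lambda>r. indicator {a<..<b} r * X r)"
    have Y: "integrable lborel Y" using int[OF ab] by (simp add: Y_def)
    have Yset: "set_integrable lborel (cbox x y) Y" for x y
      unfolding set_integrable_def using Y by (intro integrable_mult_indicator) auto
    have I0: "integral (cbox x (x + h)) Y = 0" for x h
    proof -
      have "integral (cbox x (x + h)) Y = (\<integral>r. indicator {x..x+h} r * Y r \<partial>lborel)"
        using set_borel_integral_eq_integral(2)[OF Yset[of x "x+h"]]
        by (simp add: set_lebesgue_integral_def)
      also have "\<dots> = (\<integral>r. indicator {max x a<..<min (x+h) b} r * X r \<partial>lborel)"
      proof (rule integral_cong_AE)
        show "(\<lambda>r. indicator {x..x + h} r * Y r) \<in> borel_measurable lborel"
          using Y by measurable
        have "(\<lambda>r. indicator {max x a<..<min (x+h) b} r * Y r) \<in> borel_measurable lborel"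
          using Y by measurable
        also have "(\<lambda>r. indicator {max x a<..<min (x+h) b} r * Y r) = (\<lambda>r. indicator {max x a<..<min (x+h) b} r * X r)"
          by (auto simp: Y_def indicator_def)
        finally show "(\<lambda>r. indicator {max x a<..<min (x+h) b} r * X r) \<in> borel_measurable lborel" .
        show "AE r in lborel. indicator {x..x + h} r * Y r = indicator {max x a<..<min (x + h) b} r * X r"
          using AE_lborel_singleton[of x] AE_lborel_singleton[of "x+h"]
          by eventually_elim (auto simp: Y_def indicator_def)
      qed
      also have "\<dots> = 0"
      proof (cases "max x a < min (x+h) b")
        case True
        then show ?thesis using ab by (intro zero) auto
      next
        case False
        then have "{max x a<..<min (x+h) b} = {}" by auto
        then show ?thesis by (simp only:) simp
      qed
      finally show ?thesis .
    qed
    have "Y integrable_on cbox x y" for x y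
      using set_borel_integral_eq_integral(1)[OF Yset] by blast
    then obtain N where N: "negligible N"
      "\<And>x e. x \<notin> N \<Longrightarrow> 0 < e \<Longrightarrow> \<exists>d>0. \<forall>h. 0 < h \<and> h < d \<longrightarrow>
         norm (integral (cbox x (x + h *\<^sub>R One)) Y /\<^sub>R h ^ DIM(real) - Y x) < e"
      using integrable_ccontinuous_explicit[of Y] by metis
    have "Y x = 0" if xN: "x \<notin> N" for x
    proof (rule ccontr)
      assume "Y x \<noteq> 0"
      then obtain d where d: "d > 0" "\<forall>h. 0 < h \<and> h < d \<longrightarrow> norm (integral (cbox x (x + h *\<^sub>R One)) Y /\<^sub>R h ^ DIM(real) - Y x) < norm (Y x)"
        using N(2)[OF xN, of "norm (Y x)"] by auto
      then show False using d(2)[rule_format, of "d/2"] I0 by simp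
    qed
    then have "AE x in lebesgue. Y x = 0"
      by (intro AE_I'[of N]) (use N(1) in \<open>auto simp: negligible_iff_null_sets\<close>)
    then have "AE x in lborel. Y x = 0"
      using Y by (subst (asm) AE_completion_iff) auto
    then show ?thesis by eventually_elim (auto simp: Y_def)
  qed
  have "AE r in lborel. \<forall>k::nat. r \<in> {1 / real (k + 2)<..<real (k + 2)} \<longrightarrow> X r = 0"
    unfolding AE_all_countable
  proof
    fix k :: nat
    have "1 / real (k + 2) < 1" "1 < real (k + 2)" by auto
    then have lt: "1 / real (k + 2) < real (k + 2)" by linarith
    show "AE r in lborel. r \<in> {1 / real (k + 2)<..<real (k + 2)} \<longrightarrow> X r = 0"
      by (rule main[OF _ lt]) simp
  qed
  then show ?thesis
  proof eventually_elim
    case (elim r)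
    show ?case
    proof
      assume r: "r > 0"
      obtain k :: nat where k: "max r (1 / r) < real k" using reals_Archimedean2 by blast
      then have "1 / r < real (k + 2)" "r < real (k + 2)" by auto
      with r have "1 / real (k + 2) < r" by (simp add: field_simps)
      then show "X r = 0" using elim \<open>r < real (k+2)\<close> by auto
    qed
  qed
qed

section \<open>Regularity of radial distributional solutions\<close>

lemma isCont_square:
  fixes h :: "real \<Rightarrow> real"
  assumes "continuous_on UNIV h"
  shows "isCont (\<lambda>r. h (r\<^sup>2)) r"
proof -
  have "continuous_on UNIV (\<lambda>r::real. h (r\<^sup>2))"
    by (rule continuous_on_compose2[OF assms]) (auto intro!: continuous_intros)
  then show ?thesis by (simp add: continuous_on_eq_continuous_at)
qed

text \<open>Exchanges the half-line for a compact interval away from 0, on which 1 / r^n,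
  \<open>M\<close> and \<open>J\<close> are continuous and the fundamental theorem applies.\<close>

lemma indicator_sqrt_interval:
  fixes F :: "real \<Rightarrow> real"
  assumes a: "0 < a" and F: "\<And>r. r\<^sup>2 \<le> a \<or> b \<le> r\<^sup>2 \<Longrightarrow> F r = 0"
  shows "F r * indicator {sqrt a..sqrt b} r = indicator {0<..} r * F r"
proof (cases "r \<in> {sqrt a..sqrt b}")
  case True
  have "0 < sqrt a" using a by simp
  then have "0 < r" using True by (meson atLeastAtMost_iff less_le_trans)
  then show ?thesis using True by simp
next
  case False
  show ?thesis
  proof (cases "r > 0")
    case True
    have "r\<^sup>2 \<le> a \<or> b \<le> r\<^sup>2"
      using False real_less_lsqrt[of r a] real_less_rsqrt[of r b] True by force
    then show ?thesis using F False by simp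
  qed (use False in simp)
qed

text \<open>\<open>p\<close> is the profile of a radial L^2 function u in dimension n + 1 with
  Laplace u = (1 - v) u in the sense of distributions, tested only with z (|x|^2). In
  \<open>distr_eq\<close> the integrals are in polar coordinates, with the sphere area cancelled and
  the Laplacian of the test function written out.\<close>

locale radial_distribution =
  fixes n :: nat and p v :: "real \<Rightarrow> real" and K :: real
  assumes p_meas [measurable]: "p \<in> borel_measurable borel"
    and v_cont: "continuous_on UNIV v"
    and K: "\<And>r. \<bar>1 - v r\<bar> \<le> K"
    and p_L2: "integrable lborel (\<lambda>r. indicator {0<..} r * (r ^ n * (p r)\<^sup>2))"
    and distr_eq: "\<And>z z' z'' b. smooth z \<Longrightarrow> (\<And>t. (z has_real_derivative z' t) (at t)) \<Longrightarrow>
      (\<And>t. (z' has_real_derivative z'' t) (at t)) \<Longrightarrow> (\<And>t. t \<ge> b \<Longrightarrow> z t = 0) \<Longrightarrow>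
      (\<integral>r. indicator {0<..} r * (r ^ n * (p r * (2 * real (Suc n) * z' (r\<^sup>2) + 4 * r\<^sup>2 * z'' (r\<^sup>2)))) \<partial>lborel)
      = (\<integral>r. indicator {0<..} r * (r ^ n * ((1 - v r) * p r * z (r\<^sup>2))) \<partial>lborel)"
begin

text \<open>For a solution \<open>u\<close> of \<open>(r\<^sup>n u')' = f\<close> the primitive \<open>M\<close> is the flux \<open>r\<^sup>n u'\<close>. Below, \<open>p\<close> is
  shown to agree up to a constant with an antiderivative \<open>J\<close> of \<open>M / r\<^sup>n\<close>.\<close>

definition f :: "real \<Rightarrow> real" where
  "f r = (if r > 0 then r ^ n * ((1 - v r) * p r) else 0)"

definition M :: "real \<Rightarrow> real" where
  "M s = (\<integral>r. indicator {0..s} r * f r \<partial>lborel)"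

lemma K_nonneg: "K \<ge> 0"
  using K[of 0] by linarith

lemma v_meas [measurable]: "v \<in> borel_measurable borel"
  using v_cont by (rule borel_measurable_continuous_onI)

lemma f_meas [measurable]: "f \<in> borel_measurable borel"
  unfolding f_def by measurable

text \<open>Young's inequality with a free weight. Choosing \<open>l\<close> according to the radius
  later recovers the rate that Cauchy-Schwarz would give.\<close>

lemma abs_le_square: "l > 0 \<Longrightarrow> \<bar>x\<bar> \<le> l * x\<^sup>2 + 1 / l" for l x :: real
proof -
  assume l: "l > 0"
  have "0 \<le> (l * \<bar>x\<bar> - 1)\<^sup>2" by simp
  also have "(l * \<bar>x\<bar> - 1)\<^sup>2 = l\<^sup>2 * x\<^sup>2 - 2 * (l * \<bar>x\<bar>) + 1"
    by (simp add: power2_eq_square algebra_simps)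
  finally have "2 * (l * \<bar>x\<bar>) \<le> l\<^sup>2 * x\<^sup>2 + 1" by simp
  moreover have "0 \<le> l * \<bar>x\<bar>" using l by simp
  ultimately have "l * \<bar>x\<bar> \<le> l\<^sup>2 * x\<^sup>2 + 1" by linarith
  then show ?thesis
    using l by (simp add: field_simps power2_eq_square)
qed

lemma f_bound:
  assumes "l > 0"
  shows "\<bar>f r\<bar> \<le> K * (l * (indicator {0<..} r * (r ^ n * (p r)\<^sup>2)) + indicator {0<..} r * r ^ n / l)"
proof (cases "r > 0")
  case True
  have "\<bar>f r\<bar> = r ^ n * (\<bar>1 - v r\<bar> * \<bar>p r\<bar>)"
    using True by (simp add: f_def abs_mult)
  also have "\<dots> \<le> r ^ n * (K * (l * (p r)\<^sup>2 + 1 / l))"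
    using True K abs_le_square[OF assms, of "p r"] K_nonneg by (intro mult_left_mono mult_mono) auto
  finally show ?thesis using True by (simp add: algebra_simps)
qed (simp add: f_def K_nonneg)

lemma f_int: "integrable lborel (\<lambda>r. indicator {0..R} r * f r)"
proof (rule Bochner_Integration.integrable_bound)
  have "integrable lborel (\<lambda>r. r ^ n * indicator {0..R} r)"
    by (rule borel_integrable_atLeastAtMost) auto
  then show "integrable lborel (\<lambda>r. K * (indicator {0<..} r * (r ^ n * (p r)\<^sup>2) + r ^ n * indicator {0..R} r))"
    by (intro integrable_mult_right Bochner_Integration.integrable_add p_L2)
  show "AE r in lborel. norm (indicator {0..R} r * f r)
      \<le> norm (K * (indicator {0<..} r * (r ^ n * (p r)\<^sup>2) + r ^ n * indicator {0..R} r))"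
  proof (rule AE_I2)
    fix r :: real
    show "norm (indicator {0..R} r * f r)
      \<le> norm (K * (indicator {0<..} r * (r ^ n * (p r)\<^sup>2) + r ^ n * indicator {0..R} r))"
      using f_bound[of 1 r] K_nonneg by (auto simp: indicator_def f_def)
  qed
qed measurable

text \<open>Away from 0 the weight r^n is at least a^n, so the weighted square integrability of
  \<open>p\<close> controls \<open>p\<close> itself.\<close>

lemma p_int:
  assumes "0 < a"
  shows "integrable lborel (\<lambda>r. indicator {a..b} r * p r)"
proof (rule Bochner_Integration.integrable_bound)
  show "integrable lborel (\<lambda>r. (1 / a ^ n) * (indicator {0<..} r * (r ^ n * (p r)\<^sup>2)) + 1 * indicator {a..b} r)"
    by (intro Bochner_Integration.integrable_add integrable_mult_right p_L2 borel_integrable_atLeastAtMost) auto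
  show "AE r in lborel. norm (indicator {a..b} r * p r)
     \<le> norm ((1 / a ^ n) * (indicator {0<..} r * (r ^ n * (p r)\<^sup>2)) + 1 * indicator {a..b} r)"
  proof (rule AE_I2)
    fix r :: real
    show "norm (indicator {a..b} r * p r)
     \<le> norm ((1 / a ^ n) * (indicator {0<..} r * (r ^ n * (p r)\<^sup>2)) + 1 * indicator {a..b} r)"
    proof (cases "r \<in> {a..b}")
      case True
      then have "(p r)\<^sup>2 * a ^ n \<le> (p r)\<^sup>2 * r ^ n"
        using assms by (intro mult_left_mono power_mono) auto
      then have "(p r)\<^sup>2 \<le> (1 / a ^ n) * (r ^ n * (p r)\<^sup>2)"
        using assms by (simp add: field_simps)
      then show ?thesis
        using abs_le_square[of 1 "p r"] True assms by (simp add: indicator_def)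
    qed simp
  qed
qed measurable

lemma p_mult_int:
  assumes "0 < a" "continuous_on {a..b} h" and [measurable]: "h \<in> borel_measurable borel"
  shows "integrable lborel (\<lambda>r. indicator {a..b} r * (p r * h r))"
proof -
  have "bounded (h ` {a..b})"
    by (intro compact_imp_bounded compact_continuous_image assms) auto
  then obtain B where B: "\<And>r. r \<in> {a..b} \<Longrightarrow> norm (h r) \<le> B"
    unfolding bounded_iff by blast
  show ?thesis
  proof (rule Bochner_Integration.integrable_bound[OF integrable_mult_right[OF p_int[OF assms(1)], of B]])
    show "AE r in lborel. norm (indicator {a..b} r * (p r * h r)) \<le> norm (B * (indicator {a..b} r * p r))"
    proof (rule AE_I2)
      fix r
      show "norm (indicator {a..b} r * (p r * h r)) \<le> norm (B * (indicator {a..b} r * p r))"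
      proof (cases "r \<in> {a..b}")
        case True
        have "\<bar>p r\<bar> * \<bar>h r\<bar> \<le> \<bar>p r\<bar> * \<bar>B\<bar>"
          using B[OF True] by (intro mult_left_mono) auto
        then show ?thesis using True by (simp add: abs_mult mult.commute)
      qed simp
    qed
  qed measurable
qed

lemma M_eq: "s \<ge> 0 \<Longrightarrow> M s = integral {0..s} f"
  using set_borel_integral_eq_integral(2)[of "{0..s}" f] f_int[of s]
  by (simp add: M_def set_integrable_def set_lebesgue_integral_def)

lemma M_cont: "r > 0 \<Longrightarrow> isCont M r"
proof -
  assume r: "r > 0"
  have "f integrable_on {0..r+1}"
    using set_borel_integral_eq_integral(1)[of "{0..r+1}" f] f_int[of "r+1"]
    by (simp add: set_integrable_def)
  then have "continuous_on {0..r+1} (\<lambda>s. integral {0..s} f)"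
    by (rule indefinite_integral_continuous_1)
  then have "continuous_on {0..r+1} M"
    by (rule continuous_on_eq) (simp add: M_eq)
  then show ?thesis using r by (intro continuous_on_interior) auto
qed

text \<open>The test function is \<open>z (r\<^sup>2)\<close> with \<open>z' t = t powr (- (n + 1) / 2) * g t / 2\<close>, so that
  \<open>r\<^sup>n d/dr z (r\<^sup>2) = g (r\<^sup>2)\<close>.\<close>

lemma M_distr:
  assumes g: "smooth g" and g': "\<And>t. (g has_real_derivative g' t) (at t)"
    and ab: "0 < a" "a < b" and out: "\<And>t. t \<le> a \<or> b \<le> t \<Longrightarrow> g t = 0"
  shows "(\<integral>r. indicator {0<..} r * (p r * (2 * r * g' (r\<^sup>2))) \<partial>lborel)
    = - (\<integral>s. indicator {0<..} s * (M s / s ^ n * g (s\<^sup>2)) \<partial>lborel)"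
proof -
  define q where "q = - (real n + 1) / 2"
  define \<sigma> where "\<sigma> = (\<lambda>t. (1/2) * (t powr q * g t))"
  have s\<sigma>: "smooth \<sigma>"
    unfolding \<sigma>_def using ab out by (intro smooth_mult smooth_const smooth_powr_mult[where a=a] g) auto
  obtain \<sigma>' where \<sigma>': "\<And>t. (\<sigma> has_real_derivative \<sigma>' t) (at t)"
    using smooth_realE[OF s\<sigma>] by blast
  obtain F where F: "\<And>t. (F has_real_derivative \<sigma> t) (at t)"
    using antiderivative_exists[OF smooth_continuous[OF s\<sigma>]] by blast
  \<comment> \<open>\<open>z\<close> vanishes from \<open>b\<close> on, but up to \<open>a\<close>
    it is a constant that is in general nonzero. The test function therefore sees the origin, and
    this is why the flux is \<open>M\<close>, an integral from 0 without additive constant.\<close>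
  define z where "z = (\<lambda>t. F t - F b)"
  have z': "(z has_real_derivative \<sigma> t) (at t)" for t
    unfolding z_def by (auto intro!: derivative_eq_intros F)
  have z0: "z t = 0" if "t \<ge> b" for t
  proof -
    have "z t = z b"
      by (rule constant_if_deriv_zero[OF z']) (use that out in \<open>auto simp: \<sigma>_def\<close>)
    then show ?thesis by (simp add: z_def)
  qed
  have sz: "smooth z" by (rule smooth_realI[OF z' s\<sigma>])
  have powr_cancel: "r ^ Suc n * (r\<^sup>2) powr q = 1" if "r > 0" for r :: real
  proof -
    have "r\<^sup>2 = r powr 2" using that by simp
    then have "(r\<^sup>2) powr q = r powr (2 * q)" by (simp only: powr_powr)
    also have "2 * q = - real (Suc n)" by (simp add: q_def field_simps)
    also have "r powr (- real (Suc n)) = inverse (r ^ Suc n)"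
      using that by (simp only: powr_minus powr_realpow)
    finally have e: "(r\<^sup>2) powr q = inverse (r ^ Suc n)" .
    have "r ^ Suc n \<noteq> 0" using that by simp
    then show ?thesis unfolding e by (rule right_inverse)
  qed
  have H: "2 * r ^ Suc n * \<sigma> (r\<^sup>2) = g (r\<^sup>2)" if "r > 0" for r
  proof -
    have "2 * r ^ Suc n * \<sigma> (r\<^sup>2) = (r ^ Suc n * (r\<^sup>2) powr q) * g (r\<^sup>2)"
      by (simp add: \<sigma>_def)
    then show ?thesis by (simp only: powr_cancel[OF that] mult_1)
  qed
  \<comment> \<open>The left side is the derivative of 2 r^(n+1) sigma (r^2), which is g (r^2) by
    \<open>H\<close>. Uniqueness of derivatives replaces a computation of
    \<open>\<sigma>'\<close>.\<close>
  have lhs: "r ^ n * (2 * real (Suc n) * \<sigma> (r\<^sup>2) + 4 * r\<^sup>2 * \<sigma>' (r\<^sup>2)) = 2 * r * g' (r\<^sup>2)"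
    if "r > 0" for r
  proof -
    have sq: "((\<lambda>r. r\<^sup>2) has_real_derivative 2 * r) (at r)"
      by (auto intro!: derivative_eq_intros)
    have "((\<lambda>r. 2 * r ^ Suc n * \<sigma> (r\<^sup>2)) has_real_derivative
        2 * (real (Suc n) * r ^ n) * \<sigma> (r\<^sup>2) + (\<sigma>' (r\<^sup>2) * (2 * r)) * (2 * r ^ Suc n)) (at r)"
      by (rule DERIV_mult[OF DERIV_cmult DERIV_chain2[OF \<sigma>' sq]])
         (use DERIV_pow[of "Suc n" r UNIV] in simp)
    then have "((\<lambda>r. g (r\<^sup>2)) has_real_derivative
        2 * (real (Suc n) * r ^ n) * \<sigma> (r\<^sup>2) + (\<sigma>' (r\<^sup>2) * (2 * r)) * (2 * r ^ Suc n)) (at r)"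
      by (rule has_field_derivative_transform_within_open[where S="{0<..}"]) (use that H in auto)
    moreover have "((\<lambda>r. g (r\<^sup>2)) has_real_derivative g' (r\<^sup>2) * (2 * r)) (at r)"
      by (rule DERIV_chain2[OF g' sq])
    ultimately have "g' (r\<^sup>2) * (2 * r) = 2 * (real (Suc n) * r ^ n) * \<sigma> (r\<^sup>2) + (\<sigma>' (r\<^sup>2) * (2 * r)) * (2 * r ^ Suc n)"
      using DERIV_unique by blast
    then show ?thesis by (simp add: algebra_simps power2_eq_square)
  qed
  \<comment> \<open>For r >= 1 also r <= r^2, so r >= \<open>R\<close> implies r^2 >=
    \<open>b\<close>.\<close>
  define R where "R = max b 1"
  have R: "z (r\<^sup>2) = 0" "g (r\<^sup>2) = 0" if "r \<ge> R" for r
  proof -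
    have "b \<le> r" "1 \<le> r" using that by (auto simp: R_def)
    then have "b \<le> r\<^sup>2" using self_le_power[of r 2] by simp
    then show "z (r\<^sup>2) = 0" "g (r\<^sup>2) = 0" using z0 out by auto
  qed
  have "(\<integral>r. indicator {0<..} r * (p r * (2 * r * g' (r\<^sup>2))) \<partial>lborel)
    = (\<integral>r. indicator {0<..} r * (r ^ n * (p r * (2 * real (Suc n) * \<sigma> (r\<^sup>2) + 4 * r\<^sup>2 * \<sigma>' (r\<^sup>2)))) \<partial>lborel)"
  proof (rule Bochner_Integration.integral_cong[OF refl])
    fix r :: real
    let ?X = "2 * real (Suc n) * \<sigma> (r\<^sup>2) + 4 * r\<^sup>2 * \<sigma>' (r\<^sup>2)"
    show "indicator {0<..} r * (p r * (2 * r * g' (r\<^sup>2))) = indicator {0<..} r * (r ^ n * (p r * ?X))"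
    proof (cases "r > 0")
      case True
      have "r ^ n * (p r * ?X) = p r * (r ^ n * ?X)" by (rule mult.left_commute)
      then show ?thesis by (simp only: lhs[OF True])
    qed simp
  qed
  also have "\<dots> = (\<integral>r. indicator {0<..} r * (r ^ n * ((1 - v r) * p r * z (r\<^sup>2))) \<partial>lborel)"
    by (rule distr_eq[OF sz z' \<sigma>' z0])
  also have "\<dots> = (\<integral>r. indicator {0..R} r * f r * z (r\<^sup>2) \<partial>lborel)"
    by (rule Bochner_Integration.integral_cong) (auto simp: indicator_def f_def R)
  also have "\<dots> = - (\<integral>s. indicator {0..R} s * (\<integral>r. indicator {0..s} r * f r \<partial>lborel) * (\<sigma> (s\<^sup>2) * (2 * s)) \<partial>lborel)"
  proof (rule integral_parts_indefinite[OF f_int f_meas])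
    show "((\<lambda>r. z (r\<^sup>2)) has_real_derivative \<sigma> (r\<^sup>2) * (2 * r)) (at r)" for r
      by (rule DERIV_chain2[OF z']) (auto intro!: derivative_eq_intros)
    show "continuous_on UNIV (\<lambda>s. \<sigma> (s\<^sup>2) * (2 * s))"
      by (intro continuous_intros continuous_on_compose2[OF smooth_continuous[OF s\<sigma>]]) auto
    show "z (R\<^sup>2) = 0" using R by simp
  qed
  also have "\<dots> = - (\<integral>s. indicator {0<..} s * (M s / s ^ n * g (s\<^sup>2)) \<partial>lborel)"
  proof -
    have "indicator {0..R} s * M s * (\<sigma> (s\<^sup>2) * (2 * s)) = indicator {0<..} s * (M s / s ^ n * g (s\<^sup>2))" for s
    proof (cases "0 < s \<and> s \<le> R")
      case True
      then have "g (s\<^sup>2) = 2 * s ^ Suc n * \<sigma> (s\<^sup>2)" using H by simp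
      then show ?thesis using True by (simp add: indicator_def)
    next
      case False
      then show ?thesis using R[of s] by (auto simp: indicator_def)
    qed
    then show ?thesis unfolding M_def[symmetric] by simp
  qed
  finally show ?thesis .
qed

lemma J_exists:
  obtains J where "\<And>r. r > 0 \<Longrightarrow> (J has_real_derivative M r / r ^ n) (at r)"
proof -
  have "\<exists>J. \<forall>x. ereal 0 < ereal x \<longrightarrow> ereal x < \<infinity> \<longrightarrow> (J has_vector_derivative M x / x ^ n) (at x)"
    by (rule einterval_antiderivative) (auto intro!: continuous_intros M_cont)
  then show ?thesis
    using that by (auto simp: has_real_derivative_iff_has_vector_derivative)
qed

context
  fixes J
  assumes J: "\<And>r. r > 0 \<Longrightarrow> (J has_real_derivative M r / r ^ n) (at r)"
begin

lemma J_cont: "r > 0 \<Longrightarrow> isCont J r"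
  using J DERIV_isCont by blast

lemma J_distr_int:
  assumes h: "continuous_on UNIV h" and ab: "0 < a" "a < b" and out: "\<And>t. t \<le> a \<or> b \<le> t \<Longrightarrow> h t = 0"
  shows "integrable lborel (\<lambda>r. indicator {0<..} r * (p r * (2 * r * h (r\<^sup>2))))" (is ?A)
    and "integrable lborel (\<lambda>r. indicator {0<..} r * (J r * (2 * r * h (r\<^sup>2))))" (is ?B)
proof -
  have [measurable]: "h \<in> borel_measurable borel"
    using h by (rule borel_measurable_continuous_onI)
  have hc: "continuous_on UNIV (\<lambda>r. 2 * r * h (r\<^sup>2))"
    by (intro continuous_intros continuous_on_compose2[OF h]) auto
  have sa: "sqrt a > 0" using ab by simp
  have "integrable lborel (\<lambda>r. indicator {sqrt a..sqrt b} r * (p r * (2 * r * h (r\<^sup>2))))"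
    by (rule p_mult_int[OF sa]) (use continuous_on_subset[OF hc] in auto)
  then show ?A
    by (subst (asm) mult.commute, subst (asm) indicator_sqrt_interval) (use ab out in auto)
  have "integrable lborel (\<lambda>r. (J r * (2 * r * h (r\<^sup>2))) * indicator {sqrt a..sqrt b} r)"
  proof (rule borel_integrable_atLeastAtMost)
    fix r assume "sqrt a \<le> r"
    then have "0 < r" using sa by linarith
    then show "isCont (\<lambda>r. J r * (2 * r * h (r\<^sup>2))) r"
      using hc by (intro isCont_mult[OF J_cont]) (auto simp: continuous_on_eq_continuous_at)
  qed
  then show ?B
    by (subst (asm) indicator_sqrt_interval) (use ab out in auto)
qed

text \<open>By \<open>M_distr\<close> the weak derivative of \<open>p\<close> is M / r^n. The
  classical derivative of \<open>J\<close> is the same, and integrating the derivative of J r * g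
  (r^2) over the support of \<open>g\<close> puts it in the same weak form.\<close>

lemma J_distr:
  assumes g: "smooth g" and g': "\<And>t. (g has_real_derivative g' t) (at t)" "smooth g'"
    and ab: "0 < a" "a < b" and out: "\<And>t. t \<le> a \<or> b \<le> t \<Longrightarrow> g t = 0"
    and out': "\<And>t. t \<le> a \<or> b \<le> t \<Longrightarrow> g' t = 0"
  shows "(\<integral>r. indicator {0<..} r * ((p r - J r) * (2 * r * g' (r\<^sup>2))) \<partial>lborel) = 0"
proof -
  let ?F = "\<lambda>r. M r / r ^ n * g (r\<^sup>2)" and ?G = "\<lambda>r. J r * (2 * r * g' (r\<^sup>2))"
  note int = J_distr_int[OF smooth_continuous[OF g'(2)] ab out']
  have sa: "sqrt a > 0" "sqrt a \<le> sqrt b" using ab by auto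
  have gc: "isCont (\<lambda>r. g (r\<^sup>2)) r" "isCont (\<lambda>r. g' (r\<^sup>2)) r" for r
    by (intro isCont_square smooth_continuous g g'(2))+
  have int3: "integrable lborel (\<lambda>r. (?F r) * indicator {sqrt a..sqrt b} r)"
  proof (rule borel_integrable_atLeastAtMost)
    fix r assume "sqrt a \<le> r"
    then have "0 < r" using sa(1) by linarith
    then show "isCont (\<lambda>r. ?F r) r"
      by (auto intro!: continuous_intros M_cont gc)
  qed
  have int4: "integrable lborel (\<lambda>r. (?G r) * indicator {sqrt a..sqrt b} r)"
  proof (rule borel_integrable_atLeastAtMost)
    fix r assume "sqrt a \<le> r"
    then have "0 < r" using sa(1) by linarith
    then show "isCont (\<lambda>r. ?G r) r"
      by (auto intro!: continuous_intros J_cont gc)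
  qed
  have "(\<integral>r. (?F r + ?G r) * indicator {sqrt a..sqrt b} r \<partial>lborel)
      = J (sqrt b) * g ((sqrt b)\<^sup>2) - J (sqrt a) * g ((sqrt a)\<^sup>2)"
  proof (rule integral_FTC_Icc_real[OF sa(2)])
    fix r assume r: "sqrt a \<le> r" "r \<le> sqrt b"
    then have r0: "r > 0" using sa by linarith
    have "((\<lambda>r. g (r\<^sup>2)) has_real_derivative g' (r\<^sup>2) * (2 * r)) (at r)"
      by (rule DERIV_chain2[OF g'(1)]) (auto intro!: derivative_eq_intros)
    from DERIV_mult[OF J[OF r0] this]
    show "((\<lambda>r. J r * g (r\<^sup>2)) has_real_derivative ?F r + ?G r) (at r)"
      by (simp add: mult_ac)
    show "isCont (\<lambda>r. ?F r + ?G r) r"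
      using r0 by (auto intro!: continuous_intros M_cont J_cont gc)
  qed
  also have "\<dots> = 0" using out ab by simp
  finally have "(\<integral>r. (?F r) * indicator {sqrt a..sqrt b} r \<partial>lborel)
     + (\<integral>r. (?G r) * indicator {sqrt a..sqrt b} r \<partial>lborel) = 0"
    by (simp only: distrib_right Bochner_Integration.integral_add[OF int3 int4])
  moreover have "(\<lambda>r. (?F r) * indicator {sqrt a..sqrt b} r) = (\<lambda>r. indicator {0<..} r * (?F r))"
    by (rule ext, rule indicator_sqrt_interval) (use ab out out' in auto)
  moreover have "(\<lambda>r. (?G r) * indicator {sqrt a..sqrt b} r) = (\<lambda>r. indicator {0<..} r * (?G r))"
    by (rule ext, rule indicator_sqrt_interval) (use ab out out' in auto)
  ultimately show ?thesis
    using M_distr[OF g g'(1) ab out] Bochner_Integration.integral_diff[OF int]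
    by (simp add: algebra_simps)
qed

end

end

text \<open>Written with r^n in place of r^(n-1), so that n = 0 fits the same formula in spite of
  truncated subtraction.\<close>

lemma DERIV_power_quotient:
  "r > 0 \<Longrightarrow> ((\<lambda>r::real. r ^ n) has_real_derivative real n / r * r ^ n) (at r)"
  using DERIV_pow[of n r UNIV] by (cases n) auto

text \<open>All that is kept of square integrability at infinity: the weight r^n is at least 1 for r
  >= 1. It forbids solutions that stay away from 0, without presupposing a pointwise limit.\<close>

definition vanishing_tail :: "(real \<Rightarrow> real) \<Rightarrow> bool" where
  "vanishing_tail y \<longleftrightarrow> ((\<lambda>r. integral {r..r+1} (\<lambda>s. (y s)\<^sup>2)) \<longlongrightarrow> 0) at_top"

context radial_distribution
begin

text \<open>The du Bois-Reymond argument in the variable r^2: \<open>p - J\<close> annihilates all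
  derivatives of test functions, hence is constant almost everywhere.\<close>

lemma p_eq_J:
  assumes J: "\<And>r. r > 0 \<Longrightarrow> (J has_real_derivative M r / r ^ n) (at r)"
  obtains C where "AE r in lborel. r > 0 \<longrightarrow> p r = J r + C"
proof -
  define T where "T = (\<lambda>h. \<integral>r. indicator {0<..} r * ((p r - J r) * (2 * r * h (r\<^sup>2))) \<partial>lborel)"
  have T_int: "integrable lborel (\<lambda>r. indicator {0<..} r * ((p r - J r) * (2 * r * h (r\<^sup>2))))"
    if "continuous_on UNIV h" "0 < a" "a < b" "\<And>t. t \<le> a \<or> b \<le> t \<Longrightarrow> h t = 0" for a b h
    using Bochner_Integration.integrable_diff[OF J_distr_int[OF J that]] by (simp add: algebra_simps)
  \<comment> \<open>A fixed reference bump; subtracting a multiple of it gives any other bump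
    integral 0.\<close>
  define \<rho> where "\<rho> = bump 1 1 2"
  have \<rho>: "smooth \<rho>" "\<And>t. t \<le> 1 \<or> 2 \<le> t \<Longrightarrow> \<rho> t = 0"
    unfolding \<rho>_def by (auto simp: smooth_bump intro!: bump_outside)
  obtain G where G: "\<And>t. (G has_real_derivative \<rho> t) (at t)"
    using antiderivative_exists[OF smooth_continuous[OF \<rho>(1)]] by blast
  have G_pos: "G 2 - G 1 > 0"
  proof -
    have "G 1 < G 2"
      by (rule DERIV_pos_imp_increasing_open[of 1 2 G])
         (use G bump_pos[of 1 1 _ 2] in \<open>auto simp: \<rho>_def intro!: exI continuous_at_imp_continuous_on DERIV_isCont\<close>)
    then show ?thesis by simp
  qed
  \<comment> \<open>If p = J + C, then \<open>T \<rho>\<close> is \<open>C\<close> times the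
    integral of the reference bump, because 2 r dr = d (r^2). This forces the constant.\<close>
  define C where "C = T \<rho> / (G 2 - G 1)"
  have T_bump: "(\<integral>r. indicator {0<..} r * ((p r - J r - C) * (2 * r * bump c a b (r\<^sup>2))) \<partial>lborel) = 0"
    if c: "c > 0" and ab: "0 < a" "a < b" for a b c
  proof -
    define h where "h = bump c a b"
    define a' b' where "a' = min a 1" and "b' = max b 2"
    have ab': "0 < a'" "a' < b'" using ab by (auto simp: a'_def b'_def)
    have h: "smooth h" "\<And>t. t \<le> a \<or> b \<le> t \<Longrightarrow> h t = 0"
      unfolding h_def using c by (auto simp: smooth_bump intro!: bump_outside)
    obtain F where F: "\<And>t. (F has_real_derivative h t) (at t)"
      using antiderivative_exists[OF smooth_continuous[OF h(1)]] by blast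
    have Gout: "G t = G 1" if "t \<le> 1" for t
      using constant_if_deriv_zero[OF G, of t 1] that \<rho> by simp
    have Gout2: "G t = G 2" if "2 \<le> t" for t
      using constant_if_deriv_zero[OF G, of 2 t] that \<rho> by simp
    have Fout: "F t = F a'" if "t \<le> a'" for t
      using constant_if_deriv_zero[OF F, of t a'] that h by (simp add: a'_def)
    have Fout2: "F t = F b'" if "b' \<le> t" for t
      using constant_if_deriv_zero[OF F, of b' t] that h by (simp add: b'_def)
    define I where "I = F b' - F a'"
    \<comment> \<open>With this multiple of \<open>\<rho>\<close> removed, \<open>h\<close> has
      integral 0, so its primitive \<open>g\<close> vanishes on both sides of [a', b'] and is
      admissible in \<open>J_distr\<close>.\<close>
    define k where "k = I / (G 2 - G 1)"
    define g where "g = (\<lambda>t. F t - F a' - k * (G t - G 1))"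
    define g' where "g' = (\<lambda>t. h t + (- k) * \<rho> t)"
    have g: "(g has_real_derivative g' t) (at t)" for t
      unfolding g_def g'_def by (auto intro!: derivative_eq_intros F G)
    have sg': "smooth g'"
      unfolding g'_def by (intro smooth_add smooth_mult smooth_const h \<rho>)
    have sg: "smooth g" by (rule smooth_realI[OF g sg'])
    have out: "g t = 0" if "t \<le> a' \<or> b' \<le> t" for t
      using that
    proof
      assume "t \<le> a'"
      then show ?thesis using Fout[of t] Gout[of t] by (simp add: g_def a'_def)
    next
      assume "b' \<le> t"
      then show ?thesis using Fout2[of t] Gout2[of t] G_pos
        by (simp add: g_def b'_def k_def I_def)
    qed
    have out': "g' t = 0" if "t \<le> a' \<or> b' \<le> t" for t
      using that h(2)[of t] \<rho>(2)[of t] by (auto simp: g'_def a'_def b'_def)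
    have hout: "t \<le> a' \<or> b' \<le> t \<Longrightarrow> h t = 0" "t \<le> a' \<or> b' \<le> t \<Longrightarrow> \<rho> t = 0" for t
      using h(2)[of t] \<rho>(2)[of t] by (auto simp: a'_def b'_def)
    have "0 = (\<integral>r. indicator {0<..} r * ((p r - J r) * (2 * r * g' (r\<^sup>2))) \<partial>lborel)"
      using J_distr[OF J sg g sg' ab' out out'] by simp
    also have "\<dots> = (\<integral>r. indicator {0<..} r * ((p r - J r) * (2 * r * h (r\<^sup>2)))
         - k * (indicator {0<..} r * ((p r - J r) * (2 * r * \<rho> (r\<^sup>2)))) \<partial>lborel)"
      by (rule Bochner_Integration.integral_cong) (auto simp: g'_def algebra_simps)
    also have "\<dots> = T h - k * T \<rho>"
      unfolding T_def
      by (subst Bochner_Integration.integral_diff)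
         (use ab' hout h \<rho> in \<open>auto intro!: T_int[of _ a' b'] integrable_mult_right smooth_continuous\<close>)
    finally have Th: "T h = I * C"
      by (simp add: k_def C_def)
    have hsq: "isCont (\<lambda>r. h (r\<^sup>2)) r" for r
      by (intro isCont_square smooth_continuous h)
    have sa: "0 < sqrt a'" "sqrt a' \<le> sqrt b'" using ab' by auto
    have I_eq: "(\<integral>r. (2 * r * h (r\<^sup>2)) * indicator {sqrt a'..sqrt b'} r \<partial>lborel) = F ((sqrt b')\<^sup>2) - F ((sqrt a')\<^sup>2)"
    proof (rule integral_FTC_Icc_real[OF sa(2)])
      show "((\<lambda>r. F (r\<^sup>2)) has_real_derivative 2 * r * h (r\<^sup>2)) (at r)" for r
      proof -
        have "((\<lambda>r. r\<^sup>2) has_real_derivative 2 * r) (at r)"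
          by (auto intro!: derivative_eq_intros)
        from DERIV_chain2[OF F this] show ?thesis by (simp add: mult.commute)
      qed
      show "isCont (\<lambda>r. 2 * r * h (r\<^sup>2)) r" for r
        by (intro continuous_intros hsq)
    qed
    have I_int: "integrable lborel (\<lambda>r. (2 * r * h (r\<^sup>2)) * indicator {sqrt a'..sqrt b'} r)"
      by (rule borel_integrable_atLeastAtMost) (intro continuous_intros hsq)
    have ind: "(2 * r * h (r\<^sup>2)) * indicator {sqrt a'..sqrt b'} r = indicator {0<..} r * (2 * r * h (r\<^sup>2))" for r
      by (rule indicator_sqrt_interval) (use ab' hout in auto)
    have "(\<integral>r. indicator {0<..} r * ((p r - J r - C) * (2 * r * h (r\<^sup>2))) \<partial>lborel)
      = (\<integral>r. indicator {0<..} r * ((p r - J r) * (2 * r * h (r\<^sup>2))) - C * (indicator {0<..} r * (2 * r * h (r\<^sup>2))) \<partial>lborel)"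
      by (rule Bochner_Integration.integral_cong) (auto simp: algebra_simps)
    also have "\<dots> = T h - C * I"
      using I_int I_eq ab' unfolding ind T_def I_def
      by (subst Bochner_Integration.integral_diff)
         (use ab' hout h in \<open>auto intro!: T_int[of _ a' b'] integrable_mult_right smooth_continuous\<close>)
    finally show ?thesis unfolding h_def Th[unfolded h_def] by simp
  qed
  define X where "X = (\<lambda>r. (p r - J r - C) * (2 * r))"
  have X_int': "integrable lborel (\<lambda>r. indicator {a..b} r * X r)" if ab: "0 < a" for a b
  proof -
    have "integrable lborel (\<lambda>r. indicator {a..b} r * (p r * (2 * r)))"
      by (rule p_mult_int[OF ab]) (auto intro!: continuous_intros)
    moreover have "integrable lborel (\<lambda>r. ((J r + C) * (2 * r)) * indicator {a..b} r)"
      by (rule borel_integrable_atLeastAtMost) (use ab in \<open>auto intro!: continuous_intros DERIV_isCont[OF J]\<close>)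
    ultimately have "integrable lborel (\<lambda>r. indicator {a..b} r * (p r * (2 * r)) - ((J r + C) * (2 * r)) * indicator {a..b} r)"
      by (rule Bochner_Integration.integrable_diff)
    then show ?thesis by (simp add: X_def algebra_simps)
  qed
  have X_int: "integrable lborel (\<lambda>r. indicator {a<..<b} r * X r)" if ab: "0 < a" for a b
  proof -
    have "integrable lborel (\<lambda>r. indicator {a<..<b} r *\<^sub>R (indicator {a..b} r * X r))"
      by (intro integrable_mult_indicator X_int' ab) auto
    also have "(\<lambda>r. indicator {a<..<b} r *\<^sub>R (indicator {a..b} r * X r)) = (\<lambda>r. indicator {a<..<b} r * X r)"
      by (auto simp: indicator_def fun_eq_iff)
    finally show ?thesis .
  qed
  \<comment> \<open>The bumps increase their slopes until they become the indicator of (a, b); being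
    at most 1, they leave |X| on (a, b) as a dominating function.\<close>
  have X_zero: "(\<integral>r. indicator {a<..<b} r * X r \<partial>lborel) = 0" if ab: "0 < a" "a < b" for a b
  proof -
    let ?b = "\<lambda>k r. bump (real (Suc k)) (a\<^sup>2) (b\<^sup>2) (r\<^sup>2)"
    let ?s = "\<lambda>k r. indicator {a<..<b} r * X r * ?b k r"
    have ab2: "0 < a\<^sup>2" "a\<^sup>2 < b\<^sup>2" using ab by (auto intro!: power_strict_mono)
    have mem: "a\<^sup>2 < r\<^sup>2 \<and> r\<^sup>2 < b\<^sup>2 \<longleftrightarrow> a < r \<and> r < b" if "r > 0" for r
      using that ab by (auto intro!: power_strict_mono dest: power_less_imp_less_base)
    have "(\<lambda>k. \<integral>r. ?s k r \<partial>lborel) \<longlonglongrightarrow> (\<integral>r. indicator {a<..<b} r * X r \<partial>lborel)"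
    proof (rule integral_dominated_convergence[where w="\<lambda>r. norm (indicator {a<..<b} r * X r)"])
      show m: "(\<lambda>r. indicator {a<..<b} r * X r) \<in> borel_measurable lborel"
        using X_int[OF ab(1)] by simp
      have [measurable]: "bump c x y \<in> borel_measurable borel" for c x y
        by (intro borel_measurable_continuous_onI smooth_continuous smooth_bump)
      show "?s k \<in> borel_measurable lborel" for k
        by (rule borel_measurable_times[OF m]) measurable
      show "integrable lborel (\<lambda>r. norm (indicator {a<..<b} r * X r))"
        using X_int[OF ab(1)] by (rule integrable_norm)
      show "AE r in lborel. (\<lambda>k. ?s k r) \<longlonglongrightarrow> indicator {a<..<b} r * X r"
      proof (rule AE_I2)
        fix r
        have "(\<lambda>k. ?s k r) \<longlonglongrightarrow> indicator {a<..<b} r * X r * indicator {a\<^sup>2<..<b\<^sup>2} (r\<^sup>2)"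
          by (intro tendsto_mult tendsto_const bump_tendsto)
        also have "indicator {a<..<b} r * X r * indicator {a\<^sup>2<..<b\<^sup>2} (r\<^sup>2) = indicator {a<..<b} r * X r"
          using mem[of r] ab by (auto simp: indicator_def)
        finally show "(\<lambda>k. ?s k r) \<longlonglongrightarrow> indicator {a<..<b} r * X r" .
      qed
      show "AE r in lborel. norm (?s k r) \<le> norm (indicator {a<..<b} r * X r)" for k
        by (rule AE_I2) (auto simp: abs_mult bump_bounds intro!: mult_left_le)
    qed
    moreover have "(\<integral>r. ?s k r \<partial>lborel) = 0" for k
    proof -
      have "(\<integral>r. ?s k r \<partial>lborel) = (\<integral>r. indicator {0<..} r * ((p r - J r - C) * (2 * r * ?b k r)) \<partial>lborel)"
      proof (rule Bochner_Integration.integral_cong[OF refl])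
        fix r
        show "?s k r = indicator {0<..} r * ((p r - J r - C) * (2 * r * ?b k r))"
        proof (cases "0 < r \<and> \<not> (a < r \<and> r < b)")
          case True
          then have "?b k r = 0"
            using mem[of r] by (intro bump_outside) auto
          then show ?thesis by simp
        next
          case False
          then show ?thesis using ab by (auto simp: X_def indicator_def)
        qed
      qed
      then show ?thesis using T_bump[of "real (Suc k)", OF _ ab2] by simp
    qed
    ultimately have "(\<lambda>k::nat. 0) \<longlonglongrightarrow> (\<integral>r. indicator {a<..<b} r * X r \<partial>lborel)"
      by (simp only:)
    then show ?thesis by (simp only: LIMSEQ_const_iff)
  qed
  have "AE r in lborel. r > 0 \<longrightarrow> X r = 0"
    by (rule AE_zero_if_interval_integrals_zero[OF X_int X_zero])
  then have "AE r in lborel. r > 0 \<longrightarrow> p r = J r + C"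
    by eventually_elim (auto simp: X_def)
  then show ?thesis by (rule that)
qed

text \<open>The weight r^((n+1)/2) in \<open>f_bound\<close> balances the two contributions: the
  integral of t^n over [0, r] is r^(n+1) / (n+1), so both become multiples of the weight.\<close>

lemma M_bound_sqrt:
  assumes "0 < r"
  shows "\<bar>M r\<bar> \<le> K * ((\<integral>r. indicator {0<..} r * (r ^ n * (p r)\<^sup>2) \<partial>lborel) + 1) * sqrt r ^ Suc n"
proof -
  define l where "l = sqrt r ^ Suc n"
  define A where "A = (\<integral>r. indicator {0<..} r * (r ^ n * (p r)\<^sup>2) \<partial>lborel)"
  have l: "l > 0" "l * l = r ^ Suc n"
    using assms by (auto simp: l_def power_mult_distrib[symmetric] simp del: power_Suc)
  let ?w = "\<lambda>t. K * (l * (indicator {0<..} t * (t ^ n * (p t)\<^sup>2)) + (1 / l) * (t ^ n * indicator {0..r} t))"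
  have i1: "integrable lborel (\<lambda>t. t ^ n * indicator {0..r} t)"
    by (rule borel_integrable_atLeastAtMost) auto
  have wi: "integrable lborel ?w"
    by (intro integrable_mult_right Bochner_Integration.integrable_add p_L2 i1)
  have "\<bar>M r\<bar> \<le> (\<integral>t. norm (indicator {0..r} t * f t) \<partial>lborel)"
    unfolding M_def using integral_norm_bound by (metis real_norm_def)
  also have "\<dots> \<le> (\<integral>t. ?w t \<partial>lborel)"
  proof (rule integral_mono_AE'[OF wi])
    show "AE t in lborel. norm (indicator {0..r} t * f t) \<le> ?w t"
    proof (rule AE_I2)
      fix t :: real
      show "norm (indicator {0..r} t * f t) \<le> ?w t"
      proof (cases "0 < t \<and> t \<le> r")
        case True
        then show ?thesis using f_bound[OF l(1), of t] by simp
      next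
        case False
        then show ?thesis using K_nonneg l by (auto simp: indicator_def f_def)
      qed
    qed
    show "AE t in lborel. 0 \<le> ?w t"
      by (rule AE_I2) (use K_nonneg l in \<open>auto simp: indicator_def\<close>)
  qed
  also have "\<dots> = K * (l * A + (1 / l) * (r ^ Suc n / real (Suc n)))"
    using assms integral_power[of 0 r n]
    by (simp add: Bochner_Integration.integral_add integrable_mult_right p_L2 i1 A_def)
  also have "\<dots> \<le> K * (l * A + (1 / l) * r ^ Suc n)"
    using K_nonneg l assms by (intro mult_left_mono add_mono order_refl) (auto simp: field_simps)
  also have "\<dots> = K * (A + 1) * l"
    using l by (simp add: field_simps flip: l(2))
  finally show ?thesis by (simp only: A_def l_def)
qed

text \<open>A bootstrap at the origin. The first bound on \<open>M\<close> gives |J'| <= B1 / sqrt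
  r, so \<open>J\<close> and hence \<open>p\<close> are bounded near 0; inserted into the flux, this
  improves to |M| <= K B r^(n+1), so the derivative is O(r).\<close>

lemma regularity:
  assumes n2: "n \<le> 2"
  obtains y y1 where "continuous_on UNIV y"
    "\<And>r. r > 0 \<Longrightarrow> (y has_real_derivative y1 r) (at r)"
    "\<And>r. r > 0 \<Longrightarrow> (y1 has_real_derivative (1 - v r) * y r - real n / r * y1 r) (at r)"
    "\<exists>B. \<forall>r. 0 < r \<longrightarrow> r \<le> 1 \<longrightarrow> \<bar>y1 r\<bar> \<le> B * r"
    "vanishing_tail y" "AE r in lborel. r > 0 \<longrightarrow> p r = y r"
proof -
  obtain J where J: "\<And>r. r > 0 \<Longrightarrow> (J has_real_derivative M r / r ^ n) (at r)"
    using J_exists by blast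
  obtain C where C: "AE r in lborel. r > 0 \<longrightarrow> p r = J r + C"
    using p_eq_J[OF J] by blast
  define B1 where "B1 = K * ((\<integral>r. indicator {0<..} r * (r ^ n * (p r)\<^sup>2) \<partial>lborel) + 1)"
  have B1: "B1 \<ge> 0"
  proof -
    have "0 \<le> (\<integral>r. indicator {0<..} r * (r ^ n * (p r)\<^sup>2) \<partial>lborel)"
      by (rule Bochner_Integration.integral_nonneg) (auto simp: indicator_def)
    then show ?thesis using K_nonneg by (simp add: B1_def)
  qed
  have dJ: "\<bar>M r / r ^ n\<bar> \<le> B1 / sqrt r" if r: "0 < r" "r \<le> 1" for r
  proof -
    \<comment> \<open>Here \<open>n2\<close> enters: the exponent (n + 1) / 2 - n is at least - 1 /
      2 exactly when n <= 2.\<close>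
    have "sqrt r ^ Suc n * sqrt r = sqrt r ^ (n + 2)" by simp
    also have "\<dots> \<le> sqrt r ^ (2 * n)"
      using n2 r by (intro power_decreasing) auto
    also have "\<dots> = r ^ n" using r by (simp add: power_mult)
    finally have "B1 * (sqrt r ^ Suc n * sqrt r) \<le> B1 * r ^ n" using B1 by (rule mult_left_mono)
    moreover have "\<bar>M r\<bar> * sqrt r \<le> B1 * sqrt r ^ Suc n * sqrt r"
      using M_bound_sqrt[OF r(1)] r unfolding B1_def by (intro mult_right_mono) auto
    ultimately have "\<bar>M r\<bar> * sqrt r \<le> B1 * r ^ n" by (simp add: mult.assoc)
    then show ?thesis using r by (simp add: field_simps)
  qed
  have J_bd: "\<bar>J r + C\<bar> \<le> \<bar>J 1\<bar> + 2 * B1 + \<bar>C\<bar>" if r: "0 < r" "r \<le> 1" for r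
  proof -
    \<comment> \<open>Adding or subtracting 2 B1 sqrt r, whose derivative is B1 / sqrt r, makes
      \<open>J\<close> monotone on (0, 1].\<close>
    have d: "((\<lambda>r. J r + c * sqrt r) has_real_derivative M x / x ^ n + c * (inverse (sqrt x) / 2)) (at x)"
      if "x > 0" for x c
      using that by (auto intro!: derivative_eq_intros J)
    have "J r + (2 * B1) * sqrt r \<le> J 1 + (2 * B1) * sqrt 1"
    proof (rule DERIV_nonneg_imp_nondecreasing[OF r(2), of "\<lambda>r. J r + (2 * B1) * sqrt r"])
      fix x assume x: "r \<le> x" "x \<le> 1"
      have "0 \<le> M x / x ^ n + (2 * B1) * (inverse (sqrt x) / 2)"
      proof -
        have "B1 / sqrt x = 2 * B1 * (inverse (sqrt x) / 2)" by (simp add: field_simps)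
        then show ?thesis using dJ[of x] x r by linarith
      qed
      then show "\<exists>y. ((\<lambda>r. J r + (2 * B1) * sqrt r) has_real_derivative y) (at x) \<and> 0 \<le> y"
        using d[OF less_le_trans[OF r(1) x(1)], of "2 * B1"] by blast
    qed
    moreover have "J r + (- 2 * B1) * sqrt r \<ge> J 1 + (- 2 * B1) * sqrt 1"
    proof (rule DERIV_nonpos_imp_nonincreasing[OF r(2), of "\<lambda>r. J r + (- 2 * B1) * sqrt r"])
      fix x assume x: "r \<le> x" "x \<le> 1"
      have "M x / x ^ n + (- 2 * B1) * (inverse (sqrt x) / 2) \<le> 0"
      proof -
        have "B1 / sqrt x = 2 * B1 * (inverse (sqrt x) / 2)" by (simp add: field_simps)
        then show ?thesis using dJ[of x] x r by linarith
      qed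
      then show "\<exists>y. ((\<lambda>r. J r + (- 2 * B1) * sqrt r) has_real_derivative y) (at x) \<and> y \<le> 0"
        using d[OF less_le_trans[OF r(1) x(1)], of "- 2 * B1"] by blast
    qed
    moreover have "0 \<le> B1 * sqrt r" using B1 r by simp
    ultimately show ?thesis by auto
  qed
  define B where "B = \<bar>J 1\<bar> + 2 * B1 + \<bar>C\<bar>"
  have B: "B \<ge> 0" using B1 by (simp add: B_def)
  have M_lin: "\<bar>M r\<bar> \<le> K * B * r ^ Suc n" if r: "0 < r" "r \<le> 1" for r
  proof -
    have i1: "integrable lborel (\<lambda>t. (K * B * r ^ n) * indicator {0..r} t)"
      by (rule borel_integrable_atLeastAtMost) auto
    have "\<bar>M r\<bar> \<le> (\<integral>t. norm (indicator {0..r} t * f t) \<partial>lborel)"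
      unfolding M_def using integral_norm_bound by (metis real_norm_def)
    also have "\<dots> \<le> (\<integral>t. (K * B * r ^ n) * indicator {0..r} t \<partial>lborel)"
    proof (rule integral_mono_AE'[OF i1])
      show "AE t in lborel. norm (indicator {0..r} t * f t) \<le> (K * B * r ^ n) * indicator {0..r} t"
        using C
      proof eventually_elim
        case (elim t)
        show ?case
        proof (cases "0 < t \<and> t \<le> r")
          case True
          then have "\<bar>p t\<bar> \<le> B" using elim J_bd[of t] r by (simp add: B_def)
          then have "\<bar>1 - v t\<bar> * \<bar>p t\<bar> \<le> K * B"
            using K K_nonneg by (intro mult_mono) auto
          moreover have "t ^ n \<le> r ^ n" using True by (intro power_mono) auto
          ultimately have "t ^ n * (\<bar>1 - v t\<bar> * \<bar>p t\<bar>) \<le> r ^ n * (K * B)"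
            by (intro mult_mono'[of "t ^ n" "r ^ n" "\<bar>1 - v t\<bar> * \<bar>p t\<bar>"]) (use True in auto)
          then show ?thesis using True by (simp add: f_def abs_mult mult_ac)
        next
          case False
          then show ?thesis using K_nonneg B r by (auto simp: indicator_def f_def)
        qed
      qed
      show "AE t in lborel. 0 \<le> (K * B * r ^ n) * indicator {0..r} t"
        by (rule AE_I2) (use K_nonneg B r in \<open>auto simp: indicator_def\<close>)
    qed
    also have "\<dots> = K * B * r ^ Suc n" using r by simp
    finally show ?thesis .
  qed
  \<comment> \<open>Extended by 0 the derivative is continuous on the whole line thanks to the
    linear bound, so its antiderivative \<open>y\<close> is continuous at 0 as well.\<close>
  define y1 where "y1 = (\<lambda>r. if r > 0 then M r / r ^ n else 0)"
  have y1_lin: "\<bar>y1 r\<bar> \<le> K * B * r" if r: "0 < r" "r \<le> 1" for r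
    using M_lin[OF r] r by (simp add: y1_def field_simps)
  have y1_cont: "isCont y1 r" for r
  proof -
    consider "r > 0" | "r < 0" | "r = 0" by linarith
    then show ?thesis
    proof cases
      case 1
      have "isCont (\<lambda>r. M r / r ^ n) r" using 1 by (auto intro!: continuous_intros M_cont)
      moreover have "eventually (\<lambda>r. M r / r ^ n = y1 r) (nhds r)"
        using eventually_nhds_in_open[of "{0<..}" r] 1 by (auto simp: y1_def elim!: eventually_mono)
      ultimately show ?thesis using isCont_cong[of "\<lambda>r. M r / r ^ n" y1 r] by simp
    next
      case 2
      have "eventually (\<lambda>r. 0 = y1 r) (nhds r)"
        using eventually_nhds_in_open[of "{..<0}" r] 2 by (auto simp: y1_def elim!: eventually_mono)
      then show ?thesis using isCont_cong[of "\<lambda>_. 0" y1 r] by simp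
    next
      case 3
      have lim: "((\<lambda>r. K * B * \<bar>r\<bar>) \<longlongrightarrow> K * B * \<bar>0\<bar>) (at (0::real))"
        by (intro tendsto_intros)
      have "eventually (\<lambda>r. norm (y1 r) \<le> K * B * \<bar>r\<bar>) (at (0::real))"
        unfolding eventually_at
      proof (intro exI[of _ 1] conjI ballI impI)
        fix x :: real assume "x \<noteq> 0 \<and> dist x 0 < 1"
        moreover have "0 \<le> K * B * \<bar>x\<bar>" using K_nonneg B by simp
        ultimately show "norm (y1 x) \<le> K * B * \<bar>x\<bar>"
          using y1_lin[of x] by (cases "x > 0") (simp_all add: y1_def)
      qed simp
      then have "(y1 \<longlongrightarrow> 0) (at 0)"
        using lim by (intro Lim_null_comparison[of y1]) auto
      then show ?thesis using 3 by (simp add: isCont_def y1_def)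
    qed
  qed
  obtain Y where Y: "\<And>r. (Y has_real_derivative y1 r) (at r)"
    using antiderivative_exists[of y1] y1_cont by (auto simp: continuous_on_eq_continuous_at)
  define y where "y = (\<lambda>r. Y r - Y 1 + J 1 + C)"
  have y: "(y has_real_derivative y1 r) (at r)" for r
    unfolding y_def by (auto intro!: derivative_eq_intros Y)
  have y_cont: "isCont y r" for r using y DERIV_isCont by blast
  have yJ: "y r = J r + C" if r: "r > 0" for r
  proof -
    have d: "((\<lambda>r. y r - J r) has_real_derivative 0) (at x)" if "x > 0" for x
      using DERIV_diff[OF y J[OF that]] that by (simp add: y1_def)
    have "(\<lambda>r. y r - J r) r = (\<lambda>r. y r - J r) 1"
      by (rule DERIV_isconst3[of 0 "max r 1 + 1"]) (use r d in auto)
    then show ?thesis by (simp add: y_def)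
  qed
  have py: "AE r in lborel. r > 0 \<longrightarrow> p r = y r"
    using C by eventually_elim (simp add: yJ)
  define g where "g = (\<lambda>r. r ^ n * ((1 - v r) * y r))"
  have g_cont: "continuous_on UNIV g"
    unfolding g_def using y_cont v_cont by (intro continuous_intros continuous_at_imp_continuous_on) (auto simp: continuous_on_eq_continuous_at)
  obtain G where G: "\<And>r. (G has_real_derivative g r) (at r)"
    using antiderivative_exists[OF g_cont] by blast
  have [measurable]: "g \<in> borel_measurable borel"
    using g_cont by (rule borel_measurable_continuous_onI)
  \<comment> \<open>Since \<open>p\<close> and \<open>y\<close> agree almost everywhere,
    \<open>M\<close> is a primitive of the continuous \<open>g\<close>, hence classically
    differentiable; this is the second derivative of \<open>y\<close>.\<close>
  have MG: "M s = G s - G 0" if "s > 0" for s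
  proof -
    have "M s = (\<integral>r. g r * indicator {0..s} r \<partial>lborel)"
      unfolding M_def
    proof (rule integral_cong_AE)
      show "AE r in lborel. indicator {0..s} r * f r = g r * indicator {0..s} r"
        using py AE_lborel_singleton[of 0]
        by eventually_elim (auto simp: indicator_def f_def g_def)
    qed measurable
    also have "\<dots> = G s - G 0"
      by (rule integral_FTC_Icc_real) (use that G g_cont in \<open>auto simp: continuous_on_eq_continuous_at\<close>)
    finally show ?thesis .
  qed
  have y1': "(y1 has_real_derivative (1 - v r) * y r - real n / r * y1 r) (at r)" if r: "r > 0" for r
  proof -
    have rn: "r ^ n \<noteq> 0" using r by simp
    have "((\<lambda>r. (G r - G 0) / r ^ n) has_real_derivative
        (g r * r ^ n - (G r - G 0) * (real n / r * r ^ n)) / (r ^ n * r ^ n)) (at r)"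
      using DERIV_divide[OF DERIV_diff[OF G DERIV_const[of "G 0"]] DERIV_power_quotient[OF r] rn] by simp
    moreover have "(g r * r ^ n - (G r - G 0) * (real n / r * r ^ n)) / (r ^ n * r ^ n)
        = (1 - v r) * y r - real n / r * y1 r"
      unfolding MG[OF r, symmetric] using r by (simp add: y1_def g_def field_simps)
    ultimately have "((\<lambda>r. (G r - G 0) / r ^ n) has_real_derivative (1 - v r) * y r - real n / r * y1 r) (at r)"
      by simp
    then show ?thesis
      by (rule has_field_derivative_transform_within_open[where S="{0<..}"]) (use r MG in \<open>auto simp: y1_def\<close>)
  qed
  have "vanishing_tail y"
    unfolding vanishing_tail_def
  \<comment> \<open>The window integrals are squeezed by the tails of the convergent integral in
    \<open>p_L2\<close>.\<close>
  proof (rule real_tendsto_sandwich[where f="\<lambda>_. 0"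
        and h="\<lambda>R. \<integral>r. indicator {R..} r * (indicator {0<..} r * (r ^ n * (p r)\<^sup>2)) \<partial>lborel"])
    let ?h = "\<lambda>r. indicator {0<..} r * (r ^ n * (p r)\<^sup>2)"
    have "((\<lambda>R. \<integral>r. indicator {R..} r * ?h r \<partial>lborel) \<longlongrightarrow> (\<integral>r. 0 \<partial>(lborel :: real measure))) at_top"
    proof (rule integral_dominated_convergence_at_top[where w="?h"])
      show "integrable lborel ?h" by (rule p_L2)
      show "AE r in lborel. ((\<lambda>R. indicator {R..} r * ?h r) \<longlongrightarrow> 0) at_top"
      proof (rule AE_I2)
        fix r :: real
        have "eventually (\<lambda>R. indicator {R..} r * ?h r = 0) at_top"
          using eventually_gt_at_top[of r] by eventually_elim auto
        then show "((\<lambda>R. indicator {R..} r * ?h r) \<longlongrightarrow> 0) at_top"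
          by (rule tendsto_eventually)
      qed
      show "eventually (\<lambda>R. AE r in lborel. norm (indicator {R..} r * ?h r) \<le> ?h r) at_top"
        by (intro always_eventually allI AE_I2) (auto simp: indicator_def)
    qed measurable
    then show "((\<lambda>R. \<integral>r. indicator {R..} r * ?h r \<partial>lborel) \<longlongrightarrow> 0) at_top" by simp
    show "((\<lambda>_. 0) \<longlongrightarrow> (0::real)) at_top" by simp
    have ysq: "continuous_on S (\<lambda>s. (y s)\<^sup>2)" for S :: "real set"
      using y_cont by (intro continuous_intros continuous_at_imp_continuous_on) auto
    show "eventually (\<lambda>r. 0 \<le> integral {r..r+1} (\<lambda>s. (y s)\<^sup>2)) at_top"
      by (rule always_eventually)
         (auto intro!: Henstock_Kurzweil_Integration.integral_nonneg integrable_continuous_real ysq)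
    show "eventually (\<lambda>r. integral {r..r+1} (\<lambda>s. (y s)\<^sup>2) \<le> (\<integral>s. indicator {r..} s * ?h s \<partial>lborel)) at_top"
      using eventually_ge_at_top[of 1]
    proof eventually_elim
      case (elim R)
      have "set_integrable lborel {R..R+1} (\<lambda>s. (y s)\<^sup>2)"
        by (rule borel_integrable_atLeastAtMost'[OF ysq])
      then have "integral {R..R+1} (\<lambda>s. (y s)\<^sup>2) = (\<integral>s. indicator {R..R+1} s * (y s)\<^sup>2 \<partial>lborel)"
        using set_borel_integral_eq_integral(2) by (fastforce simp: set_lebesgue_integral_def)
      also have "\<dots> \<le> (\<integral>s. indicator {R..} s * ?h s \<partial>lborel)"
      proof (rule integral_mono_AE')
        have "integrable lborel (\<lambda>s. indicator {R..} s *\<^sub>R ?h s)"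
          by (intro integrable_mult_indicator p_L2) auto
        then show "integrable lborel (\<lambda>s. indicator {R..} s * ?h s)" by simp
        show "AE s in lborel. indicator {R..R+1} s * (y s)\<^sup>2 \<le> indicator {R..} s * ?h s"
          using py
        proof eventually_elim
          case (elim s)
          have "1 * (y s)\<^sup>2 \<le> s ^ n * (y s)\<^sup>2" if "R \<le> s"
            using that \<open>1 \<le> R\<close> by (intro mult_right_mono one_le_power) auto
          then show ?case using elim \<open>1 \<le> R\<close> by (auto simp: indicator_def)
        qed
        show "AE s in lborel. 0 \<le> indicator {R..} s * ?h s"
          by (rule AE_I2) (auto simp: indicator_def)
      qed
      finally show ?case .
    qed
  qed
  moreover have "continuous_on UNIV y" using y_cont by (simp add: continuous_at_imp_continuous_on)
  ultimately show ?thesis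
    using y y1' py y1_lin by (intro that[of y y1]) blast+
qed

end

section \<open>Second order radial equations\<close>

text \<open>The equation Laplace y = q y for a radial function in dimension n + 1. It is required
  for r > 0 only; the behaviour at the origin is always supplied as limits from the right.\<close>

definition radial_ode :: "nat \<Rightarrow> (real \<Rightarrow> real) \<Rightarrow> (real \<Rightarrow> real) \<Rightarrow> (real \<Rightarrow> real) \<Rightarrow> bool" where
  "radial_ode n q y y' \<longleftrightarrow> (\<forall>r>0. (y has_real_derivative y' r) (at r) \<and>
     (y' has_real_derivative q r * y r - real n / r * y' r) (at r))"

lemma radial_odeD:
  assumes "radial_ode n q y y'" "r > 0"
  shows "(y has_real_derivative y' r) (at r)"
    "(y' has_real_derivative q r * y r - real n / r * y' r) (at r)"
  using assms by (auto simp: radial_ode_def)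

section \<open>Monotonicity up to the limits at 0 and at infinity\<close>

lemma antimono_le_limit_right:
  fixes f :: "real \<Rightarrow> real"
  assumes "0 < b" "\<And>r. 0 < r \<Longrightarrow> r \<le> b \<Longrightarrow> (f has_real_derivative f' r) (at r)"
    "\<And>r. 0 < r \<Longrightarrow> r \<le> b \<Longrightarrow> f' r \<le> 0" "(f \<longlongrightarrow> L) (at_right 0)"
  shows "f b \<le> L"
proof (rule tendsto_lowerbound[OF assms(4)])
  show "\<forall>\<^sub>F r in at_right 0. f b \<le> f r"
    unfolding eventually_at_right_field
  proof (intro exI[of _ b] conjI allI impI)
    fix r assume r: "0 < r" "r < b"
    show "f b \<le> f r"
    proof (rule DERIV_nonpos_imp_nonincreasing[of r b f])
      fix x assume x: "r \<le> x" "x \<le> b"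
      then show "\<exists>y. (f has_real_derivative y) (at x) \<and> y \<le> 0"
        using assms(2,3)[of x] r by (intro exI[of _ "f' x"]) auto
    qed (use r in simp)
  qed (rule assms(1))
qed simp

lemma mono_ge_limit_right:
  fixes f :: "real \<Rightarrow> real"
  assumes "0 < b" "\<And>r. 0 < r \<Longrightarrow> r \<le> b \<Longrightarrow> (f has_real_derivative f' r) (at r)"
    "\<And>r. 0 < r \<Longrightarrow> r \<le> b \<Longrightarrow> f' r \<ge> 0" "(f \<longlongrightarrow> L) (at_right 0)"
  shows "L \<le> f b"
  using antimono_le_limit_right[of b "\<lambda>r. - f r" "\<lambda>r. - f' r" "- L"] assms
  by (simp add: DERIV_minus tendsto_minus)

lemma strict_mono_gt_limit_right:
  fixes f :: "real \<Rightarrow> real"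
  assumes b: "0 < b" and d: "\<And>r. 0 < r \<Longrightarrow> r \<le> b \<Longrightarrow> (f has_real_derivative f' r) (at r)"
    and f': "\<And>r. 0 < r \<Longrightarrow> r < b \<Longrightarrow> f' r > 0" and "(f \<longlongrightarrow> L) (at_right 0)"
  shows "L < f b"
proof -
  have "L \<le> f (b / 2)"
    by (rule mono_ge_limit_right[of _ f f']) (use assms in \<open>auto intro!: less_imp_le[OF f']\<close>)
  also have "f (b / 2) < f b"
  proof (rule DERIV_pos_imp_increasing_open[of "b/2" b f])
    show "continuous_on {b/2..b} f"
      using b by (intro continuous_at_imp_continuous_on ballI DERIV_isCont[OF d]) auto
    show "\<exists>y. (f has_real_derivative y) (at x) \<and> 0 < y" if "b / 2 < x" "x < b" for x
      using d[of x] f'[of x] that b by (intro exI[of _ "f' x"]) auto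
  qed (use b in simp)
  finally show ?thesis .
qed

lemma mono_le_limit_at_top:
  fixes f :: "real \<Rightarrow> real"
  assumes d: "\<And>r. a \<le> r \<Longrightarrow> (f has_real_derivative f' r) (at r)"
    and f': "\<And>r. a \<le> r \<Longrightarrow> f' r \<ge> 0" and lim: "(f \<longlongrightarrow> L) at_top"
  shows "f a \<le> L"
proof (rule tendsto_lowerbound[OF lim])
  show "\<forall>\<^sub>F r in at_top. f a \<le> f r"
    using eventually_ge_at_top[of a]
  proof eventually_elim
    case (elim r)
    show "f a \<le> f r"
    proof (rule DERIV_nonneg_imp_nondecreasing[OF elim])
      fix x assume x: "a \<le> x" "x \<le> r"
      then show "\<exists>y. (f has_real_derivative y) (at x) \<and> 0 \<le> y"
        using d f' by blast
    qed
  qed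
qed simp

lemma antimono_ge_limit_at_top:
  fixes f :: "real \<Rightarrow> real"
  assumes "\<And>r. a \<le> r \<Longrightarrow> (f has_real_derivative f' r) (at r)"
    "\<And>r. a \<le> r \<Longrightarrow> f' r \<le> 0" "(f \<longlongrightarrow> L) at_top"
  shows "L \<le> f a"
  using mono_le_limit_at_top[of a "\<lambda>r. - f r" "\<lambda>r. - f' r" "- L"] assms
  by (simp add: DERIV_minus tendsto_minus)

lemma strict_mono_lt_limit_at_top:
  fixes f :: "real \<Rightarrow> real"
  assumes d: "\<And>r. a \<le> r \<Longrightarrow> (f has_real_derivative f' r) (at r)"
    and f': "\<And>r. a < r \<Longrightarrow> f' r > 0" and lim: "(f \<longlongrightarrow> L) at_top"
  shows "f a < L"
proof -
  have "f a < f (a + 1)"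
  proof (rule DERIV_pos_imp_increasing_open[of a "a + 1" f])
    show "continuous_on {a..a + 1} f"
      by (intro continuous_at_imp_continuous_on ballI DERIV_isCont[OF d]) auto
    show "\<exists>y. (f has_real_derivative y) (at x) \<and> 0 < y" if "a < x" "x < a + 1" for x
      using d[of x] f'[of x] that by (intro exI[of _ "f' x"]) auto
  qed simp
  also have "f (a + 1) \<le> L"
    by (rule mono_le_limit_at_top[of _ f f']) (use assms in \<open>auto intro!: less_imp_le[OF f']\<close>)
  finally show ?thesis .
qed

text \<open>Positivity is asked for just to the right of \<open>a\<close>, not at \<open>a\<close>:
  the applications start at the origin, where only a limit is known, or at a zero of the
  function.\<close>

lemma first_zero:
  fixes f :: "real \<Rightarrow> real"
  assumes c: "\<And>x. a < x \<Longrightarrow> x \<le> s \<Longrightarrow> isCont f x" and e: "e > 0" and pos: "\<And>x. a < x \<Longrightarrow> x < a + e \<Longrightarrow> f x > 0"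
    and s: "a < s" "f s \<le> 0"
  obtains t where "a < t" "t \<le> s" "f t = 0" "\<And>x. a < x \<Longrightarrow> x < t \<Longrightarrow> f x > 0"
proof -
  define b where "b = a + e / 2"
  have b: "a < b" "b < a + e" using e by (auto simp: b_def)
  have fc: "continuous_on {b..t} f" if "t \<le> s" for t
    using b that by (intro continuous_at_imp_continuous_on ballI c) auto
  define S where "S = {b..s} \<inter> f -` {..0}"
  have "closed S"
    unfolding S_def by (intro continuous_closed_preimage fc order_refl closed_atMost closed_atLeastAtMost)
  then have "compact ({b..s} \<inter> S)" by (intro compact_Int_closed compact_Icc)
  moreover have "{b..s} \<inter> S = S" by (auto simp: S_def)
  ultimately have "compact S" by simp
  moreover have "s \<in> S"
    using s pos[of s] b by (cases "s < b") (auto simp: S_def)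
  ultimately obtain t where t: "t \<in> S" "\<And>x. x \<in> S \<Longrightarrow> t \<le> x"
    using compact_attains_inf[of S] by blast
  have t': "b \<le> t" "t \<le> s" "f t \<le> 0" using t(1) by (auto simp: S_def)
  have left: "f x > 0" if "a < x" "x < t" for x
  proof (cases "x < a + e")
    case False
    then have "x \<notin> S" using t(2)[of x] that by auto
    then show ?thesis using False that t' b by (auto simp: S_def)
  qed (use pos that in blast)
  have "f t = 0"
  proof (rule ccontr)
    assume "f t \<noteq> 0"
    then have "\<exists>x\<ge>b. x \<le> t \<and> f x = 0"
      using t' pos[of b] b by (intro IVT2' fc) auto
    then obtain x where x: "b \<le> x" "x \<le> t" "f x = 0" by blast
    then show False using left[of x] b \<open>f t \<noteq> 0\<close> by (cases "x = t") auto
  qed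
  then show ?thesis using that[of t] left b t' by auto
qed

lemma vanishing_tail_lower_bound:
  assumes vt: "vanishing_tail y" and c: "\<And>r. r \<ge> a \<Longrightarrow> isCont y r"
    and d: "\<And>r. r \<ge> a \<Longrightarrow> d \<le> (y r)\<^sup>2"
  shows "d \<le> 0"
proof (rule tendsto_lowerbound[OF vt[unfolded vanishing_tail_def]])
  show "\<forall>\<^sub>F r in at_top. d \<le> integral {r..r+1} (\<lambda>s. (y s)\<^sup>2)"
    using eventually_ge_at_top[of a]
  proof eventually_elim
    case (elim r)
    have "integral {r..r+1} (\<lambda>s. d) \<le> integral {r..r+1} (\<lambda>s. (y s)\<^sup>2)"
    proof (rule integral_le)
      show "(\<lambda>s. (y s)\<^sup>2) integrable_on {r..r+1}"
        using elim by (intro integrable_continuous_real continuous_intros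
            continuous_at_imp_continuous_on ballI c) auto
    qed (use d elim in auto)
    then show ?case by simp
  qed
qed simp

lemma power_times_exp_tendsto_0:
  fixes d :: real
  assumes d: "d > 0"
  shows "((\<lambda>r. r ^ k * exp (- (d * r))) \<longlongrightarrow> 0) at_top"
proof -
  have "((\<lambda>r. (d * r) ^ k / exp (d * r)) \<longlongrightarrow> 0) at_top"
    by (rule filterlim_compose[OF tendsto_power_div_exp_0])
       (use d in \<open>auto intro!: filterlim_tendsto_pos_mult_at_top[OF tendsto_const] filterlim_ident\<close>)
  then have "((\<lambda>r. (1 / d ^ k) * ((d * r) ^ k / exp (d * r))) \<longlongrightarrow> (1 / d ^ k) * 0) at_top"
    by (intro tendsto_mult tendsto_const)
  moreover have "(1 / d ^ k) * ((d * r) ^ k / exp (d * r)) = r ^ k * exp (- (d * r))" for r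
    using d by (simp add: power_mult_distrib exp_minus field_simps)
  ultimately show ?thesis by simp
qed

lemma square_exp_bound_tendsto_0:
  fixes f :: "real \<Rightarrow> real"
  assumes d: "d > 0" and f: "\<And>r. r \<ge> R \<Longrightarrow> (f r)\<^sup>2 \<le> C * exp (- (2 * d * r))"
  shows "((\<lambda>r. r ^ k * f r) \<longlongrightarrow> 0) at_top"
proof (rule Lim_null_comparison)
  have "((\<lambda>r. sqrt \<bar>C\<bar> * (r ^ k * exp (- (d * r)))) \<longlongrightarrow> sqrt \<bar>C\<bar> * 0) at_top"
    by (intro tendsto_mult tendsto_const power_times_exp_tendsto_0 d)
  then show "((\<lambda>r. sqrt \<bar>C\<bar> * (r ^ k * exp (- (d * r)))) \<longlongrightarrow> 0) at_top" by simp
  show "\<forall>\<^sub>F r in at_top. norm (r ^ k * f r) \<le> sqrt \<bar>C\<bar> * (r ^ k * exp (- (d * r)))"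
    using eventually_ge_at_top[of "max R 0"]
  proof eventually_elim
    case (elim r)
    have e: "(exp (- (d * r)))\<^sup>2 = exp (- (2 * d * r))"
      by (simp add: power2_eq_square flip: exp_add)
    have "C * exp (- (2 * d * r)) \<le> \<bar>C\<bar> * exp (- (2 * d * r))"
      by (intro mult_right_mono) auto
    moreover have "(f r)\<^sup>2 \<le> C * exp (- (2 * d * r))"
      using f elim by simp
    ultimately have "(f r)\<^sup>2 \<le> (sqrt \<bar>C\<bar> * exp (- (d * r)))\<^sup>2"
      unfolding power_mult_distrib real_sqrt_pow2[OF abs_ge_zero] e by (rule order_trans[rotated])
    then have "\<bar>f r\<bar> \<le> sqrt \<bar>C\<bar> * exp (- (d * r))"
      by (metis abs_le_square_iff abs_of_nonneg exp_ge_zero mult_nonneg_nonneg real_sqrt_ge_zero abs_ge_zero)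
    then have "r ^ k * \<bar>f r\<bar> \<le> r ^ k * (sqrt \<bar>C\<bar> * exp (- (d * r)))"
      using elim by (intro mult_left_mono) auto
    then show ?case using elim by (simp add: abs_mult mult_ac)
  qed
qed

text \<open>Everything rests on \<open>A\<close>, half the weighted derivative of y^2. Its
  derivative dominates 2 d |A|, so \<open>A\<close> either grows, which the vanishing tail forbids,
  or is nonpositive and decays like exp (- 2 d r). Integrating from infinity carries the rate over
  to y^2.\<close>

lemma radial_ode_decay:
  assumes ode: "radial_ode n q y y'" and R: "R \<ge> 1" and d: "d > 0"
    and q: "\<And>r. r \<ge> R \<Longrightarrow> d\<^sup>2 \<le> q r" and vt: "vanishing_tail y"
  shows "((\<lambda>r. r ^ k * y r) \<longlongrightarrow> 0) at_top" "((\<lambda>r. r ^ k * y' r) \<longlongrightarrow> 0) at_top"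
proof -
  note dy = radial_odeD(1)[OF ode] and dy' = radial_odeD(2)[OF ode]
  define A where "A = (\<lambda>r. r ^ n * (y r * y' r))"
  define A' where "A' = (\<lambda>r. r ^ n * ((y' r)\<^sup>2 + q r * (y r)\<^sup>2))"
  have dA: "(A has_real_derivative A' r) (at r)" if r: "r > 0" for r
  proof -
    have "(A has_real_derivative real n / r * r ^ n * (y r * y' r) +
        (y' r * y' r + (q r * y r - real n / r * y' r) * y r) * r ^ n) (at r)"
      unfolding A_def by (rule DERIV_mult[OF DERIV_power_quotient[OF r] DERIV_mult[OF dy[OF r] dy'[OF r]]])
    then show ?thesis
      by (rule DERIV_cong) (simp add: A'_def power2_eq_square algebra_simps)
  qed
  have pos: "r > 0" if "r \<ge> R" for r using that R by linarith
  have A': "2 * d * \<bar>A r\<bar> \<le> A' r" if r: "r \<ge> R" for r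
  proof -
    have "0 \<le> (\<bar>y' r\<bar> - d * \<bar>y r\<bar>)\<^sup>2" by simp
    also have "\<dots> = (y' r)\<^sup>2 - 2 * d * \<bar>y r * y' r\<bar> + d\<^sup>2 * (y r)\<^sup>2"
      by (simp add: power2_diff power_mult_distrib abs_mult)
    also have "d\<^sup>2 * (y r)\<^sup>2 \<le> q r * (y r)\<^sup>2"
      using q[OF r] by (intro mult_right_mono) auto
    finally have "2 * d * \<bar>y r * y' r\<bar> \<le> (y' r)\<^sup>2 + q r * (y r)\<^sup>2" by simp
    then have "r ^ n * (2 * d * \<bar>y r * y' r\<bar>) \<le> A' r"
      unfolding A'_def using pos[OF r] by (intro mult_left_mono) auto
    then show ?thesis using pos[OF r] by (simp add: A_def abs_mult mult_ac)
  qed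
  have dy2: "((\<lambda>r. (y r)\<^sup>2) has_real_derivative 2 * A r / r ^ n) (at r)" if r: "r > 0" for r
  proof -
    have "((\<lambda>r. y r * y r) has_real_derivative y' r * y r + y' r * y r) (at r)"
      by (rule DERIV_mult[OF dy[OF r] dy[OF r]])
    then show ?thesis using r by (simp add: power2_eq_square A_def mult.commute)
  qed
  \<comment> \<open>A positive value of \<open>A\<close> would persist, y^2 would not decrease from
    there on, and the vanishing tail would force y r0 = 0, against A r0 > 0.\<close>
  have A_le: "A r0 \<le> 0" if r0: "r0 \<ge> R" for r0
  proof (rule ccontr)
    assume "\<not> A r0 \<le> 0"
    then have A0: "A r0 > 0" by simp
    have mono: "A r0 \<le> A r" if r: "r \<ge> r0" for r
    proof (rule DERIV_nonneg_imp_nondecreasing[OF r])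
      fix x assume x: "r0 \<le> x" "x \<le> r"
      have "0 \<le> 2 * d * \<bar>A x\<bar>" using d by simp
      then have "0 \<le> A' x" using A'[of x] x r0 by linarith
      then show "\<exists>y. (A has_real_derivative y) (at x) \<and> 0 \<le> y"
        using dA[of x] pos[of x] x r0 by auto
    qed
    have "(y r0)\<^sup>2 \<le> (y r)\<^sup>2" if r: "r \<ge> r0" for r
    proof (rule DERIV_nonneg_imp_nondecreasing[OF r])
      fix x assume x: "r0 \<le> x" "x \<le> r"
      have "x > 0" using x r0 pos by force
      moreover have "0 \<le> 2 * A x / x ^ n" using mono[of x] x A0 \<open>x > 0\<close> by simp
      ultimately show "\<exists>z. ((\<lambda>r. (y r)\<^sup>2) has_real_derivative z) (at x) \<and> 0 \<le> z"
        using dy2[of x] by blast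
    qed
    moreover have "isCont y r" if "r \<ge> r0" for r
      using that r0 pos by (intro DERIV_isCont[OF dy]) force
    ultimately have "(y r0)\<^sup>2 \<le> 0" using vanishing_tail_lower_bound[OF vt] by blast
    then have "y r0 = 0" by simp
    then show False using A0 by (simp add: A_def)
  qed
  \<comment> \<open>Minus the value at \<open>R\<close> of A r * exp (2 d r), which is nondecreasing
    from \<open>R\<close> on because A' + 2 d A >= 0.\<close>
  define C where "C = - A R * exp (2 * d * R)"
  have C: "C \<ge> 0" using A_le[of R] by (simp add: C_def mult_le_0_iff)
  have A_ge: "- (C * exp (- (2 * d * r))) \<le> A r" if r: "r \<ge> R" for r
  proof -
    have "A R * exp (2 * d * R) \<le> A r * exp (2 * d * r)"
    proof (rule DERIV_nonneg_imp_nondecreasing[OF r, of "\<lambda>r. A r * exp (2 * d * r)"])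
      fix x assume x: "R \<le> x" "x \<le> r"
      have "((\<lambda>r. A r * exp (2 * d * r)) has_real_derivative (A' x + 2 * d * A x) * exp (2 * d * x)) (at x)"
        by (rule DERIV_cong, rule DERIV_mult[OF dA[OF pos[OF x(1)]]])
           (auto intro!: derivative_eq_intros simp: algebra_simps)
      moreover have "0 \<le> A' x + 2 * d * A x"
        using A'[OF x(1)] A_le[OF x(1)] by simp
      ultimately show "\<exists>y. ((\<lambda>r. A r * exp (2 * d * r)) has_real_derivative y) (at x) \<and> 0 \<le> y"
        by (intro exI conjI) (assumption, simp)
    qed
    then have "- C \<le> A r * exp (2 * d * r)" by (simp add: C_def)
    then have "- C * exp (- (2 * d * r)) \<le> A r * exp (2 * d * r) * exp (- (2 * d * r))"
      by (rule mult_right_mono) simp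
    then show ?thesis by (simp add: mult.assoc flip: exp_add)
  qed
  have y2_anti: "(y s)\<^sup>2 \<le> (y r)\<^sup>2" if "R \<le> r" "r \<le> s" for r s
  proof (rule DERIV_nonpos_imp_nonincreasing[OF that(2)])
    fix x assume x: "r \<le> x" "x \<le> s"
    have "x > 0" using x that pos by force
    moreover have "2 * A x / x ^ n \<le> 0" using A_le[of x] x that \<open>x > 0\<close> by (simp add: divide_le_0_iff)
    ultimately show "\<exists>z. ((\<lambda>r. (y r)\<^sup>2) has_real_derivative z) (at x) \<and> z \<le> 0"
      using dy2[of x] by blast
  qed
  have y2_lim: "((\<lambda>r. (y r)\<^sup>2) \<longlongrightarrow> 0) at_top"
  proof -
    \<comment> \<open>As y^2 is nonincreasing, its value at the right end of a window is at most the
      integral over the window.\<close>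
    have "((\<lambda>r. (y (r + 1))\<^sup>2) \<longlongrightarrow> 0) at_top"
    proof (rule real_tendsto_sandwich[OF _ _ tendsto_const vt[unfolded vanishing_tail_def]])
      show "\<forall>\<^sub>F r in at_top. (y (r + 1))\<^sup>2 \<le> integral {r..r + 1} (\<lambda>s. (y s)\<^sup>2)"
        using eventually_ge_at_top[of R]
      proof eventually_elim
        case (elim r)
        have "integral {r..r+1} (\<lambda>s. (y (r+1))\<^sup>2) \<le> integral {r..r+1} (\<lambda>s. (y s)\<^sup>2)"
        proof (rule integral_le)
          show "(\<lambda>s. (y s)\<^sup>2) integrable_on {r..r+1}"
            using elim pos by (intro integrable_continuous_real continuous_intros
                continuous_at_imp_continuous_on ballI DERIV_isCont[OF dy]) force
        qed (use elim y2_anti in auto)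
        then show ?case by simp
      qed
    qed simp
    then show ?thesis
      using filterlim_compose[OF _ filterlim_tendsto_add_at_top[OF tendsto_const[of "-1"] filterlim_ident]]
      by fastforce
  qed
  have y2_bd: "(y r)\<^sup>2 \<le> (C / d) * exp (- (2 * d * r))" if r: "r \<ge> R" for r
  proof -
    \<comment> \<open>\<open>?B\<close> is nondecreasing with limit 0, since A <= 0 and x >= 1 give
      A x <= A x / x^n.\<close>
    let ?B = "\<lambda>r. (y r)\<^sup>2 - (C / d) * exp (- (2 * d * r))"
    have "?B r \<le> 0"
    proof (rule mono_le_limit_at_top[of r ?B])
      fix x assume x: "r \<le> x"
      have x0: "x > 0" "x \<ge> 1" using x r R by auto
      show "(?B has_real_derivative (2 * A x / x ^ n + 2 * C * exp (- (2 * d * x)))) (at x)"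
        by (rule DERIV_cong, rule DERIV_diff[OF dy2[OF x0(1)]])
           (use d in \<open>auto intro!: derivative_eq_intros\<close>)
      have "A x \<le> A x / x ^ n"
        using A_le[of x] x r x0 one_le_power[OF x0(2), of n] mult_left_mono_neg[of 1 "x ^ n" "A x"]
        by (simp add: field_simps)
      then show "0 \<le> 2 * A x / x ^ n + 2 * C * exp (- (2 * d * x))"
        using A_ge[of x] x r by simp
    next
      have "((\<lambda>r. exp (- (2 * d * r))) \<longlongrightarrow> 0) at_top"
        using power_times_exp_tendsto_0[of "2 * d" 0] d by simp
      then have "(?B \<longlongrightarrow> 0 - (C / d) * 0) at_top"
        by (intro tendsto_diff tendsto_mult tendsto_const y2_lim)
      then show "(?B \<longlongrightarrow> 0) at_top" by simp
    qed
    then show ?thesis by simp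
  qed
  show "((\<lambda>r. r ^ k * y r) \<longlongrightarrow> 0) at_top"
    by (rule square_exp_bound_tendsto_0[OF d y2_bd])
  have y'2_anti: "(y' s)\<^sup>2 \<le> (y' r)\<^sup>2" if "R \<le> r" "r \<le> s" for r s
  proof (rule DERIV_nonpos_imp_nonincreasing[OF that(2)])
    fix x assume x: "r \<le> x" "x \<le> s"
    have x0: "x > 0" "x \<ge> R" using x that pos by force+
    have "((\<lambda>r. (y' r)\<^sup>2) has_real_derivative 2 * y' x * (q x * y x - real n / x * y' x)) (at x)"
      by (rule DERIV_cong, rule DERIV_power[OF dy'[OF x0(1)]]) simp
    moreover have "2 * y' x * (q x * y x - real n / x * y' x) \<le> 0"
    proof -
      have "y x * y' x \<le> 0"
        using A_le[OF x0(2)] mult_pos_pos[OF zero_less_power[OF x0(1)]] unfolding A_def by (meson not_le)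
      moreover have "q x \<ge> 0" using q[OF x0(2)] by (meson order_trans zero_le_power2)
      ultimately have "q x * (y x * y' x) \<le> 0" by (simp add: mult_le_0_iff)
      moreover have "0 \<le> real n / x * (y' x)\<^sup>2" using x0 by simp
      moreover have "2 * y' x * (q x * y x - real n / x * y' x) = 2 * (q x * (y x * y' x)) - 2 * (real n / x * (y' x)\<^sup>2)"
        by (simp add: power2_eq_square algebra_simps)
      ultimately show ?thesis by linarith
    qed
    ultimately show "\<exists>z. ((\<lambda>r. (y' r)\<^sup>2) has_real_derivative z) (at x) \<and> z \<le> 0" by blast
  qed
  have "(y' r)\<^sup>2 \<le> (4 * (C / d) * exp (2 * d)) * exp (- (2 * d * r))" if r: "r \<ge> R + 1" for r
  proof -
    \<comment> \<open>(y')^2 is nonincreasing because y y' <= 0, so y' at r is at most a mean slope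
      over [r - 1, r], which the bound on y^2 controls.\<close>
    have "\<exists>z. r - 1 < z \<and> z < r \<and> y r - y (r - 1) = (r - (r - 1)) * y' z"
      by (rule MVT2) (use r R in \<open>auto intro!: dy\<close>)
    then obtain z where z: "r - 1 < z" "z < r" "y r - y (r - 1) = y' z" by auto
    have "(y' r)\<^sup>2 \<le> (y' z)\<^sup>2" using y'2_anti[of z r] z r by simp
    also have "(y' z)\<^sup>2 = (y r - y (r - 1))\<^sup>2" using z by simp
    also have "\<dots> \<le> 2 * (y r)\<^sup>2 + 2 * (y (r - 1))\<^sup>2"
      using zero_le_power2[of "y r + y (r - 1)"] by (simp add: power2_eq_square algebra_simps)
    also have "\<dots> \<le> 4 * (y (r - 1))\<^sup>2" using y2_anti[of "r - 1" r] r by simp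
    also have "\<dots> \<le> 4 * ((C / d) * exp (- (2 * d * (r - 1))))"
      using y2_bd[of "r - 1"] r by simp
    also have "exp (- (2 * d * (r - 1))) = exp (2 * d) * exp (- (2 * d * r))"
      by (simp add: algebra_simps flip: exp_add)
    finally show ?thesis by (simp add: mult_ac)
  qed
  then show "((\<lambda>r. r ^ k * y' r) \<longlongrightarrow> 0) at_top"
    by (rule square_exp_bound_tendsto_0[OF d])
qed

text \<open>A Gronwall argument for y^2 + (y')^2. The singular coefficient n / r does no harm since
  it enters as friction, with a nonpositive contribution.\<close>

lemma radial_ode_zero:
  assumes ode: "radial_ode n q y y'" and q: "\<And>r. r > 0 \<Longrightarrow> \<bar>q r\<bar> \<le> Q"
    and lim: "(y \<longlongrightarrow> 0) (at_right 0)" "(y' \<longlongrightarrow> 0) (at_right 0)" and r: "r > 0"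
  shows "y r = 0"
proof -
  note dy = radial_odeD(1)[OF ode] and dy' = radial_odeD(2)[OF ode]
  define K where "K = Q + 1"
  let ?Z = "\<lambda>r. ((y r)\<^sup>2 + (y' r)\<^sup>2) * exp (- K * r)"
  let ?D = "\<lambda>r. 2 * y r * y' r + 2 * y' r * (q r * y r - real n / r * y' r)"
  have "?Z r \<le> 0"
  proof (rule antimono_le_limit_right[OF r, of ?Z])
    fix s :: real assume s: "0 < s"
    have "((\<lambda>r. (y r)\<^sup>2 + (y' r)\<^sup>2) has_real_derivative ?D s) (at s)"
      by (rule DERIV_cong, rule DERIV_add[OF DERIV_power[OF dy[OF s]] DERIV_power[OF dy'[OF s]]]) simp
    then show "(?Z has_real_derivative ((?D s - K * ((y s)\<^sup>2 + (y' s)\<^sup>2)) * exp (- K * s))) (at s)"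
      by (rule DERIV_cong[OF DERIV_mult]) (auto intro!: derivative_eq_intros simp: algebra_simps)
    have "2 * (1 + q s) * (y s * y' s) \<le> 2 * \<bar>1 + q s\<bar> * \<bar>y s * y' s\<bar>"
      by (metis abs_ge_self abs_mult mult.assoc mult_left_mono zero_le_numeral)
    also have "\<dots> \<le> 2 * K * \<bar>y s * y' s\<bar>"
    proof -
      have "\<bar>1 + q s\<bar> \<le> K" using q[OF s] unfolding K_def by linarith
      then show ?thesis by (intro mult_right_mono mult_left_mono) auto
    qed
    also have "\<dots> \<le> K * ((y s)\<^sup>2 + (y' s)\<^sup>2)"
    proof -
      have "0 \<le> (\<bar>y s\<bar> - \<bar>y' s\<bar>)\<^sup>2" by simp
      then have "2 * \<bar>y s * y' s\<bar> \<le> (y s)\<^sup>2 + (y' s)\<^sup>2"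
        by (simp add: power2_diff abs_mult)
      moreover have "K \<ge> 0" using q[OF s] by (simp add: K_def)
      ultimately have "K * (2 * \<bar>y s * y' s\<bar>) \<le> K * ((y s)\<^sup>2 + (y' s)\<^sup>2)" by (rule mult_left_mono)
      then show ?thesis by (simp add: mult_ac)
    qed
    moreover have "0 \<le> real n / s * (y' s)\<^sup>2" using s by simp
    moreover have "?D s = 2 * (1 + q s) * (y s * y' s) - 2 * (real n / s * (y' s)\<^sup>2)"
      by (simp add: power2_eq_square algebra_simps)
    ultimately have "?D s - K * ((y s)\<^sup>2 + (y' s)\<^sup>2) \<le> 0"
      by linarith
    then show "(?D s - K * ((y s)\<^sup>2 + (y' s)\<^sup>2)) * exp (- K * s) \<le> 0"
      by (simp add: mult_le_0_iff)
  next
    have "(?Z \<longlongrightarrow> (0\<^sup>2 + 0\<^sup>2) * exp (- K * 0)) (at_right 0)"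
      by (intro tendsto_intros lim)
    then show "(?Z \<longlongrightarrow> 0) (at_right 0)" by simp
  qed
  then have "(y r)\<^sup>2 + (y' r)\<^sup>2 \<le> 0" by (simp add: mult_le_0_iff)
  then show ?thesis by (simp add: sum_power2_le_zero_iff)
qed

section \<open>The radial ground state\<close>

locale radial_ground_state =
  fixes n :: nat and W W' :: "real \<Rightarrow> real" and W0 :: real
  assumes n: "n \<le> 2"
    and ode: "radial_ode n (\<lambda>r. 1 - (W r)\<^sup>2) W W'"
    and W_pos: "r > 0 \<Longrightarrow> W r > 0"
    and W_le: "r > 0 \<Longrightarrow> W r \<le> W0"
    and W_lim_0: "(W \<longlongrightarrow> W0) (at_right 0)"
    and W'_lim_0: "(W' \<longlongrightarrow> 0) (at_right 0)"
    and W_tail: "vanishing_tail W"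
begin

lemma dW: "r > 0 \<Longrightarrow> (W has_real_derivative W' r) (at r)"
  and dW': "r > 0 \<Longrightarrow> (W' has_real_derivative W r - W r ^ 3 - real n / r * W' r) (at r)"
  using radial_odeD[OF ode, of r] by (simp_all add: power2_eq_square power3_eq_cube algebra_simps)

text \<open>The mechanical energy of W'' = W - W^3; the term - n / r W' acts as friction.\<close>

definition energy :: "real \<Rightarrow> real" where
  "energy r = (W' r)\<^sup>2 / 2 + (W r ^ 4 / 4 - (W r)\<^sup>2 / 2)"

lemma energy_deriv:
  assumes r: "r > 0"
  shows "(energy has_real_derivative - (real n / r * (W' r)\<^sup>2)) (at r)"
proof -
  define D where "D = W r - W r ^ 3 - real n / r * W' r"
  have D: "(W' has_real_derivative D) (at r)"
    unfolding D_def by (rule dW'[OF r])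
  have "(energy has_real_derivative W' r * D + (W r ^ 3 - W r) * W' r) (at r)"
    unfolding energy_def
    by (auto intro!: derivative_eq_intros dW[OF r] D simp: power3_eq_cube field_simps)
  then show ?thesis
    by (rule DERIV_cong) (simp add: D_def power2_eq_square algebra_simps)
qed

lemma energy_antimono:
  assumes "0 < r" "r \<le> s"
  shows "energy s \<le> energy r"
proof (rule DERIV_nonpos_imp_nonincreasing[OF assms(2)])
  fix x assume "r \<le> x" "x \<le> s"
  then have "x > 0" using assms by linarith
  moreover have "- (real n / x * (W' x)\<^sup>2) \<le> 0" using \<open>x > 0\<close> by simp
  ultimately show "\<exists>y. (energy has_real_derivative y) (at x) \<and> y \<le> 0" using energy_deriv by blast
qed

text \<open>The potential part of the energy is at least - 1 / 4, so the nonincreasing energy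
  controls the kinetic part.\<close>

lemma W'_bounded:
  obtains L where "L > 0" "\<And>r. r \<ge> 1 \<Longrightarrow> \<bar>W' r\<bar> \<le> L"
proof -
  have "\<bar>W' r\<bar> \<le> sqrt \<bar>2 * energy 1 + 1 / 2\<bar> + 1" if r: "r \<ge> 1" for r
  proof -
    have "0 \<le> ((W r)\<^sup>2 - 1)\<^sup>2" by simp
    then have "- 1 / 4 \<le> W r ^ 4 / 4 - (W r)\<^sup>2 / 2"
      by (simp add: power2_diff flip: power_mult)
    then have "(W' r)\<^sup>2 \<le> \<bar>2 * energy 1 + 1 / 2\<bar>"
      using energy_antimono[of 1 r] r by (simp add: energy_def[of r])
    then have "\<bar>W' r\<bar> \<le> sqrt \<bar>2 * energy 1 + 1 / 2\<bar>"
      using real_le_rsqrt by (metis power2_abs)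
    then show ?thesis by simp
  qed
  then show ?thesis by (intro that[of "sqrt \<bar>2 * energy 1 + 1 / 2\<bar> + 1"]) (auto intro: add_nonneg_pos)
qed

lemma W_lim: "(W \<longlongrightarrow> 0) at_top"
proof -
  obtain L where L: "L > 0" "\<And>r. r \<ge> 1 \<Longrightarrow> \<bar>W' r\<bar> \<le> L" using W'_bounded by blast
  have "\<forall>\<^sub>F r in at_top. dist (W r) 0 < e" if e: "e > 0" for e
  proof -
    \<comment> \<open>With slope at least - L, a value of at least e leaves W above e / 2 on an
      interval of length \<open>h\<close> inside the unit window, which would contribute at least (e
      / 2)^2 h to the window integral.\<close>
    define h where "h = min 1 (e / (2 * L))"
    have h: "0 < h" "h \<le> 1" "L * h \<le> e / 2" using e L by (auto simp: h_def min_def field_simps)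
    have "0 < (e / 2)\<^sup>2 * h" using e h by simp
    then have "\<forall>\<^sub>F r in at_top. integral {r..r+1} (\<lambda>s. (W s)\<^sup>2) < (e / 2)\<^sup>2 * h"
      using order_tendstoD(2)[OF W_tail[unfolded vanishing_tail_def]] by blast
    then show ?thesis
      using eventually_ge_at_top[of 1]
    proof eventually_elim
      case (elim r)
      have Wc: "continuous_on S (\<lambda>s. (W s)\<^sup>2)" if "S \<subseteq> {0<..}" for S
        using that by (intro continuous_intros continuous_at_imp_continuous_on ballI DERIV_isCont[OF dW]) auto
      have "W r < e"
      proof (rule ccontr)
        assume "\<not> W r < e"
        then have "e \<le> W r" by simp
        have low: "e / 2 \<le> W s" if s: "s \<in> {r..r + h}" for s
        proof (cases "s = r")
          case False
          then have "r < s" using s by simp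
          have "\<exists>z. r < z \<and> z < s \<and> W s - W r = (s - r) * W' z"
            by (rule MVT2[OF \<open>r < s\<close>]) (use elim in \<open>auto intro!: dW\<close>)
          then obtain z where z: "r < z" "W s - W r = (s - r) * W' z" by blast
          have "- L \<le> W' z" using L(2)[of z] z elim by simp
          then have "(s - r) * (- L) \<le> (s - r) * W' z" using \<open>r < s\<close> by (intro mult_left_mono) auto
          moreover have "(s - r) * L \<le> h * L" using s L by (intro mult_right_mono) auto
          ultimately show ?thesis using z h \<open>e \<le> W r\<close> by (simp add: mult.commute)
        qed (use \<open>e \<le> W r\<close> e in simp)
        have "(e / 2)\<^sup>2 * h = integral {r..r+h} (\<lambda>s. (e / 2)\<^sup>2)" using h by simp
        also have "\<dots> \<le> integral {r..r+h} (\<lambda>s. (W s)\<^sup>2)"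
        proof (rule integral_le)
          show "(\<lambda>s. (W s)\<^sup>2) integrable_on {r..r+h}"
            using elim by (intro integrable_continuous_real Wc) auto
        qed (use low e in \<open>auto intro!: power_mono\<close>)
        also have "\<dots> \<le> integral {r..r+1} (\<lambda>s. (W s)\<^sup>2)"
          using elim h by (intro integral_subset_le integrable_continuous_real Wc) auto
        finally show False using elim by simp
      qed
      then show ?case using W_pos[of r] elim by simp
    qed
  qed
  then show ?thesis by (rule tendstoI)
qed

text \<open>Once W < 1 / 2, the coefficient 1 - W^2 exceeds (1 / 2)^2 and the linear decay result
  applies to the nonlinear equation.\<close>

lemma W_decay: "((\<lambda>r. r ^ k * W r) \<longlongrightarrow> 0) at_top" "((\<lambda>r. r ^ k * W' r) \<longlongrightarrow> 0) at_top"
proof -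
  have "\<forall>\<^sub>F r in at_top. W r < 1 / 2" using order_tendstoD(2)[OF W_lim, of "1 / 2"] by simp
  then obtain R0 where R0: "\<And>r. r \<ge> R0 \<Longrightarrow> W r < 1 / 2" unfolding eventually_at_top_linorder by blast
  have q: "(1 / 2)\<^sup>2 \<le> 1 - (W r)\<^sup>2" if "r \<ge> max R0 1" for r
  proof -
    have "(W r)\<^sup>2 \<le> (1 / 2)\<^sup>2" using R0[of r] W_pos[of r] that by (intro power_mono) auto
    then show ?thesis by (simp add: power2_eq_square)
  qed
  show "((\<lambda>r. r ^ k * W r) \<longlongrightarrow> 0) at_top"
    by (rule radial_ode_decay(1)[OF ode _ _ _ W_tail, of "max R0 1" "1 / 2"]) (use q in auto)
  show "((\<lambda>r. r ^ k * W' r) \<longlongrightarrow> 0) at_top"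
    by (rule radial_ode_decay(2)[OF ode _ _ _ W_tail, of "max R0 1" "1 / 2"]) (use q in auto)
qed

lemma W'_lim: "(W' \<longlongrightarrow> 0) at_top"
  using W_decay(2)[of 0] by simp

lemma energy_nonneg: "r > 0 \<Longrightarrow> energy r \<ge> 0"
proof -
  assume r: "r > 0"
  have "(energy \<longlongrightarrow> 0\<^sup>2 / 2 + (0 ^ 4 / 4 - 0\<^sup>2 / 2)) at_top"
    unfolding energy_def by (intro tendsto_intros W_lim W'_lim) auto
  then have lim: "(energy \<longlongrightarrow> 0) at_top" by simp
  show ?thesis
  proof (rule antimono_ge_limit_at_top[OF _ _ lim])
    fix s assume "r \<le> s"
    then have s: "s > 0" using r by simp
    show "(energy has_real_derivative - (real n / s * (W' s)\<^sup>2)) (at s)" by (rule energy_deriv[OF s])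
    show "- (real n / s * (W' s)\<^sup>2) \<le> 0" using s by simp
  qed
qed

text \<open>At a critical point the energy is W^2 (W^2 - 2) / 4, and its nonnegativity forces W^2 >=
  2. Since W'' = W - W^3 there, every critical point is a strict local maximum.\<close>

lemma critical_point:
  assumes r: "r > 0" and "W' r = 0"
  shows "W r - W r ^ 3 < 0"
proof -
  have "0 \<le> (W r)\<^sup>2 * ((W r)\<^sup>2 - 2)"
    using energy_nonneg[OF r] assms(2) by (simp add: energy_def algebra_simps flip: power_add)
  then have "2 \<le> (W r)\<^sup>2" using W_pos[OF r] by (simp add: zero_le_mult_iff)
  then have "0 < W r * ((W r)\<^sup>2 - 1)" using W_pos[OF r] by simp
  then show ?thesis by (simp add: algebra_simps power2_eq_square power3_eq_cube)
qed

text \<open>Just to the left of a critical point W' is positive. If it is so down to the origin, W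
  exceeds its maximum \<open>W0\<close>. Otherwise the nearest critical point on the left has W' > 0
  on its right side, although it must be a strict local maximum too.\<close>

lemma W'_nonzero:
  assumes r: "r > 0"
  shows "W' r \<noteq> 0"
proof
  assume z: "W' r = 0"
  obtain d where d: "d > 0" "\<And>h. 0 < h \<Longrightarrow> h < d \<Longrightarrow> W' r < W' (r - h)"
    using DERIV_neg_dec_left[OF dW'[OF r]] critical_point[OF r z] z by auto
  show False
  proof (cases "\<forall>s. 0 < s \<and> s < r \<longrightarrow> W' s > 0")
    case True
    have "W0 < W r"
      by (rule strict_mono_gt_limit_right[OF r dW _ W_lim_0]) (use True in auto)
    then show False using W_le[OF r] by simp
  next
    case False
    then obtain a where a: "0 < a" "a < r" "W' a \<le> 0" by (auto simp: not_less)
    obtain t where t: "0 < t" "t \<le> r - a" "W' (r - t) = 0" "\<And>x. 0 < x \<Longrightarrow> x < t \<Longrightarrow> W' (r - x) > 0"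
    proof (rule first_zero[of 0 "r - a" "\<lambda>x. W' (r - x)" d])
      fix x assume "0 < x" "x \<le> r - a"
      then have "isCont W' (r - x)" using a by (intro DERIV_isCont[OF dW']) auto
      then show "isCont (\<lambda>x. W' (r - x)) x" 
        by (rule isCont_o2[where f="\<lambda>x. r - x" and g=W', rotated]) (intro continuous_intros)
    qed (use d a z in auto)
    have s: "r - t > 0" using t a by simp
    obtain e where e: "e > 0" "\<And>h. 0 < h \<Longrightarrow> h < e \<Longrightarrow> W' (r - t + h) < W' (r - t)"
      using DERIV_neg_dec_right[OF dW'[OF s]] critical_point[OF s t(3)] t(3) by auto
    define h where "h = min e t / 2"
    have "0 < h" "h < e" "h < t" using e t by (auto simp: h_def min_def)
    then show False using e(2)[of h] t(3) t(4)[of "t - h"] by (simp add: algebra_simps)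
  qed
qed

text \<open>Without zeros W' keeps its sign; were it positive, the positive function W would
  increase to its limit 0.\<close>

lemma W'_neg: "r > 0 \<Longrightarrow> W' r < 0"
proof (rule ccontr)
  assume r: "r > 0" and "\<not> W' r < 0"
  then have pos: "W' r > 0" using W'_nonzero[OF r] by simp
  have "W' s \<ge> 0" if s: "s \<ge> r" for s
  proof (rule ccontr)
    assume "\<not> W' s \<ge> 0"
    then have "\<exists>x\<ge>r. x \<le> s \<and> W' x = 0"
      using pos s r by (intro IVT2' continuous_at_imp_continuous_on ballI DERIV_isCont[OF dW']) auto
    then show False using W'_nonzero r by force
  qed
  then have "W r \<le> 0"
    by (intro mono_le_limit_at_top[OF _ _ W_lim, of r W'] dW) (use r in auto)
  then show False using W_pos[OF r] by simp
qed

lemma W_strict_antimono: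
  assumes "0 < r" "r < s"
  shows "W s < W r"
proof (rule DERIV_neg_imp_decreasing[OF assms(2)])
  fix x assume "r \<le> x" "x \<le> s"
  then have "x > 0" using assms by simp
  then show "\<exists>y. (W has_real_derivative y) (at x) \<and> y < 0"
    using dW W'_neg by blast
qed

text \<open>Twice the quantity that belongs to the multiplier r W' + (N - 2) / 2 W in dimension N =
  n + 1; hence the coefficient n - 1.\<close>

definition pohozaev :: "real \<Rightarrow> real" where
  "pohozaev r = r ^ n * (r * ((W' r)\<^sup>2 + W r ^ 4 / 2 - (W r)\<^sup>2) + (real n - 1) * (W r * W' r))"

lemma pohozaev_deriv:
  assumes r: "r > 0"
  shows "(pohozaev has_real_derivative r ^ n * (W r)\<^sup>2 * ((3 - real n) / 2 * (W r)\<^sup>2 - 2)) (at r)"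
proof -
  let ?F = "\<lambda>r. r * ((W' r)\<^sup>2 + W r ^ 4 / 2 - (W r)\<^sup>2) + (real n - 1) * (W r * W' r)"
  define D where "D = W r - W r ^ 3 - real n / r * W' r"
  have D: "(W' has_real_derivative D) (at r)"
    unfolding D_def by (rule dW'[OF r])
  let ?F' = "((W' r)\<^sup>2 + W r ^ 4 / 2 - (W r)\<^sup>2)
      + r * (2 * W' r * D + 2 * W r ^ 3 * W' r - 2 * W r * W' r) + (real n - 1) * (W' r * W' r + W r * D)"
  have "(?F has_real_derivative ?F') (at r)"
    by (auto intro!: derivative_eq_intros dW[OF r] D simp: field_simps)
  have factor: "a * x * b + c * x = (a * b + c) * x" for a b c x :: real
    by (simp add: algebra_simps)
  from DERIV_mult[OF DERIV_power_quotient[OF r] \<open>(?F has_real_derivative ?F') (at r)\<close>]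
  have "(pohozaev has_real_derivative real n / r * r ^ n * ?F r + ?F' * r ^ n) (at r)"
    unfolding pohozaev_def .
  moreover have "real n / r * ?F r + ?F' = (W r)\<^sup>2 * ((3 - real n) / 2 * (W r)\<^sup>2 - 2)"
    using r unfolding D_def by (simp add: field_simps power2_eq_square power3_eq_cube power4_eq_xxxx)
  then have "real n / r * r ^ n * ?F r + ?F' * r ^ n = r ^ n * (W r)\<^sup>2 * ((3 - real n) / 2 * (W r)\<^sup>2 - 2)"
    unfolding factor by (simp only: mult_ac)
  ultimately show ?thesis by simp
qed

text \<open>The factor \<open>?s\<close> decreases along with W. The value at r is compared with the
  limit 0 at the end towards which \<open>?s\<close> keeps the sign it has at r: the origin if
  nonnegative, infinity otherwise.\<close>

lemma pohozaev_nonneg: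
  assumes r: "r > 0"
  shows "pohozaev r \<ge> 0"
proof -
  let ?s = "\<lambda>r. (3 - real n) / 2 * (W r)\<^sup>2 - 2"
  have sign: "?s t \<le> ?s s" if "0 < s" "s \<le> t" for s t
  proof -
    have "W t \<le> W s" using W_strict_antimono[of s t] that by (cases "s = t") auto
    then have "(W t)\<^sup>2 \<le> (W s)\<^sup>2" using W_pos[of t] that by (intro power_mono) auto
    then show ?thesis using n by (intro diff_mono mult_left_mono) auto
  qed
  show ?thesis
  proof (cases "?s r \<ge> 0")
    case True
    have "(pohozaev \<longlongrightarrow> 0 ^ n * (0 * (0\<^sup>2 + W0 ^ 4 / 2 - W0\<^sup>2) + (real n - 1) * (W0 * 0))) (at_right 0)"
      unfolding pohozaev_def by (intro tendsto_intros W_lim_0 W'_lim_0) auto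
    then have lim: "(pohozaev \<longlongrightarrow> 0) (at_right 0)" by simp
    show ?thesis
    proof (rule mono_ge_limit_right[OF r pohozaev_deriv _ lim])
      fix t assume t: "0 < t" "t \<le> r"
      then have "0 \<le> ?s t" using sign[OF t] True by linarith
      then show "0 \<le> t ^ n * (W t)\<^sup>2 * ?s t" using t by (intro mult_nonneg_nonneg) auto
    qed
  next
    case False
    \<comment> \<open>Regrouped so that each power of r meets a factor W or W', to which
      \<open>W_decay\<close> applies.\<close>
    have eq: "pohozaev = (\<lambda>r. (r ^ (n + 1) * W' r) * W' r + (r ^ (n + 1) * W r) * (W r ^ 3 / 2 - W r)
        + (real n - 1) * (r ^ n * W r) * W' r)"
      by (rule ext) (simp add: pohozaev_def power2_eq_square power3_eq_cube power4_eq_xxxx algebra_simps)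
    have "(pohozaev \<longlongrightarrow> 0 * 0 + 0 * (0 ^ 3 / 2 - 0) + (real n - 1) * 0 * 0) at_top"
      unfolding eq by (intro tendsto_intros W_decay W_lim W'_lim) auto
    then have lim: "(pohozaev \<longlongrightarrow> 0) at_top" by simp
    show ?thesis
    proof (rule antimono_ge_limit_at_top[OF _ _ lim])
      fix t assume t: "r \<le> t"
      show "(pohozaev has_real_derivative t ^ n * (W t)\<^sup>2 * ?s t) (at t)"
        using pohozaev_deriv t r by simp
      have "?s t \<le> 0" using sign[OF r t] False by linarith
      then show "t ^ n * (W t)\<^sup>2 * ?s t \<le> 0" using t r by (intro mult_nonneg_nonpos) auto
    qed
  qed
qed

definition \<theta> :: "real \<Rightarrow> real" where
  "\<theta> r = - (r * W' r) / W r"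

text \<open>After elimination of W'' the numerator of the derivative is pohozaev x / x^n + x W^4 /
  2; the second term makes the sign strict.\<close>

lemma \<theta>_strict_mono:
  assumes "0 < r" "r < s"
  shows "\<theta> r < \<theta> s"
proof (rule DERIV_pos_imp_increasing[OF assms(2)])
  fix x assume "r \<le> x" "x \<le> s"
  then have x: "x > 0" using assms by linarith
  have W: "W x > 0" using W_pos[OF x] .
  let ?W'' = "W x - W x ^ 3 - real n / x * W' x"
  let ?N = "x * (W' x)\<^sup>2 + (real n - 1) * (W x * W' x) + x * (W x ^ 4 - (W x)\<^sup>2)"
  have "(\<theta> has_real_derivative (- (W' x + x * ?W'') * W x - - (x * W' x) * W' x) / (W x * W x)) (at x)"
    unfolding \<theta>_def
    by (rule DERIV_divide) (use W in \<open>auto intro!: derivative_eq_intros dW dW' x\<close>)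
  moreover have "- (W' x + x * ?W'') * W x - - (x * W' x) * W' x = ?N"
    using x by (simp add: field_simps power2_eq_square power3_eq_cube power4_eq_xxxx)
  moreover
  have N: "?N > 0"
  proof -
    have "pohozaev x / x ^ n \<ge> 0" using pohozaev_nonneg[OF x] x by simp
    then have "0 \<le> x * ((W' x)\<^sup>2 + W x ^ 4 / 2 - (W x)\<^sup>2) + (real n - 1) * (W x * W' x)"
      using x by (simp add: pohozaev_def)
    moreover have "0 < x * (W x ^ 4 / 2)" using x W by simp
    ultimately have "0 < (x * ((W' x)\<^sup>2 + W x ^ 4 / 2 - (W x)\<^sup>2) + (real n - 1) * (W x * W' x)) + x * (W x ^ 4 / 2)"
      by linarith
    also have "\<dots> = ?N" by (simp add: algebra_simps)
    finally show ?thesis .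
  qed
  ultimately have "(\<theta> has_real_derivative ?N / (W x * W x)) (at x)" by (simp only:)
  moreover have "0 < ?N / (W x * W x)" using N W by (intro divide_pos_pos mult_pos_pos)
  ultimately show "\<exists>y. (\<theta> has_real_derivative y) (at x) \<and> 0 < y" by blast
qed

text \<open>The expression minus 1 is W^2 + r W W' - 1. It tends to W0^2 - 1 at the origin, where
  nonnegative energy gives W0^2 >= 2, and to - 1 at infinity; in between it has a zero.\<close>

lemma matching_radius:
  obtains R where "R > 0" "(1 - \<theta> R) * (W R)\<^sup>2 = 1"
proof -
  let ?h = "\<lambda>r. (W r)\<^sup>2 + r * (W r * W' r) - 1"
  have h: "(1 - \<theta> r) * (W r)\<^sup>2 - 1 = ?h r" if "r > 0" for r
    using W_pos[OF that] by (simp add: \<theta>_def field_simps power2_eq_square)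
  have "(energy \<longlongrightarrow> 0\<^sup>2 / 2 + (W0 ^ 4 / 4 - W0\<^sup>2 / 2)) (at_right 0)"
    unfolding energy_def by (intro tendsto_intros W_lim_0 W'_lim_0) auto
  then have "0 \<le> 0\<^sup>2 / 2 + (W0 ^ 4 / 4 - W0\<^sup>2 / 2)"
    by (rule tendsto_lowerbound)
       (auto simp: eventually_at_right_field intro!: exI[of _ 1] energy_nonneg)
  then have "0 \<le> W0\<^sup>2 * (W0\<^sup>2 - 2)" by (simp add: algebra_simps flip: power_add)
  moreover have "W0 > 0" using W_pos[of 1] W_le[of 1] by simp
  ultimately have "W0\<^sup>2 \<ge> 2" by (simp add: zero_le_mult_iff)
  have "(?h \<longlongrightarrow> W0\<^sup>2 + 0 * (W0 * 0) - 1) (at_right 0)"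
    by (intro tendsto_intros W_lim_0 W'_lim_0)
  then have "\<forall>\<^sub>F r in at_right 0. 0 < ?h r"
    by (rule order_tendstoD(1)) (use \<open>W0\<^sup>2 \<ge> 2\<close> in simp)
  then obtain b where b: "b > 0" "\<And>r. 0 < r \<Longrightarrow> r < b \<Longrightarrow> 0 < ?h r"
    unfolding eventually_at_right_field by blast
  have a: "b / 2 > 0" using b(1) by simp
  have hb: "0 < ?h (b / 2)" by (rule b(2)) (use b(1) in auto)
  have "((\<lambda>r. (W r)\<^sup>2 + r ^ 1 * W r * W' r - 1) \<longlongrightarrow> 0\<^sup>2 + 0 * 0 - 1) at_top"
    by (intro tendsto_intros W_decay W_lim W'_lim)
  then have "((\<lambda>r. ?h r) \<longlongrightarrow> - 1) at_top" by (simp add: mult.assoc)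
  then have "\<forall>\<^sub>F r in at_top. ?h r < 0" by (rule order_tendstoD(2)) simp
  then have "\<forall>\<^sub>F r in at_top. ?h r < 0 \<and> b / 2 \<le> r"
    using eventually_ge_at_top by (rule eventually_conj)
  then obtain c where c: "?h c < 0" "b / 2 \<le> c"
    unfolding eventually_at_top_linorder by blast
  have "\<exists>x\<ge>b/2. x \<le> c \<and> ?h x = 0"
  proof (rule IVT2'[OF less_imp_le[OF c(1)] less_imp_le[OF hb] c(2)], intro continuous_at_imp_continuous_on ballI)
    fix x assume "x \<in> {b / 2..c}"
    then have "x > 0" using a by (meson atLeastAtMost_iff less_le_trans)
    then show "isCont ?h x"
      by (intro continuous_intros DERIV_isCont[OF dW] DERIV_isCont[OF dW'])
  qed
  then obtain R where "R \<ge> b / 2" "?h R = 0" by blast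
  then show ?thesis using h[of R] a by (intro that[of R]) auto
qed

end

text \<open>The weight r^n absorbs the first order terms. The defect \<open>g\<close> is L z for L =
  - Laplace + q, so the derivative is r^n y L z.\<close>

lemma wronskian_deriv:
  assumes "radial_ode n q y y'" and r: "r > 0"
    and dz: "(z has_real_derivative z' r) (at r)"
      "(z' has_real_derivative q r * z r - real n / r * z' r - g) (at r)"
  shows "((\<lambda>r. r ^ n * (y' r * z r - y r * z' r)) has_real_derivative r ^ n * (y r * g)) (at r)"
proof -
  note dy = radial_odeD[OF assms(1) r]
  have "((\<lambda>r. r ^ n * (y' r * z r - y r * z' r)) has_real_derivative
     real n / r * r ^ n * (y' r * z r - y r * z' r) +
     (((q r * y r - real n / r * y' r) * z r + z' r * y' r)
      - (y' r * z' r + (q r * z r - real n / r * z' r - g) * y r)) * r ^ n) (at r)"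
    by (intro DERIV_mult DERIV_power_quotient DERIV_diff dy dz r)
  then show ?thesis
    by (rule DERIV_cong) (simp add: algebra_simps)
qed

text \<open>The weighted product r^n y y' starts from 0 and does not decrease, so y^2 does not
  decrease either; yet y^2 tends to 0 at infinity.\<close>

lemma coercive_radial_ode_zero:
  assumes ode: "radial_ode n q y y'" and d: "d > 0" and q: "\<And>r. r > 0 \<Longrightarrow> d\<^sup>2 \<le> q r"
    and lim: "(y \<longlongrightarrow> y0) (at_right 0)" "(y' \<longlongrightarrow> 0) (at_right 0)"
    and vt: "vanishing_tail y" and r: "r > 0"
  shows "y r = 0"
proof -
  note dy = radial_odeD[OF ode]
  let ?A = "\<lambda>r. r ^ n * (y r * y' r)"
  let ?A' = "\<lambda>x. real n / x * x ^ n * (y x * y' x) + (y' x * y' x + (q x * y x - real n / x * y' x) * y x) * x ^ n"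
  have A: "?A s \<ge> 0" if s: "s > 0" for s
  proof (rule mono_ge_limit_right[OF s])
    fix x :: real assume x: "x > 0"
    show "(?A has_real_derivative ?A' x) (at x)"
      by (intro DERIV_mult DERIV_power_quotient dy x)
    have "?A' x = x ^ n * ((y' x)\<^sup>2 + q x * (y x)\<^sup>2)"
      by (simp add: power2_eq_square algebra_simps)
    moreover have "0 \<le> q x" using q[OF x] by (meson order_trans zero_le_power2)
    ultimately show "0 \<le> ?A' x"
      using x by simp
  next
    have "(?A \<longlongrightarrow> 0 ^ n * (y0 * 0)) (at_right 0)" by (intro tendsto_intros lim)
    then show "(?A \<longlongrightarrow> 0) (at_right 0)" by simp
  qed
  have "((\<lambda>r. r ^ 0 * y r) \<longlongrightarrow> 0) at_top"
    by (rule radial_ode_decay(1)[OF ode _ d _ vt, of 1]) (use q in auto)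
  then have "((\<lambda>r. y r * y r) \<longlongrightarrow> 0 * 0) at_top"
    by (intro tendsto_mult) auto
  then have "y r * y r \<le> 0"
  proof (intro mono_le_limit_at_top[of r "\<lambda>r. y r * y r"])
    fix s assume s: "r \<le> s"
    then have s0: "s > 0" using r by simp
    show "((\<lambda>r. y r * y r) has_real_derivative y' s * y s + y' s * y s) (at s)"
      by (intro DERIV_mult dy s0)
    have "0 \<le> y s * y' s" using A[OF s0] mult_pos_neg[OF zero_less_power[OF s0]] by (meson not_le)
    then show "0 \<le> y' s * y s + y' s * y s" by (simp add: mult.commute)
  qed simp
  then show ?thesis by (auto simp: mult_le_0_iff)
qed

text \<open>Serves to undo the dilation by sqrt (1 - kappa), so that the equation of the sum becomes
  the kernel equation at W itself.\<close>

lemma radial_ode_scale: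
  assumes ode: "radial_ode n q y y'" and s: "s > 0"
  shows "radial_ode n (\<lambda>r. q (r / s) / s\<^sup>2) (\<lambda>r. y (r / s)) (\<lambda>r. y' (r / s) / s)"
  unfolding radial_ode_def
proof (intro allI impI conjI)
  fix r :: real assume r: "r > 0"
  have rs: "r / s > 0" using r s by simp
  have d: "((\<lambda>r. r / s) has_real_derivative 1 / s) (at r)"
    using s by (auto intro!: derivative_eq_intros)
  show "((\<lambda>r. y (r / s)) has_real_derivative y' (r / s) / s) (at r)"
    using DERIV_chain2[OF radial_odeD(1)[OF ode rs] d] by simp
  have "((\<lambda>r. y' (r / s) / s) has_real_derivative (q (r / s) * y (r / s) - real n / (r / s) * y' (r / s)) * (1 / s) / s) (at r)"
    by (rule DERIV_cdivide[OF DERIV_chain2[OF radial_odeD(2)[OF ode rs] d]])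
  then show "((\<lambda>r. y' (r / s) / s) has_real_derivative
      q (r / s) / s\<^sup>2 * y (r / s) - real n / r * (y' (r / s) / s)) (at r)"
    by (rule DERIV_cong) (use r s in \<open>simp add: field_simps power2_eq_square\<close>)
qed

context radial_ground_state
begin

text \<open>Two weighted Wronskians with limit 0 at both ends do the work. \<open>B\<close>, formed
  with W, yields a first zero of y and a strictly negative slope there; \<open>Q\<close>, formed
  with v, refutes either position of that zero relative to R.\<close>

lemma radial_kernel_not_positive_at_0:
  assumes yode: "radial_ode n (\<lambda>r. 1 - 3 * (W r)\<^sup>2) y y'"
    and lim0: "(y \<longlongrightarrow> y0) (at_right 0)" "(y' \<longlongrightarrow> 0) (at_right 0)"
    and decay: "\<And>k. ((\<lambda>r. r ^ k * y r) \<longlongrightarrow> 0) at_top" "\<And>k. ((\<lambda>r. r ^ k * y' r) \<longlongrightarrow> 0) at_top"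
  shows "y0 \<le> 0"
proof (rule ccontr)
  assume "\<not> y0 \<le> 0"
  then have y0: "y0 > 0" by simp
  note dy = radial_odeD[OF yode]
  have yc: "isCont y r" if "r > 0" for r using dy(1)[OF that] DERIV_isCont by blast
  obtain R where R: "R > 0" "(1 - \<theta> R) * (W R)\<^sup>2 = 1" by (rule matching_radius)
  define c where "c = \<theta> R"
  have c1: "1 - c > 0" using R W_pos[OF R(1)] by (metis c_def zero_less_mult_pos2 zero_less_one zero_less_power)
  define v where "v = (\<lambda>r. r * W' r + c * W r)"
  \<comment> \<open>The derivative of \<open>v\<close> after W'' has been eliminated through the
    equation, so that it can be differentiated once more.\<close>
  define v' where "v' = (\<lambda>r. (1 + c - real n) * W' r + r * (W r - W r ^ 3))"
  define g where "g = (\<lambda>r. 2 * W r * ((1 - c) * (W r)\<^sup>2 - 1))"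
  have v_eq: "v r = W r * (c - \<theta> r)" if "r > 0" for r
    using W_pos[OF that] by (simp add: v_def \<theta>_def field_simps)
  have v_pos: "v r > 0" if "0 < r" "r < R" for r
    using \<theta>_strict_mono[OF that] W_pos[of r] that by (simp add: v_eq c_def)
  have v_neg: "v r < 0" if "R < r" for r
    using \<theta>_strict_mono[OF R(1) that] W_pos[of r] R(1) that by (simp add: v_eq c_def mult_less_0_iff)
  have v_R: "v R = 0" using R by (simp add: v_eq c_def)
  have g_pos: "g r > 0" if r: "0 < r" "r < R" for r
  proof -
    have "(W R)\<^sup>2 < (W r)\<^sup>2"
      using W_strict_antimono[OF r] W_pos[OF R(1)] by (intro power_strict_mono) auto
    then have "(1 - c) * (W R)\<^sup>2 < (1 - c) * (W r)\<^sup>2" using c1 by (rule mult_strict_left_mono)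
    then show ?thesis using R(2) W_pos[OF r(1)] by (simp add: g_def c_def)
  qed
  have g_neg: "g r < 0" if r: "R < r" for r
  proof -
    have r0: "r > 0" using r R(1) by simp
    have "(W r)\<^sup>2 < (W R)\<^sup>2"
      using W_strict_antimono[OF R(1) r] W_pos[OF r0] by (intro power_strict_mono) auto
    then have "(1 - c) * (W r)\<^sup>2 < (1 - c) * (W R)\<^sup>2" using c1 by (rule mult_strict_left_mono)
    then show ?thesis using R(2) W_pos[OF r0] by (simp add: g_def c_def mult_less_0_iff)
  qed
  have dv: "(v has_real_derivative v' r) (at r)"
    "(v' has_real_derivative (1 - 3 * (W r)\<^sup>2) * v r - real n / r * v' r - g r) (at r)" if r: "r > 0" for r
  proof -
    have "(v has_real_derivative (1 * W' r + (W r - W r ^ 3 - real n / r * W' r) * r) + c * W' r) (at r)"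
      unfolding v_def by (intro DERIV_add DERIV_mult DERIV_cmult DERIV_ident dW dW' r)
    then show "(v has_real_derivative v' r) (at r)"
      by (rule DERIV_cong) (use r in \<open>simp add: v'_def field_simps\<close>)
    have "(v' has_real_derivative (1 + c - real n) * (W r - W r ^ 3 - real n / r * W' r)
        + (1 * (W r - W r ^ 3) + (W' r - real 3 * (W' r * W r ^ (3 - Suc 0))) * r)) (at r)"
      unfolding v'_def by (intro DERIV_add DERIV_mult DERIV_cmult DERIV_ident DERIV_diff DERIV_power dW dW' r)
    then show "(v' has_real_derivative (1 - 3 * (W r)\<^sup>2) * v r - real n / r * v' r - g r) (at r)"
      by (rule DERIV_cong)
         (use r in \<open>simp add: v_def v'_def g_def field_simps power2_eq_square power3_eq_cube\<close>)
  qed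
  \<comment> \<open>Minus the weighted Wronskian of y and W; the term \<open>W r * 0\<close> is
    zero. By L W = - 2 W^3 its derivative has the sign of y.\<close>
  define B where "B = (\<lambda>r. r ^ n * (W r * 0 - (y' r * W r - y r * W' r)))"
  have dB: "(B has_real_derivative r ^ n * (y r * (2 * W r ^ 3))) (at r)" if r: "r > 0" for r
  proof -
    have "((\<lambda>r. r ^ n * (y' r * W r - y r * W' r)) has_real_derivative r ^ n * (y r * (- 2 * W r ^ 3))) (at r)"
      by (rule wronskian_deriv[where z=W and z'=W', OF yode r dW[OF r]], rule DERIV_cong[OF dW'[OF r]])
         (simp add: power2_eq_square power3_eq_cube algebra_simps)
    from DERIV_minus[OF this] show ?thesis by (simp add: B_def algebra_simps)
  qed
  have B0: "(B \<longlongrightarrow> 0) (at_right 0)"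
  proof -
    have "(B \<longlongrightarrow> 0 ^ n * (W0 * 0 - (0 * W0 - y0 * 0))) (at_right 0)"
      unfolding B_def by (intro tendsto_intros lim0 W_lim_0 W'_lim_0)
    then show ?thesis by simp
  qed
  have Binf: "(B \<longlongrightarrow> 0) at_top"
  proof -
    have "((\<lambda>r. (r ^ n * y r) * W' r - (r ^ n * y' r) * W r) \<longlongrightarrow> 0 * 0 - 0 * 0) at_top"
      by (intro tendsto_intros decay W_lim W'_lim)
    then show ?thesis by (simp add: B_def algebra_simps)
  qed
  define Q where "Q = (\<lambda>r. r ^ n * (y' r * v r - y r * v' r))"
  have dQ: "(Q has_real_derivative r ^ n * (y r * g r)) (at r)" if r: "r > 0" for r
    unfolding Q_def by (rule wronskian_deriv[where z=v and z'=v', OF yode r dv[OF r]])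
  have Q0: "(Q \<longlongrightarrow> 0) (at_right 0)"
  proof -
    have "(Q \<longlongrightarrow> 0 ^ n * (0 * (0 * 0 + c * W0) - y0 * ((1 + c - real n) * 0 + 0 * (W0 - W0 ^ 3)))) (at_right 0)"
      unfolding Q_def v_def v'_def by (intro tendsto_intros lim0 W_lim_0 W'_lim_0)
    then show ?thesis by simp
  qed
  have Qinf: "(Q \<longlongrightarrow> 0) at_top"
  proof -
    have "((\<lambda>r. (r ^ Suc n * y' r) * W' r + c * (r ^ n * y' r) * W r
        - ((1 + c - real n) * (r ^ n * y r) * W' r + (r ^ Suc n * y r) * (W r - W r ^ 3)))
        \<longlongrightarrow> 0 * 0 + c * 0 * 0 - ((1 + c - real n) * 0 * 0 + 0 * (0 - 0 ^ 3))) at_top"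
      by (intro tendsto_intros decay W_lim W'_lim)
    then show ?thesis by (simp add: Q_def v_def v'_def algebra_simps)
  qed
  have "\<forall>\<^sub>F r in at_right 0. 0 < y r" using order_tendstoD(1)[OF lim0(1) y0] .
  then obtain e where e: "e > 0" "\<And>r. 0 < r \<Longrightarrow> r < e \<Longrightarrow> 0 < y r"
    unfolding eventually_at_right_field by blast
  \<comment> \<open>If y stayed positive, \<open>B\<close> would rise strictly from 0 and still have
    limit 0 at infinity.\<close>
  have "\<exists>s>0. y s \<le> 0"
  proof (rule ccontr)
    assume "\<not> (\<exists>s>0. y s \<le> 0)"
    then have pos: "y s > 0" if "s > 0" for s using that by force
    have "0 < B 1"
      by (rule strict_mono_gt_limit_right[OF _ dB _ B0]) (use pos W_pos in auto)
    moreover have "B 1 \<le> 0"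
      by (rule mono_le_limit_at_top[OF _ _ Binf, OF dB]) (use pos W_pos in \<open>auto intro!: mult_nonneg_nonneg less_imp_le\<close>)
    ultimately show False by simp
  qed
  then obtain s where s: "s > 0" "y s \<le> 0" by blast
  obtain r1 where r1: "0 < r1" "y r1 = 0" "\<And>r. 0 < r \<Longrightarrow> r < r1 \<Longrightarrow> y r > 0"
    by (rule first_zero[of 0 s y e]) (use yc e s in auto)
  \<comment> \<open>At a zero of y, \<open>B\<close> reduces to - r^n y' W, so its positivity
    determines the sign of the slope strictly.\<close>
  have "0 < B r1"
    by (rule strict_mono_gt_limit_right[OF r1(1) dB _ B0]) (use r1(3) W_pos in auto)
  then have y'1: "y' r1 < 0"
    using r1 W_pos[OF r1(1)] by (simp add: B_def zero_less_mult_iff mult_less_0_iff)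
  show False
  proof (cases "r1 \<le> R")
    case True
    \<comment> \<open>On (0, r1) both y and g are positive, so \<open>Q\<close> rises from 0; at r1
      it equals r1^n y' v with y' < 0 and v >= 0.\<close>
    have "0 < Q r1"
      by (rule strict_mono_gt_limit_right[OF r1(1) dQ _ Q0])
         (use r1(3) g_pos True in \<open>auto intro!: mult_pos_pos\<close>)
    moreover have "v r1 \<ge> 0" using v_pos[of r1] v_R r1 True by (cases "r1 = R") auto
    then have "y' r1 * v r1 \<le> 0" using y'1 by (simp add: mult_le_0_iff)
    then have "Q r1 \<le> 0" using r1 by (simp add: Q_def mult_le_0_iff)
    ultimately show False by simp
  next
    case False
    then have rR: "R < r1" by simp
    \<comment> \<open>Beyond R both v and g are negative. So Q r1 > 0, and \<open>Q\<close> keeps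
      increasing while y is negative: either up to infinity, where it tends to 0, or up to the next
      zero r2, where y' >= 0 and v < 0 give Q r2 <= 0.\<close>
    have "0 < y' r1 * v r1" using y'1 v_neg[OF rR] by (rule mult_neg_neg)
    then have Q1: "0 < Q r1" using r1 by (simp add: Q_def)
    obtain d where d: "d > 0" "\<And>h. 0 < h \<Longrightarrow> h < d \<Longrightarrow> y (r1 + h) < y r1"
      using DERIV_neg_dec_right[OF dy(1)[OF r1(1)] y'1] by auto
    have right: "- y r > 0" if "r1 < r" "r < r1 + d" for r
      using d(2)[of "r - r1"] that r1(2) by simp
    have yg: "0 < r ^ n * (y r * g r)" if "r1 < r" "y r < 0" for r
      using that g_neg[of r] rR r1(1) by (intro mult_pos_pos mult_neg_neg zero_less_power) auto
    show False
    proof (cases "\<forall>r>r1. y r < 0")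
      case True
      have "Q r1 < 0"
        by (rule strict_mono_lt_limit_at_top[OF dQ _ Qinf]) (use r1(1) yg True in auto)
      then show False using Q1 by simp
    next
      case False
      then obtain s where s: "r1 < s" "- y s \<le> 0" by (auto simp: not_less)
      obtain r2 where r2: "r1 < r2" "- y r2 = 0" "\<And>r. r1 < r \<Longrightarrow> r < r2 \<Longrightarrow> - y r > 0"
        by (rule first_zero[of r1 s "\<lambda>r. - y r" d]) (use yc r1 d(1) right s in \<open>auto intro!: continuous_intros\<close>)
      have r20: "r2 > 0" using r1 r2 by simp
      have "y' r2 \<ge> 0"
      proof (rule ccontr)
        assume "\<not> y' r2 \<ge> 0"
        then obtain d where d: "d > 0" "\<And>h. 0 < h \<Longrightarrow> h < d \<Longrightarrow> y r2 < y (r2 - h)"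
          using DERIV_neg_dec_left[OF dy(1)[OF r20]] by auto
        define h where "h = min (d / 2) ((r2 - r1) / 2)"
        have "0 < h" "h < d" "r1 < r2 - h" using d r2(1) by (auto simp: h_def min_def field_simps)
        then show False using d(2)[of h] r2(2) r2(3)[of "r2 - h"] by simp
      qed
      then have "y' r2 * v r2 \<le> 0" using v_neg[of r2] rR r2 by (simp add: mult_le_0_iff)
      then have "Q r2 \<le> 0" using r2 r20 by (simp add: Q_def mult_le_0_iff)
      moreover have "Q r1 \<le> Q r2"
      proof (rule DERIV_nonneg_imp_nondecreasing[OF less_imp_le[OF r2(1)]])
        fix x assume x: "r1 \<le> x" "x \<le> r2"
        have "0 \<le> x ^ n * (y x * g x)"
        proof (cases "x = r1 \<or> x = r2")
          case True
          then show ?thesis using r1(2) r2(2) by auto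
        next
          case False
          then show ?thesis using yg[of x] r2(3)[of x] x by (auto intro: less_imp_le)
        qed
        then show "\<exists>z. (Q has_real_derivative z) (at x) \<and> 0 \<le> z"
          using dQ[of x] x r1 by (intro exI conjI) auto
      qed
      ultimately show False using Q1 by simp
    qed
  qed
qed

text \<open>The sign statement for y and for - y leaves only y0 = 0, and zero initial data at the
  origin determine the zero solution.\<close>

theorem radial_kernel_trivial:
  assumes yode: "radial_ode n (\<lambda>r. 1 - 3 * (W r)\<^sup>2) y y'"
    and lim0: "(y \<longlongrightarrow> y0) (at_right 0)" "(y' \<longlongrightarrow> 0) (at_right 0)"
    and decay: "\<And>k. ((\<lambda>r. r ^ k * y r) \<longlongrightarrow> 0) at_top" "\<And>k. ((\<lambda>r. r ^ k * y' r) \<longlongrightarrow> 0) at_top"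
    and r: "r > 0"
  shows "y r = 0"
proof -
  have "y0 \<le> 0" by (rule radial_kernel_not_positive_at_0[OF yode lim0 decay])
  moreover have "- y0 \<le> 0"
  proof (rule radial_kernel_not_positive_at_0[where y="\<lambda>r. - y r" and y'="\<lambda>r. - y' r"])
    show "radial_ode n (\<lambda>r. 1 - 3 * (W r)\<^sup>2) (\<lambda>r. - y r) (\<lambda>r. - y' r)"
      unfolding radial_ode_def
    proof (intro allI impI conjI)
      fix r :: real assume r: "r > 0"
      show "((\<lambda>r. - y r) has_real_derivative - y' r) (at r)"
        by (rule DERIV_minus[OF radial_odeD(1)[OF yode r]])
      show "((\<lambda>r. - y' r) has_real_derivative (1 - 3 * (W r)\<^sup>2) * - y r - real n / r * - y' r) (at r)"
        by (rule DERIV_cong[OF DERIV_minus[OF radial_odeD(2)[OF yode r]]]) (simp add: algebra_simps)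
    qed
    show "((\<lambda>r. - y r) \<longlongrightarrow> - y0) (at_right 0)" by (intro tendsto_minus lim0)
    show "((\<lambda>r. - y' r) \<longlongrightarrow> 0) (at_right 0)" using tendsto_minus[OF lim0(2)] by simp
    show "((\<lambda>r. r ^ k * - y r) \<longlongrightarrow> 0) at_top" for k using tendsto_minus[OF decay(1)[of k]] by simp
    show "((\<lambda>r. r ^ k * - y' r) \<longlongrightarrow> 0) at_top" for k using tendsto_minus[OF decay(2)[of k]] by simp
  qed
  ultimately have "y0 = 0" by simp
  show ?thesis
  proof (rule radial_ode_zero[OF yode _ _ lim0(2) r])
    show "(y \<longlongrightarrow> 0) (at_right 0)" using lim0(1) \<open>y0 = 0\<close> by simp
    show "\<bar>1 - 3 * (W s)\<^sup>2\<bar> \<le> 1 + 3 * W0\<^sup>2" if "s > 0" for s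
    proof -
      have "(W s)\<^sup>2 \<le> W0\<^sup>2" using W_pos[OF that] W_le[OF that] by (intro power_mono) auto
      moreover have "0 \<le> (W s)\<^sup>2" by simp
      ultimately show ?thesis by linarith
    qed
  qed
qed

end

section \<open>Weak solutions\<close>

lemma L2_mult_integrable:
  assumes "L2 f" "L2 g"
  shows "integrable lborel (\<lambda>x. f x * g x)"
proof (rule Bochner_Integration.integrable_bound)
  show "integrable lborel (\<lambda>x. (f x)\<^sup>2 + (g x)\<^sup>2)"
    using assms by (auto simp: L2_def)
  show "(\<lambda>x. f x * g x) \<in> borel_measurable lborel"
    using assms by (auto simp: L2_def)
  show "AE x in lborel. norm (f x * g x) \<le> norm ((f x)\<^sup>2 + (g x)\<^sup>2)"
  proof (rule AE_I2)
    fix x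
    have "0 \<le> (\<bar>f x\<bar> - \<bar>g x\<bar>)\<^sup>2" by simp
    then have "2 * (\<bar>f x\<bar> * \<bar>g x\<bar>) \<le> (f x)\<^sup>2 + (g x)\<^sup>2" by (simp add: power2_diff)
    moreover have "0 \<le> \<bar>f x\<bar> * \<bar>g x\<bar>" by simp
    ultimately have "\<bar>f x\<bar> * \<bar>g x\<bar> \<le> (f x)\<^sup>2 + (g x)\<^sup>2" by linarith
    then show "norm (f x * g x) \<le> norm ((f x)\<^sup>2 + (g x)\<^sup>2)"
      by (simp add: abs_mult)
  qed
qed

lemma L2_cmult: "L2 f \<Longrightarrow> L2 (\<lambda>x. c * f x)"
  by (auto simp: L2_def power_mult_distrib)

lemma L2_add:
  assumes f: "L2 f" and g: "L2 g"
  shows "L2 (\<lambda>x. f x + g x)"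
proof -
  have "integrable lborel (\<lambda>x. (f x)\<^sup>2 + (g x)\<^sup>2 + 2 * (f x * g x))"
    using f g L2_mult_integrable[OF f g]
    by (intro Bochner_Integration.integrable_add integrable_mult_right) (auto simp: L2_def)
  moreover have "(\<lambda>x. (f x + g x)\<^sup>2) = (\<lambda>x. (f x)\<^sup>2 + (g x)\<^sup>2 + 2 * (f x * g x))"
    by (auto simp: power2_sum)
  ultimately show ?thesis using f g by (auto simp: L2_def)
qed

lemma test_function_iff: "test_function \<psi> \<longleftrightarrow> smooth \<psi> \<and> compact (closure {x. \<psi> x \<noteq> 0})"
  by (simp add: test_function_def smooth_def)

lemma test_function_linear: "test_function \<psi> \<Longrightarrow> linear (frechet_derivative \<psi> (at x))"
  unfolding test_function_iff using has_derivative_linear[OF smooth_has_derivative] by blast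

lemma test_function_L2:
  fixes \<psi> :: "'a::euclidean_space \<Rightarrow> real"
  assumes "test_function \<psi>"
  shows "L2 \<psi>"
proof -
  let ?S = "closure {x. \<psi> x \<noteq> 0}"
  have c: "continuous_on UNIV \<psi>" and S: "compact ?S"
    using assms smooth_continuous by (auto simp: test_function_iff)
  have "integrable lborel (\<lambda>x. indicator ?S x *\<^sub>R (\<psi> x)\<^sup>2)"
    by (rule borel_integrable_compact[OF S]) (intro continuous_intros continuous_on_subset[OF c] subset_UNIV)
  also have "(\<lambda>x. indicator ?S x *\<^sub>R (\<psi> x)\<^sup>2) = (\<lambda>x. (\<psi> x)\<^sup>2)"
    using closure_subset[of "{x. \<psi> x \<noteq> 0}"] by (auto simp: indicator_def fun_eq_iff)
  finally show ?thesis
    using borel_measurable_continuous_onI[OF c] by (simp add: L2_def)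
qed

lemma test_function_frechet:
  fixes \<psi> :: "'a::euclidean_space \<Rightarrow> real"
  assumes t: "test_function \<psi>" and b: "b \<in> Basis"
  shows "test_function (\<lambda>x. frechet_derivative \<psi> (at x) b)"
proof -
  let ?S = "closure {x. \<psi> x \<noteq> 0}"
  have "{x. frechet_derivative \<psi> (at x) b \<noteq> 0} \<subseteq> ?S"
  proof (rule subsetI, rule ccontr)
    fix x assume x: "x \<in> {x. frechet_derivative \<psi> (at x) b \<noteq> 0}" and nS: "x \<notin> ?S"
    have z: "((\<lambda>_::'a. 0::real) has_derivative (\<lambda>_. 0)) (at x)" by simp
    have "(\<psi> has_derivative (\<lambda>_. 0)) (at x)"
      by (rule has_derivative_transform_within_open[where f="\<lambda>_. 0" and s="- ?S", OF z])
         (use nS closure_subset[of "{x. \<psi> x \<noteq> 0}"] in auto)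
    then have "frechet_derivative \<psi> (at x) = (\<lambda>_. 0)"
      by (rule frechet_derivative_at[symmetric])
    then show False using x by simp
  qed
  then have "closure {x. frechet_derivative \<psi> (at x) b \<noteq> 0} \<subseteq> ?S"
    by (rule closure_minimal) simp
  then have "compact (closure {x. frechet_derivative \<psi> (at x) b \<noteq> 0})"
    using t unfolding test_function_iff by (metis closed_closure compact_Int_closed inf.absorb_iff2)
  then show ?thesis
    using t smooth_frechet[OF _ b] by (auto simp: test_function_iff)
qed

lemma frechet_Basis_sum:
  fixes \<psi> :: "'a::euclidean_space \<Rightarrow> real"
  assumes "smooth \<psi>"
  shows "frechet_derivative \<psi> (at x) h = (\<Sum>b\<in>Basis. (h \<bullet> b) * frechet_derivative \<psi> (at x) b)"
proof -
  have lin: "linear (frechet_derivative \<psi> (at x))"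
    using smooth_has_derivative[OF assms] by (rule has_derivative_linear)
  have "frechet_derivative \<psi> (at x) h = frechet_derivative \<psi> (at x) (\<Sum>b\<in>Basis. (h \<bullet> b) *\<^sub>R b)"
    by (simp add: euclidean_representation)
  then show ?thesis
    by (simp add: linear_sum[OF lin] linear_cmul[OF lin])
qed

abbreviation laplacian :: "('a::euclidean_space \<Rightarrow> real) \<Rightarrow> 'a \<Rightarrow> real" where
  "laplacian \<psi> x \<equiv> \<Sum>b\<in>Basis. frechet_derivative (\<lambda>x. frechet_derivative \<psi> (at x) b) (at x) b"

text \<open>All products are of two L^2 functions. Each partial derivative of a test function is
  again a test function, so the definition of the weak gradient can be applied to it and moves the
  second derivative over.\<close>

lemma gradient_pairing_integrable:
  assumes g: "has_H1_gradient u g" and t: "test_function \<psi>"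
  shows "integrable lborel (\<lambda>x. frechet_derivative \<psi> (at x) (g x))"
    and "integrable lborel (\<lambda>x. u x * \<psi> x)"
    and "(\<integral>x. frechet_derivative \<psi> (at x) (g x) \<partial>lborel)
      = - (\<integral>x. u x * laplacian \<psi> x \<partial>lborel)"
proof -
  have sm: "smooth \<psi>" using t by (simp add: test_function_iff)
  have Lg: "L2 (\<lambda>x. g x \<bullet> b)" if "b \<in> Basis" for b using g that by (simp add: has_H1_gradient_def)
  have Lu: "L2 u" using g by (simp add: has_H1_gradient_def)
  note tb = test_function_frechet[OF t]
  have i1: "integrable lborel (\<lambda>x. (g x \<bullet> b) * frechet_derivative \<psi> (at x) b)" if "b \<in> Basis" for b
    using that by (intro L2_mult_integrable Lg test_function_L2 tb)
  have i2: "integrable lborel (\<lambda>x. u x * frechet_derivative (\<lambda>x. frechet_derivative \<psi> (at x) b) (at x) b)" if "b \<in> Basis" for b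
    using that by (intro L2_mult_integrable Lu test_function_L2 test_function_frechet tb)
  have eq: "(\<lambda>x. frechet_derivative \<psi> (at x) (g x)) = (\<lambda>x. \<Sum>b\<in>Basis. (g x \<bullet> b) * frechet_derivative \<psi> (at x) b)"
    by (rule ext, rule frechet_Basis_sum[OF sm])
  show "integrable lborel (\<lambda>x. frechet_derivative \<psi> (at x) (g x))"
    unfolding eq by (intro Bochner_Integration.integrable_sum i1)
  show "integrable lborel (\<lambda>x. u x * \<psi> x)"
    by (intro L2_mult_integrable Lu test_function_L2 t)
  have "(\<integral>x. frechet_derivative \<psi> (at x) (g x) \<partial>lborel)
      = (\<Sum>b\<in>Basis. \<integral>x. (g x \<bullet> b) * frechet_derivative \<psi> (at x) b \<partial>lborel)"
    unfolding eq by (intro Bochner_Integration.integral_sum i1)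
  also have "\<dots> = (\<Sum>b\<in>Basis. - (\<integral>x. u x * frechet_derivative (\<lambda>x. frechet_derivative \<psi> (at x) b) (at x) b \<partial>lborel))"
    using g tb by (intro sum.cong) (auto simp: has_H1_gradient_def)
  also have "\<dots> = - (\<integral>x. (\<Sum>b\<in>Basis. u x * frechet_derivative (\<lambda>x. frechet_derivative \<psi> (at x) b) (at x) b) \<partial>lborel)"
    by (simp add: sum_negf Bochner_Integration.integral_sum[OF i2])
  finally show "(\<integral>x. frechet_derivative \<psi> (at x) (g x) \<partial>lborel)
      = - (\<integral>x. u x * laplacian \<psi> x \<partial>lborel)"
    by (simp add: sum_distrib_left)
qed

text \<open>With both derivatives on the test function the gradient of u disappears; only values of
  u remain, and these have a radial profile.\<close>

lemma weak_solution_distributional: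
  assumes ws: "weak_solution u f" and t: "test_function \<psi>"
  shows "(\<integral>x. u x * laplacian \<psi> x \<partial>lborel)
    = (\<integral>x. (u x - f x) * \<psi> x \<partial>lborel)"
proof -
  obtain g where g: "has_H1_gradient u g" and f: "integrable lborel (\<lambda>x. f x * \<psi> x)"
    "(\<integral>x. frechet_derivative \<psi> (at x) (g x) + u x * \<psi> x \<partial>lborel) = (\<integral>x. f x * \<psi> x \<partial>lborel)"
    using ws t unfolding weak_solution_def by blast
  note gp = gradient_pairing_integrable[OF g t]
  have "(\<integral>x. (u x - f x) * \<psi> x \<partial>lborel) = (\<integral>x. u x * \<psi> x \<partial>lborel) - (\<integral>x. f x * \<psi> x \<partial>lborel)"
    by (simp add: left_diff_distrib Bochner_Integration.integral_diff[OF gp(2) f(1)])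
  also have "(\<integral>x. f x * \<psi> x \<partial>lborel) = (\<integral>x. frechet_derivative \<psi> (at x) (g x) \<partial>lborel) + (\<integral>x. u x * \<psi> x \<partial>lborel)"
    using f(2) by (simp add: Bochner_Integration.integral_add[OF gp(1,2)])
  finally show ?thesis using gp(3) by simp
qed

lemma weak_solution_L2: "weak_solution u f \<Longrightarrow> L2 u"
  by (auto simp: weak_solution_def has_H1_gradient_def)

lemma weak_solution_H1: "weak_solution u f \<Longrightarrow> H1 u"
  by (auto simp: weak_solution_def H1_def)

text \<open>Testing with z (|x|^2) and integrating in polar coordinates reduces the weak equation to
  \<open>radial_distribution\<close>. The form potential times u also covers the cubic equation,
  with w^2 as potential.\<close>

lemma radial_weak_solution_ode:
  fixes u :: "'a::euclidean_space \<Rightarrow> real"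
  assumes dim: "DIM('a) = Suc n" and n: "n \<le> 2" and rad: "radial u"
    and ws: "weak_solution u (\<lambda>x. v (norm x) * u x)"
    and v: "continuous_on UNIV v" "\<And>r. \<bar>1 - v r\<bar> \<le> K"
  obtains y y' where "continuous_on UNIV y" "radial_ode n (\<lambda>r. 1 - v r) y y'"
    "(y' \<longlongrightarrow> 0) (at_right 0)" "vanishing_tail y" "AE x in lborel. u x = y (norm x)"
proof -
  obtain e :: 'a where e: "e \<in> Basis" using nonempty_Basis by blast
  define p where "p = (\<lambda>r. u (r *\<^sub>R e))"
  have up: "u x = p (norm x)" for x
  proof -
    have "norm (norm x *\<^sub>R e) = norm x" using e by simp
    then show ?thesis using rad unfolding radial_def p_def by metis
  qed
  have [measurable]: "u \<in> borel_measurable borel"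
    using weak_solution_L2[OF ws] by (simp add: L2_def)
  have p_meas [measurable]: "p \<in> borel_measurable borel"
    unfolding p_def by measurable
  have v_meas [measurable]: "v \<in> borel_measurable borel"
    by (rule borel_measurable_continuous_onI[OF v(1)])
  have "integrable lborel (\<lambda>x::'a. (p (norm x))\<^sup>2)"
    using weak_solution_L2[OF ws] by (simp add: L2_def up)
  then have p_L2: "integrable lborel (\<lambda>r. indicator {0<..} r * (r ^ n * (p r)\<^sup>2))"
    by (subst (asm) integrable_norm_iff[OF dim, of "\<lambda>r. (p r)\<^sup>2"]) auto
  interpret radial_distribution n p v K
  proof
    fix z z' z'' :: "real \<Rightarrow> real" and b
    assume sm: "smooth z" and z': "\<And>t. (z has_real_derivative z' t) (at t)"
      and z'': "\<And>t. (z' has_real_derivative z'' t) (at t)" and zb: "\<And>t. t \<ge> b \<Longrightarrow> z t = 0"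
    let ?Z = "\<lambda>t. 2 * real (Suc n) * z' t + 4 * t * z'' t"
    have t: "test_function (\<lambda>x::'a. z (x \<bullet> x))"
      by (rule test_function_norm_square[OF sm zb])
    \<comment> \<open>\<open>z'\<close> and \<open>z''\<close> are given without regularity;
      uniqueness of derivatives identifies them with smooth functions, which makes them
      measurable.\<close>
    obtain z1 where z1: "\<And>t. (z has_real_derivative z1 t) (at t)" "smooth z1"
      using smooth_realE[OF sm] by blast
    have z1_eq: "z1 = z'" using DERIV_unique[OF z1(1) z'] by blast
    obtain z2 where z2: "\<And>t. (z' has_real_derivative z2 t) (at t)" "smooth z2"
      using smooth_realE[OF z1(2)] z1_eq by blast
    have z2_eq: "z2 = z''" using DERIV_unique[OF z2(1) z''] by blast
    have [measurable]: "z \<in> borel_measurable borel" "z' \<in> borel_measurable borel" "z'' \<in> borel_measurable borel"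
      using sm z1(2) z2(2) unfolding z1_eq z2_eq by (auto intro!: borel_measurable_continuous_onI smooth_continuous)
    have lap: "laplacian (\<lambda>x. z (x \<bullet> x)) x
        = ?Z ((norm x)\<^sup>2)" for x :: 'a
    proof -
      have sq: "(norm x)\<^sup>2 = (\<Sum>b\<in>Basis. (x \<bullet> b)\<^sup>2)"
        unfolding power2_norm_eq_inner by (subst euclidean_inner) (simp add: power2_eq_square)
      have "laplacian (\<lambda>x. z (x \<bullet> x)) x
          = (\<Sum>b\<in>Basis. 2 * z' (x \<bullet> x) + 4 * (x \<bullet> b)\<^sup>2 * z'' (x \<bullet> x))"
        by (intro sum.cong refl frechet2_norm_square z' z'')
      also have "\<dots> = 2 * real (Suc n) * z' (x \<bullet> x) + 4 * (\<Sum>b\<in>Basis. (x \<bullet> b)\<^sup>2) * z'' (x \<bullet> x)"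
        by (simp add: sum.distrib dim sum_distrib_left sum_distrib_right)
      finally show ?thesis unfolding sq[symmetric] power2_norm_eq_inner .
    qed
    have "sphere_area n * (\<integral>r. indicator {0<..} r * (r ^ n * (p r * ?Z (r\<^sup>2))) \<partial>lborel)
      = (\<integral>x. p (norm (x::'a)) * ?Z ((norm x)\<^sup>2) \<partial>lborel)"
      by (rule integral_norm[OF dim, symmetric]) measurable
    also have "\<dots> = (\<integral>x. (u x - v (norm x) * u x) * z (x \<bullet> x) \<partial>lborel)"
      using weak_solution_distributional[OF ws t] unfolding lap up by simp
    also have "\<dots> = (\<integral>x. (1 - v (norm (x::'a))) * p (norm x) * z ((norm x)\<^sup>2) \<partial>lborel)"
      by (simp add: up power2_norm_eq_inner algebra_simps)
    also have "\<dots> = sphere_area n * (\<integral>r. indicator {0<..} r * (r ^ n * ((1 - v r) * p r * z (r\<^sup>2))) \<partial>lborel)"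
      by (rule integral_norm[OF dim]) measurable
    finally show "(\<integral>r. indicator {0<..} r * (r ^ n * (p r * ?Z (r\<^sup>2))) \<partial>lborel)
      = (\<integral>r. indicator {0<..} r * (r ^ n * ((1 - v r) * p r * z (r\<^sup>2))) \<partial>lborel)"
      using sphere_area_pos[of n] by simp
  qed (use p_meas v p_L2 in auto)
  obtain y y' where y: "continuous_on UNIV y"
    "\<And>r. r > 0 \<Longrightarrow> (y has_real_derivative y' r) (at r)"
    "\<And>r. r > 0 \<Longrightarrow> (y' has_real_derivative (1 - v r) * y r - real n / r * y' r) (at r)"
    "\<exists>B. \<forall>r. 0 < r \<longrightarrow> r \<le> 1 \<longrightarrow> \<bar>y' r\<bar> \<le> B * r"
    "vanishing_tail y" "AE r in lborel. r > 0 \<longrightarrow> p r = y r"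
    by (rule regularity[OF n]) (rule that)
  have "radial_ode n (\<lambda>r. 1 - v r) y y'" using y(2,3) by (simp add: radial_ode_def)
  moreover have "(y' \<longlongrightarrow> 0) (at_right 0)"
  proof -
    obtain B where B: "\<And>r. 0 < r \<Longrightarrow> r \<le> 1 \<Longrightarrow> \<bar>y' r\<bar> \<le> B * r" using y(4) by blast
    have "((\<lambda>r. B * r) \<longlongrightarrow> B * 0) (at_right 0)" by (intro tendsto_intros)
    then have "((\<lambda>r. B * r) \<longlongrightarrow> 0) (at_right 0)" by simp
    moreover have "\<forall>\<^sub>F r in at_right 0. norm (y' r) \<le> B * r"
      unfolding eventually_at_right_field using B by (intro exI[of _ 1]) auto
    ultimately show ?thesis by (rule Lim_null_comparison[rotated])
  qed
  moreover have "AE x in lborel. u x = y (norm x)"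
  proof -
    have [measurable]: "y \<in> borel_measurable borel" by (rule borel_measurable_continuous_onI[OF y(1)])
    have "AE x in (lborel :: 'a measure). p (norm x) = y (norm x)"
      by (rule AE_norm[OF _ y(6)]) measurable
    then show ?thesis by (simp add: up)
  qed
  ultimately show ?thesis using y(1,5) by (intro that)
qed

section \<open>Linear combinations and dilations of weak solutions\<close>

lemma weak_solution_add_cmult:
  fixes u v :: "'a::euclidean_space \<Rightarrow> real"
  assumes "weak_solution u f" "weak_solution v g"
  shows "weak_solution (\<lambda>x. u x + c * v x) (\<lambda>x. f x + c * g x)"
proof -
  obtain gu where gu: "has_H1_gradient u gu"
    "\<And>\<psi>. test_function \<psi> \<Longrightarrow> integrable lborel (\<lambda>x. f x * \<psi> x)"
    "\<And>\<psi>. test_function \<psi> \<Longrightarrow> (\<integral>x. frechet_derivative \<psi> (at x) (gu x) + u x * \<psi> x \<partial>lborel) = (\<integral>x. f x * \<psi> x \<partial>lborel)"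
    using assms(1) unfolding weak_solution_def by blast
  obtain gv where gv: "has_H1_gradient v gv"
    "\<And>\<psi>. test_function \<psi> \<Longrightarrow> integrable lborel (\<lambda>x. g x * \<psi> x)"
    "\<And>\<psi>. test_function \<psi> \<Longrightarrow> (\<integral>x. frechet_derivative \<psi> (at x) (gv x) + v x * \<psi> x \<partial>lborel) = (\<integral>x. g x * \<psi> x \<partial>lborel)"
    using assms(2) unfolding weak_solution_def by blast
  have L: "L2 u" "L2 v" "\<And>b. b \<in> Basis \<Longrightarrow> L2 (\<lambda>x. gu x \<bullet> b)" "\<And>b. b \<in> Basis \<Longrightarrow> L2 (\<lambda>x. gv x \<bullet> b)"
    using gu(1) gv(1) by (auto simp: has_H1_gradient_def)
  have part: "(\<integral>x. (u x + c * v x) * frechet_derivative \<psi> (at x) b \<partial>lborel) = - (\<integral>x. ((gu x + c *\<^sub>R gv x) \<bullet> b) * \<psi> x \<partial>lborel)"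
    if t: "test_function \<psi>" and b: "b \<in> Basis" for \<psi> b
  proof -
    note Lt = test_function_L2[OF t] test_function_L2[OF test_function_frechet[OF t b]]
    note i = L2_mult_integrable[OF L(1) Lt(2)] L2_mult_integrable[OF L(2) Lt(2)]
      L2_mult_integrable[OF L(3)[OF b] Lt(1)] L2_mult_integrable[OF L(4)[OF b] Lt(1)]
    have "(\<integral>x. (u x + c * v x) * frechet_derivative \<psi> (at x) b \<partial>lborel)
      = (\<integral>x. u x * frechet_derivative \<psi> (at x) b \<partial>lborel) + c * (\<integral>x. v x * frechet_derivative \<psi> (at x) b \<partial>lborel)"
      using i by (simp add: distrib_right mult.assoc)
    also have "\<dots> = - ((\<integral>x. (gu x \<bullet> b) * \<psi> x \<partial>lborel) + c * (\<integral>x. (gv x \<bullet> b) * \<psi> x \<partial>lborel))"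
      using gu(1) gv(1) t b by (simp add: has_H1_gradient_def)
    also have "\<dots> = - (\<integral>x. ((gu x + c *\<^sub>R gv x) \<bullet> b) * \<psi> x \<partial>lborel)"
      using i by (simp add: inner_add_left distrib_right mult.assoc)
    finally show ?thesis .
  qed
  have "has_H1_gradient (\<lambda>x. u x + c * v x) (\<lambda>x. gu x + c *\<^sub>R gv x)"
    unfolding has_H1_gradient_def using part L
    by (auto simp: inner_add_left intro!: L2_add L2_cmult)
  moreover have "integrable lborel (\<lambda>x. (f x + c * g x) * \<psi> x)" if "test_function \<psi>" for \<psi>
    using gu(2)[OF that] gv(2)[OF that] by (simp add: distrib_right mult.assoc)
  moreover have "(\<integral>x. frechet_derivative \<psi> (at x) (gu x + c *\<^sub>R gv x) + (u x + c * v x) * \<psi> x \<partial>lborel)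
      = (\<integral>x. (f x + c * g x) * \<psi> x \<partial>lborel)" if t: "test_function \<psi>" for \<psi>
  proof -
    have lin: "linear (frechet_derivative \<psi> (at x))" for x
      by (rule test_function_linear[OF t])
    note iu = gradient_pairing_integrable(1,2)[OF gu(1) t]
    note iv = gradient_pairing_integrable(1,2)[OF gv(1) t]
    have "(\<integral>x. frechet_derivative \<psi> (at x) (gu x + c *\<^sub>R gv x) + (u x + c * v x) * \<psi> x \<partial>lborel)
      = (\<integral>x. (frechet_derivative \<psi> (at x) (gu x) + u x * \<psi> x) + c * (frechet_derivative \<psi> (at x) (gv x) + v x * \<psi> x) \<partial>lborel)"
      by (rule Bochner_Integration.integral_cong)
         (auto simp: linear_add[OF lin] linear_cmul[OF lin] algebra_simps)
    also have "\<dots> = (\<integral>x. f x * \<psi> x \<partial>lborel) + c * (\<integral>x. g x * \<psi> x \<partial>lborel)"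
      using iu iv gu(3)[OF t] gv(3)[OF t] by simp
    also have "\<dots> = (\<integral>x. (f x + c * g x) * \<psi> x \<partial>lborel)"
      using gu(2)[OF t] gv(2)[OF t] by (simp add: distrib_right mult.assoc)
    finally show ?thesis .
  qed
  ultimately show ?thesis unfolding weak_solution_def by blast
qed

lemma integral_lborel_scaleR:
  fixes h :: "'a::euclidean_space \<Rightarrow> real"
  assumes s: "s > 0" and [measurable]: "h \<in> borel_measurable borel"
  shows "(\<integral>x. h (s *\<^sub>R x) \<partial>lborel) = (\<integral>x. h x \<partial>lborel) / s ^ DIM('a)"
    and "integrable lborel (\<lambda>x. h (s *\<^sub>R x)) \<longleftrightarrow> integrable lborel h"
proof -
  have eq: "lborel = density (distr lborel borel (\<lambda>x::'a. s *\<^sub>R x)) (\<lambda>_. ennreal (s ^ DIM('a)))"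
    using lborel_affine[of s 0] s by (simp add: abs_of_pos)
  have "(\<integral>x. h x \<partial>lborel) = (\<integral>x. s ^ DIM('a) *\<^sub>R h x \<partial>distr lborel borel (\<lambda>x::'a. s *\<^sub>R x))"
    by (subst eq, subst integral_density) (use s in auto)
  also have "\<dots> = (\<integral>x. s ^ DIM('a) *\<^sub>R h (s *\<^sub>R x) \<partial>lborel)"
    by (subst integral_distr) auto
  finally show "(\<integral>x. h (s *\<^sub>R x) \<partial>lborel) = (\<integral>x. h x \<partial>lborel) / s ^ DIM('a)"
    using s by simp
  have "integrable lborel h \<longleftrightarrow> integrable (distr lborel borel (\<lambda>x::'a. s *\<^sub>R x)) (\<lambda>x. s ^ DIM('a) *\<^sub>R h x)"
    by (subst eq, subst integrable_density) (use s in auto)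
  also have "\<dots> \<longleftrightarrow> integrable lborel (\<lambda>x. s ^ DIM('a) *\<^sub>R h (s *\<^sub>R x))"
    by (subst integrable_distr_eq) auto
  also have "\<dots> \<longleftrightarrow> integrable lborel (\<lambda>x. h (s *\<^sub>R x))"
    using s by simp
  finally show "integrable lborel (\<lambda>x. h (s *\<^sub>R x)) \<longleftrightarrow> integrable lborel h" by simp
qed

lemma test_function_scaleR:
  fixes \<psi> :: "'a::euclidean_space \<Rightarrow> real"
  assumes t: "test_function \<psi>" and c: "c \<noteq> 0"
  shows "test_function (\<lambda>x. \<psi> (c *\<^sub>R x))"
proof -
  have "smooth (\<lambda>x. \<psi> (c *\<^sub>R x + 0))" using t by (intro smooth_affine) (simp add: test_function_iff)
  moreover have "{x. \<psi> (c *\<^sub>R x) \<noteq> 0} = (\<lambda>x. (1 / c) *\<^sub>R x) ` {x. \<psi> x \<noteq> 0}"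
    using c by (auto simp: image_iff intro!: exI[of _ "c *\<^sub>R _"])
  then have "closure {x. \<psi> (c *\<^sub>R x) \<noteq> 0} = (\<lambda>x. (1 / c) *\<^sub>R x) ` closure {x. \<psi> x \<noteq> 0}"
    by (simp add: closure_scaleR)
  moreover have "compact ((\<lambda>x. (1 / c) *\<^sub>R x) ` closure {x. \<psi> x \<noteq> 0})"
    using t by (intro compact_scaling) (simp add: test_function_iff)
  ultimately show ?thesis by (simp add: test_function_iff)
qed

text \<open>From - Laplace u = f - u the dilated function satisfies - Laplace (u (s x)) = s^2 (f -
  u) (s x); adding u (s x) gives the right-hand side.\<close>

lemma weak_solution_scaleR:
  fixes u f :: "'a::euclidean_space \<Rightarrow> real"
  assumes ws: "weak_solution u f" and s: "s > 0" and f_meas: "f \<in> borel_measurable borel"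
  shows "weak_solution (\<lambda>x. a * u (s *\<^sub>R x)) (\<lambda>x. a * (s\<^sup>2 * f (s *\<^sub>R x) + (1 - s\<^sup>2) * u (s *\<^sub>R x)))"
proof -
  obtain g where g: "has_H1_gradient u g"
    "\<And>\<psi>. test_function \<psi> \<Longrightarrow> integrable lborel (\<lambda>x. f x * \<psi> x)"
    "\<And>\<psi>. test_function \<psi> \<Longrightarrow> (\<integral>x. frechet_derivative \<psi> (at x) (g x) + u x * \<psi> x \<partial>lborel) = (\<integral>x. f x * \<psi> x \<partial>lborel)"
    using ws unfolding weak_solution_def by blast
  define N where "N = s ^ DIM('a)"
  have L: "L2 u" "\<And>b. b \<in> Basis \<Longrightarrow> L2 (\<lambda>x. g x \<bullet> b)"
    using g(1) by (auto simp: has_H1_gradient_def)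
  have L2s: "L2 (\<lambda>x. c * h (s *\<^sub>R x))" if h: "L2 h" for h :: "'a \<Rightarrow> real" and c
  proof (rule L2_cmult)
    have [measurable]: "h \<in> borel_measurable borel" using h by (simp add: L2_def)
    show "L2 (\<lambda>x. h (s *\<^sub>R x))"
      using h integral_lborel_scaleR(2)[OF s, of "\<lambda>x. (h x)\<^sup>2"] by (simp add: L2_def)
  qed
  have D: "frechet_derivative (\<lambda>x. \<psi> (s *\<^sub>R x)) (at x) h = s * frechet_derivative \<psi> (at (s *\<^sub>R x)) h"
    if t: "test_function \<psi>" for \<psi> :: "'a \<Rightarrow> real" and x h
  proof -
    have d: "(\<psi> has_derivative frechet_derivative \<psi> (at (s *\<^sub>R x))) (at (s *\<^sub>R x))"
      using t by (intro smooth_has_derivative) (simp add: test_function_iff)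
    have "((\<lambda>x. \<psi> (s *\<^sub>R x)) has_derivative (\<lambda>h. frechet_derivative \<psi> (at (s *\<^sub>R x)) (s *\<^sub>R h))) (at x)"
      by (rule has_derivative_compose[where f="\<lambda>x. s *\<^sub>R x" and g=\<psi>, OF _ d]) (auto intro!: derivative_eq_intros)
    from frechet_derivative_at[OF this]
    show ?thesis using linear_cmul[OF has_derivative_linear[OF d]] by (metis real_scaleR_def)
  qed
  \<comment> \<open>Every test function is the dilation of another one, so a change of variables
    leads back to the equation of u.\<close>
  have rescale: "\<exists>\<psi>'. test_function \<psi>' \<and> \<psi> = (\<lambda>x. \<psi>' (s *\<^sub>R x))" if "test_function \<psi>" for \<psi> :: "'a \<Rightarrow> real"
    using test_function_scaleR[OF that, of "1 / s"] s
    by (intro exI[of _ "\<lambda>x. \<psi> ((1 / s) *\<^sub>R x)"]) auto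
  have meas: "h \<in> borel_measurable borel" if "integrable lborel h" for h :: "'a \<Rightarrow> real"
    using borel_measurable_integrable[OF that] by simp
  have part: "(\<integral>x. (a * u (s *\<^sub>R x)) * frechet_derivative \<psi> (at x) b \<partial>lborel)
      = - (\<integral>x. (((a * s) *\<^sub>R g (s *\<^sub>R x)) \<bullet> b) * \<psi> x \<partial>lborel)"
    if t: "test_function \<psi>" and b: "b \<in> Basis" for \<psi> b
  proof -
    obtain \<psi>' where \<psi>': "test_function \<psi>'" "\<psi> = (\<lambda>x. \<psi>' (s *\<^sub>R x))" using rescale[OF t] by blast
    note i = L2_mult_integrable[OF L(1) test_function_L2[OF test_function_frechet[OF \<psi>'(1) b]]]
      L2_mult_integrable[OF L(2)[OF b] test_function_L2[OF \<psi>'(1)]]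
    have "(\<integral>x. (a * u (s *\<^sub>R x)) * frechet_derivative \<psi> (at x) b \<partial>lborel)
      = (\<integral>x. (a * s) * (u (s *\<^sub>R x) * frechet_derivative \<psi>' (at (s *\<^sub>R x)) b) \<partial>lborel)"
      unfolding \<psi>'(2) D[OF \<psi>'(1)] by (simp add: mult_ac)
    also have "\<dots> = (a * s) * ((\<integral>x. u x * frechet_derivative \<psi>' (at x) b \<partial>lborel) / N)"
      using integral_lborel_scaleR(1)[OF s meas[OF i(1)]] by (simp add: N_def)
    also have "\<dots> = - ((a * s) * ((\<integral>x. (g x \<bullet> b) * \<psi>' x \<partial>lborel) / N))"
      using g(1) \<psi>'(1) b by (simp add: has_H1_gradient_def)
    also have "\<dots> = - (\<integral>x. (a * s) * ((g (s *\<^sub>R x) \<bullet> b) * \<psi>' (s *\<^sub>R x)) \<partial>lborel)"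
      using integral_lborel_scaleR(1)[OF s meas[OF i(2)]] by (simp add: N_def)
    finally show ?thesis unfolding \<psi>'(2) by (simp add: mult_ac)
  qed
  have "has_H1_gradient (\<lambda>x. a * u (s *\<^sub>R x)) (\<lambda>x. (a * s) *\<^sub>R g (s *\<^sub>R x))"
    unfolding has_H1_gradient_def using part L L2s[OF L(1)] L2s[OF L(2)] by auto
  moreover have "integrable lborel (\<lambda>x. (a * (s\<^sup>2 * f (s *\<^sub>R x) + (1 - s\<^sup>2) * u (s *\<^sub>R x))) * \<psi> x) \<and>
     (\<integral>x. frechet_derivative \<psi> (at x) ((a * s) *\<^sub>R g (s *\<^sub>R x)) + (a * u (s *\<^sub>R x)) * \<psi> x \<partial>lborel)
      = (\<integral>x. (a * (s\<^sup>2 * f (s *\<^sub>R x) + (1 - s\<^sup>2) * u (s *\<^sub>R x))) * \<psi> x \<partial>lborel)" if t: "test_function \<psi>" for \<psi>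
  proof -
    obtain \<psi>' where \<psi>': "test_function \<psi>'" "\<psi> = (\<lambda>x. \<psi>' (s *\<^sub>R x))" using rescale[OF t] by blast
    note i = gradient_pairing_integrable(1,2)[OF g(1) \<psi>'(1)] g(2)[OF \<psi>'(1)]
    have lin: "linear (frechet_derivative \<psi>' (at x))" for x
      by (rule test_function_linear[OF \<psi>'(1)])
    define h where "h = (\<lambda>x. a * (s\<^sup>2 * (f x * \<psi>' x) + (1 - s\<^sup>2) * (u x * \<psi>' x)))"
    define k where "k = (\<lambda>x. a * (s\<^sup>2 * frechet_derivative \<psi>' (at x) (g x) + u x * \<psi>' x))"
    have hi: "integrable lborel h" and ki: "integrable lborel k"
      unfolding h_def k_def using i by auto
    have h_eq: "(\<lambda>x. (a * (s\<^sup>2 * f (s *\<^sub>R x) + (1 - s\<^sup>2) * u (s *\<^sub>R x))) * \<psi> x) = (\<lambda>x. h (s *\<^sub>R x))"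
      unfolding h_def \<psi>'(2) by (auto simp: algebra_simps)
    have k_eq: "(\<lambda>x. frechet_derivative \<psi> (at x) ((a * s) *\<^sub>R g (s *\<^sub>R x)) + (a * u (s *\<^sub>R x)) * \<psi> x) = (\<lambda>x. k (s *\<^sub>R x))"
      unfolding k_def \<psi>'(2) D[OF \<psi>'(1)]
      by (auto simp: linear_cmul[OF lin] algebra_simps power2_eq_square)
    have "(\<integral>x. frechet_derivative \<psi>' (at x) (g x) \<partial>lborel) + (\<integral>x. u x * \<psi>' x \<partial>lborel) = (\<integral>x. f x * \<psi>' x \<partial>lborel)"
      using g(3)[OF \<psi>'(1)] by (simp add: Bochner_Integration.integral_add[OF i(1,2)])
    then have "(\<integral>x. k x \<partial>lborel) = (\<integral>x. h x \<partial>lborel)"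
      unfolding h_def k_def using i by (simp flip: \<open>_ = (\<integral>x. f x * \<psi>' x \<partial>lborel)\<close>) (simp add: algebra_simps)
    then show ?thesis
      unfolding h_eq k_eq using integral_lborel_scaleR[OF s meas[OF hi]] integral_lborel_scaleR[OF s meas[OF ki]] hi
      by simp
  qed
  ultimately show ?thesis unfolding weak_solution_def by blast
qed

section \<open>Nondegeneracy\<close>

text \<open>The set where the functions differ is open, and a nonempty open set is not null.\<close>

lemma AE_eq_imp_eq_continuous:
  fixes f g :: "'a::euclidean_space \<Rightarrow> real"
  assumes "continuous_on UNIV f" "continuous_on UNIV g" "AE x in lborel. f x = g x"
  shows "f x = g x"
proof (rule ccontr)
  assume ne: "f x \<noteq> g x"
  have o: "open {x. f x \<noteq> g x}"
    using assms by (intro open_Collect_neq) auto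
  then have "emeasure lborel {x. f x \<noteq> g x} = 0"
    using AE_iff_measurable[of "{x. f x \<noteq> g x}" lborel "\<lambda>x. f x = g x"] assms(3) by auto
  then have "{x. f x \<noteq> g x} \<in> null_sets lborel"
    using o by (intro null_setsI) auto
  then have "negligible {x. f x \<noteq> g x}"
    using negligible_iff_null_sets null_sets_completionI by blast
  then show False using open_not_negligible[OF o] ne by blast
qed

text \<open>The cubic term is read as the bounded potential w^2 times w, so the linear regularity
  result applies. \<open>W\<close> restricts w to a line and is defined for negative arguments too;
  continuity upgrades its almost everywhere agreement with the regular solution to equality for r >=
  0.\<close>

lemma ground_state_profile:
  fixes w :: "'a::euclidean_space \<Rightarrow> real"
  assumes dim: "DIM('a) = Suc n" and n: "n \<le> 2" and gs: "ground_state w"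
  obtains W W' where "continuous_on UNIV W" "\<And>x. w x = W (norm x)" "radial_ground_state n W W' (w 0)"
    "\<And>r. 0 \<le> W r" "\<And>r. W r \<le> w 0"
proof -
  have w: "continuous_on UNIV w" "radial w" "\<And>x. 0 < w x" "\<And>x. w x \<le> w 0" "weak_solution w (\<lambda>x. w x ^ 3)"
    using gs by (auto simp: ground_state_def)
  obtain e :: 'a where e: "e \<in> Basis" using nonempty_Basis by blast
  define W where "W = (\<lambda>r. w (r *\<^sub>R e))"
  have W: "w x = W (norm x)" for x
  proof -
    have "norm (norm x *\<^sub>R e) = norm x" using e by simp
    then show ?thesis using w(2) unfolding radial_def W_def by metis
  qed
  have W_cont: "continuous_on UNIV W"
    unfolding W_def by (intro continuous_on_compose2[OF w(1)] continuous_intros) auto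
  have W_bd: "0 < W r" "W r \<le> w 0" for r using w(3,4) by (simp_all add: W_def)
  have ws: "weak_solution w (\<lambda>x. (W (norm x))\<^sup>2 * w x)"
    using w(5) by (simp add: W[symmetric] power2_eq_square power3_eq_cube)
  have bnd: "\<bar>1 - (W r)\<^sup>2\<bar> \<le> 1 + (w 0)\<^sup>2" for r
  proof -
    have "(W r)\<^sup>2 \<le> (w 0)\<^sup>2" using W_bd[of r] by (intro power_mono) auto
    moreover have "0 \<le> (W r)\<^sup>2" by simp
    ultimately show ?thesis by linarith
  qed
  have cont: "continuous_on UNIV (\<lambda>r. (W r)\<^sup>2)" by (intro continuous_intros W_cont)
  obtain y y' where y: "continuous_on UNIV y" "radial_ode n (\<lambda>r. 1 - (W r)\<^sup>2) y y'"
    "(y' \<longlongrightarrow> 0) (at_right 0)" "vanishing_tail y" "AE x in lborel. w x = y (norm x)"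
    by (rule radial_weak_solution_ode[where v="\<lambda>r. (W r)\<^sup>2", OF dim n w(2) ws cont bnd]) (rule that)
  have wy: "w x = y (norm x)" for x
    by (rule AE_eq_imp_eq_continuous[OF w(1) _ y(5)])
       (intro continuous_on_compose2[OF y(1)] continuous_intros; simp)
  have yW: "y r = W r" if "r \<ge> 0" for r
    using wy[of "r *\<^sub>R e"] that e by (simp add: W_def)
  have "radial_ground_state n W y' (w 0)"
  proof
    show "radial_ode n (\<lambda>r. 1 - (W r)\<^sup>2) W y'"
      unfolding radial_ode_def
    proof (intro allI impI conjI)
      fix r :: real assume r: "r > 0"
      show "(W has_real_derivative y' r) (at r)"
        by (rule has_field_derivative_transform_within_open[OF radial_odeD(1)[OF y(2) r], of "{0<..}"])
           (use r yW in auto)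
      show "(y' has_real_derivative (1 - (W r)\<^sup>2) * W r - real n / r * y' r) (at r)"
        using radial_odeD(2)[OF y(2) r] yW[of r] r by simp
    qed
    have "isCont W 0" using W_cont by (simp add: continuous_on_eq_continuous_at)
    then have "(W \<longlongrightarrow> W 0) (at_right 0)"
      unfolding isCont_def by (rule tendsto_within_subset) simp
    then show "(W \<longlongrightarrow> w 0) (at_right 0)" by (simp add: W)
    show "vanishing_tail W"
    proof -
      have "\<forall>\<^sub>F r in at_top. integral {r..r+1} (\<lambda>s. (y s)\<^sup>2) = integral {r..r+1} (\<lambda>s. (W s)\<^sup>2)"
        using eventually_ge_at_top[of 0]
        by eventually_elim (intro integral_cong, simp add: yW)
      then show ?thesis using y(4) unfolding vanishing_tail_def by (rule Lim_transform_eventually[rotated])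
    qed
  qed (use n W_bd y in auto)
  then show ?thesis using W_cont W W_bd by (intro that[of W y']) (auto intro: less_imp_le)
qed

lemma AE_zero_of_radial:
  assumes "\<And>r. r > 0 \<Longrightarrow> y r = 0" "AE x in lborel. (u :: 'a::euclidean_space \<Rightarrow> real) x = y (norm x)"
  shows "AE x in lborel. u x = 0"
  using assms(2) AE_lborel_singleton[of 0]
  by eventually_elim (use assms(1) in auto)

lemma radial_add_cmult: "radial u \<Longrightarrow> radial v \<Longrightarrow> radial (\<lambda>x. u x + c * v x)"
  unfolding radial_def by metis

text \<open>Equal components make the zeroth order part of the linearisation a symmetric 2 x 2
  matrix with equal diagonal entries, so (1, 1) and (1, -1) are eigenvectors at every point and the
  system decouples. The bound on w(0) is taken squared and without denominators.\<close>

theorem synchronized_solution_nondegenerate: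
  fixes w :: "'a::euclidean_space \<Rightarrow> real" and \<kappa> \<beta> :: real
  assumes dim: "DIM('a) = Suc n" and n: "n \<le> 2" and \<kappa>: "0 < \<kappa>" "\<kappa> < 1" and gs: "ground_state w"
    and \<beta>: "-1 < \<beta>" and small: "\<beta> < 3 \<Longrightarrow> (3 - \<beta>) * (1 - \<kappa>) * (w 0)\<^sup>2 \<le> 2 * \<kappa> * (1 + \<beta>)"
  shows "radially_nondegenerate \<kappa> \<beta>
    (\<lambda>x. sqrt ((1 - \<kappa>) / (1 + \<beta>)) * w (sqrt (1 - \<kappa>) *\<^sub>R x))
    (\<lambda>x. sqrt ((1 - \<kappa>) / (1 + \<beta>)) * w (sqrt (1 - \<kappa>) *\<^sub>R x))"
proof -
  define s a where "s = sqrt (1 - \<kappa>)" and "a = sqrt ((1 - \<kappa>) / (1 + \<beta>))"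
  have s: "s > 0" "s\<^sup>2 = 1 - \<kappa>" using \<kappa> by (auto simp: s_def)
  have a2: "a\<^sup>2 = (1 - \<kappa>) / (1 + \<beta>)" using \<kappa> \<beta> by (simp add: a_def)
  have a: "(1 + \<beta>) * a\<^sup>2 = s\<^sup>2" using \<beta> s(2) by (simp add: a2)
  define U where "U = (\<lambda>x. a * w (s *\<^sub>R x))"
  have w: "radial w" "weak_solution w (\<lambda>x. w x ^ 3)" "continuous_on UNIV w"
    using gs by (auto simp: ground_state_def)
  obtain W W' where W: "continuous_on UNIV W" "\<And>x. w x = W (norm x)" "radial_ground_state n W W' (w 0)"
    "\<And>r. 0 \<le> W r" "\<And>r. W r \<le> w 0"
    using ground_state_profile[OF dim n gs] by blast
  interpret radial_ground_state n W W' "w 0" by (rule W(3))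
  have U2: "(U x)\<^sup>2 = a\<^sup>2 * (W (s * norm x))\<^sup>2" for x
    using s(1) by (simp add: U_def W(2) power_mult_distrib)
  have W2: "(W r)\<^sup>2 \<le> (w 0)\<^sup>2" for r using W(4,5) by (intro power_mono)
  have W2s: "continuous_on UNIV (\<lambda>r. (W (s * r))\<^sup>2)"
    by (intro continuous_intros continuous_on_compose2[OF W(1)]) auto
  have wsU: "weak_solution U (\<lambda>x. U x ^ 3 + \<beta> * (U x)\<^sup>2 * U x + \<kappa> * U x)"
  proof -
    have "(\<lambda>x. w x ^ 3) \<in> borel_measurable borel"
      using borel_measurable_continuous_onI[OF w(3)] by measurable
    from weak_solution_scaleR[OF w(2) s(1) this, of a]
    have "weak_solution U (\<lambda>x. a * (s\<^sup>2 * w (s *\<^sub>R x) ^ 3 + (1 - s\<^sup>2) * w (s *\<^sub>R x)))"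
      by (simp add: U_def)
    also have "(\<lambda>x. a * (s\<^sup>2 * w (s *\<^sub>R x) ^ 3 + (1 - s\<^sup>2) * w (s *\<^sub>R x)))
        = (\<lambda>x. U x ^ 3 + \<beta> * (U x)\<^sup>2 * U x + \<kappa> * U x)"
    proof
      fix x
      \<comment> \<open>Substituting (1 + beta) a^2 = s^2 turns the dilated cubic term into (1 +
        beta) U^3, and 1 - s^2 = kappa gives the coupling term.\<close>
      have "a * (s\<^sup>2 * w (s *\<^sub>R x) ^ 3 + (1 - s\<^sup>2) * w (s *\<^sub>R x))
          = a * (((1 + \<beta>) * a\<^sup>2) * w (s *\<^sub>R x) ^ 3 + \<kappa> * w (s *\<^sub>R x))"
        unfolding a using s(2) by simp
      then show "a * (s\<^sup>2 * w (s *\<^sub>R x) ^ 3 + (1 - s\<^sup>2) * w (s *\<^sub>R x))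
          = U x ^ 3 + \<beta> * (U x)\<^sup>2 * U x + \<kappa> * U x"
        by (simp add: U_def power2_eq_square power3_eq_cube algebra_simps)
    qed
    finally show ?thesis .
  qed
  have "radial U" using w(1) s(1) by (auto simp: radial_def U_def W(2))
  then have sol: "radial_solution \<kappa> \<beta> U U"
    using wsU weak_solution_H1[OF wsU] by (simp add: radial_solution_def)
  have "AE x in lborel. \<phi>1 x = 0 \<and> \<phi>2 x = 0"
    if rad: "radial \<phi>1" "radial \<phi>2" and lin: "linearized_solution \<kappa> \<beta> U U \<phi>1 \<phi>2" for \<phi>1 \<phi>2
  proof -
    let ?f1 = "\<lambda>x. \<kappa> * \<phi>2 x + 3 * (U x)\<^sup>2 * \<phi>1 x + \<beta> * (U x)\<^sup>2 * \<phi>1 x + 2 * \<beta> * U x * U x * \<phi>2 x"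
    let ?f2 = "\<lambda>x. \<kappa> * \<phi>1 x + 3 * (U x)\<^sup>2 * \<phi>2 x + \<beta> * (U x)\<^sup>2 * \<phi>2 x + 2 * \<beta> * U x * U x * \<phi>1 x"
    have ws: "weak_solution \<phi>1 ?f1" "weak_solution \<phi>2 ?f2"
      using lin by (simp_all add: linearized_solution_def)
    \<comment> \<open>The sum is c = 1 and the difference c = -1; only c * c = 1 is needed for the
      right-hand sides to recombine.\<close>
    have comb: "weak_solution (\<lambda>x. \<phi>1 x + c * \<phi>2 x)
        (\<lambda>x. (c * \<kappa> + (3 + \<beta> + 2 * c * \<beta>) * a\<^sup>2 * (W (s * norm x))\<^sup>2) * (\<phi>1 x + c * \<phi>2 x))"
      if c: "c * c = 1" for c :: real
    proof -
      have "?f1 x + c * ?f2 x = (c * \<kappa> + (3 + \<beta> + 2 * c * \<beta>) * (U x)\<^sup>2) * (\<phi>1 x + c * \<phi>2 x)" for x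
      proof -
        have "?f1 x + c * ?f2 x - (c * \<kappa> + (3 + \<beta> + 2 * c * \<beta>) * (U x)\<^sup>2) * (\<phi>1 x + c * \<phi>2 x)
            = (1 - c * c) * (\<kappa> + 2 * \<beta> * (U x)\<^sup>2) * \<phi>2 x"
          by (simp add: power2_eq_square algebra_simps)
        then show ?thesis using c by simp
      qed
      then show ?thesis
        using weak_solution_add_cmult[OF ws, of c] by (simp add: U2 mult.assoc)
    qed
    have lim0: "(y \<longlongrightarrow> y 0) (at_right 0)" if "continuous_on UNIV y" for y :: "real \<Rightarrow> real"
    proof -
      have "isCont y 0" using that by (simp add: continuous_on_eq_continuous_at)
      then show ?thesis unfolding isCont_def by (rule tendsto_within_subset) simp
    qed
    have pot: "continuous_on UNIV (\<lambda>r. k + b * (W (s * r))\<^sup>2)" "\<bar>1 - (k + b * (W (s * r))\<^sup>2)\<bar> \<le> 1 + \<bar>k\<bar> + \<bar>b\<bar> * (w 0)\<^sup>2"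
      for k b r :: real
    proof -
      show "continuous_on UNIV (\<lambda>r. k + b * (W (s * r))\<^sup>2)"
        by (intro continuous_intros W2s)
      have "\<bar>b * (W (s * r))\<^sup>2\<bar> \<le> \<bar>b\<bar> * (w 0)\<^sup>2"
        using W2[of "s * r"] by (simp add: abs_mult mult_left_mono)
      then show "\<bar>1 - (k + b * (W (s * r))\<^sup>2)\<bar> \<le> 1 + \<bar>k\<bar> + \<bar>b\<bar> * (w 0)\<^sup>2" by linarith
    qed
    have plus: "AE x in lborel. \<phi>1 x + 1 * \<phi>2 x = 0"
    proof -
      \<comment> \<open>For c = 1 beta disappears: with 1 - kappa = s^2 the coefficient becomes s^2
        (1 - 3 W^2) at the point s r, a dilation of the scalar linearisation.\<close>
      have b: "(3 + \<beta> + 2 * 1 * \<beta>) * a\<^sup>2 = 3 * s\<^sup>2" using a by (simp add: algebra_simps)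
      obtain y y' where y: "continuous_on UNIV y"
        "radial_ode n (\<lambda>r. 1 - (1 * \<kappa> + 3 * s\<^sup>2 * (W (s * r))\<^sup>2)) y y'"
        "(y' \<longlongrightarrow> 0) (at_right 0)" "vanishing_tail y" "AE x in lborel. \<phi>1 x + 1 * \<phi>2 x = y (norm x)"
        by (rule radial_weak_solution_ode[where v="\<lambda>r. 1 * \<kappa> + 3 * s\<^sup>2 * (W (s * r))\<^sup>2",
              OF dim n radial_add_cmult[OF rad] comb[of 1, unfolded b] pot]) (simp, rule that)
      have q: "1 - (1 * \<kappa> + 3 * s\<^sup>2 * (W (s * r))\<^sup>2) = s\<^sup>2 * (1 - 3 * (W (s * r))\<^sup>2)" for r
        using s(2) by (simp add: algebra_simps)
      have "\<forall>\<^sub>F r in at_top. W r < 1 / 2" using order_tendstoD(2)[OF W_lim, of "1 / 2"] by simp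
      then obtain R0 where R0: "\<And>r. r \<ge> R0 \<Longrightarrow> W r < 1 / 2" unfolding eventually_at_top_linorder by blast
      define R where "R = max 1 (R0 / s)"
      \<comment> \<open>Where W < 1 / 2 one has 1 - 3 W^2 >= 1 / 4, which accounts for the decay
        rate s / 2.\<close>
      have qR: "(s / 2)\<^sup>2 \<le> 1 - (1 * \<kappa> + 3 * s\<^sup>2 * (W (s * r))\<^sup>2)" if r: "r \<ge> R" for r
      proof -
        have "R0 / s \<le> r" using r by (simp add: R_def)
        then have "R0 \<le> s * r" using s(1) by (simp add: field_simps)
        then have "(W (s * r))\<^sup>2 \<le> (1 / 2)\<^sup>2" using R0[of "s * r"] W(4) by (intro power_mono) auto
        then have "1 / 4 \<le> 1 - 3 * (W (s * r))\<^sup>2" by (simp add: power2_eq_square)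
        then have "s\<^sup>2 * (1 / 4) \<le> s\<^sup>2 * (1 - 3 * (W (s * r))\<^sup>2)" by (rule mult_left_mono) simp
        then show ?thesis unfolding q by (simp add: power_divide)
      qed
      have R1: "R \<ge> 1" and s2: "s / 2 > 0" using s(1) by (auto simp: R_def)
      note dec = radial_ode_decay[OF y(2) R1 s2 qR y(4)]
      have div_top: "filterlim (\<lambda>r. r / s) at_top at_top"
        using s(1) filterlim_tendsto_pos_mult_at_top[OF tendsto_const[of "1 / s"] _ filterlim_ident] by simp
      have div_0: "filterlim (\<lambda>r. r / s) (at_right 0) (at_right 0)"
      proof -
        have "((\<lambda>r. r / s) \<longlongrightarrow> 0 / s) (at_right 0)" by (intro tendsto_intros) (use s(1) in auto)
        moreover have "\<forall>\<^sub>F r in at_right 0. r / s \<in> {0<..} \<and> r / s \<noteq> 0"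
          using s(1) by (auto simp: eventually_at_right_field intro!: exI[of _ 1])
        ultimately show ?thesis by (simp add: filterlim_at)
      qed
      have scaled: "((\<lambda>r. r ^ k * h (r / s)) \<longlongrightarrow> 0) at_top"
        if "((\<lambda>r. r ^ k * h r) \<longlongrightarrow> 0) at_top" for h :: "real \<Rightarrow> real" and k
      proof -
        have "((\<lambda>r. s ^ k * ((r / s) ^ k * h (r / s))) \<longlongrightarrow> s ^ k * 0) at_top"
          by (intro tendsto_mult tendsto_const filterlim_compose[OF that div_top])
        then show ?thesis using s(1) by (simp add: power_divide)
      qed
      have "y (r / s) = 0" if r: "r > 0" for r
      proof (rule radial_kernel_trivial[where y="\<lambda>r. y (r / s)" and y'="\<lambda>r. y' (r / s) / s", OF _ _ _ _ _ r])
        have "radial_ode n (\<lambda>r. (1 - (1 * \<kappa> + 3 * s\<^sup>2 * (W (s * (r / s)))\<^sup>2)) / s\<^sup>2) (\<lambda>r. y (r / s)) (\<lambda>r. y' (r / s) / s)"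
          by (rule radial_ode_scale[OF y(2) s(1)])
        then show "radial_ode n (\<lambda>r. 1 - 3 * (W r)\<^sup>2) (\<lambda>r. y (r / s)) (\<lambda>r. y' (r / s) / s)"
          unfolding q using s(1) by simp
        show "((\<lambda>r. y (r / s)) \<longlongrightarrow> y 0) (at_right 0)"
          by (rule filterlim_compose[OF lim0[OF y(1)] div_0])
        have "((\<lambda>r. y' (r / s) / s) \<longlongrightarrow> 0 / s) (at_right 0)"
          by (intro tendsto_divide tendsto_const filterlim_compose[OF y(3) div_0]) (use s(1) in auto)
        then show "((\<lambda>r. y' (r / s) / s) \<longlongrightarrow> 0) (at_right 0)" by simp
        show "((\<lambda>r. r ^ k * y (r / s)) \<longlongrightarrow> 0) at_top" for k
          by (rule scaled[OF dec(1)])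
        have "((\<lambda>r. (r ^ k * y' (r / s)) / s) \<longlongrightarrow> 0 / s) at_top" for k
          by (intro tendsto_divide tendsto_const scaled[OF dec(2)]) (use s(1) in auto)
        then show "((\<lambda>r. r ^ k * (y' (r / s) / s)) \<longlongrightarrow> 0) at_top" for k by simp
      qed
      then have "y r = 0" if "r > 0" for r
        using that s(1) by (metis mult_pos_pos nonzero_mult_div_cancel_right less_numeral_extra(3))
      then show ?thesis by (rule AE_zero_of_radial[OF _ y(5)])
    qed
    have minus: "AE x in lborel. \<phi>1 x + (- 1) * \<phi>2 x = 0"
    proof -
      define b where "b = (3 + \<beta> + 2 * (- 1) * \<beta>) * a\<^sup>2"
      obtain y y' where y: "continuous_on UNIV y"
        "radial_ode n (\<lambda>r. 1 - ((- 1) * \<kappa> + b * (W (s * r))\<^sup>2)) y y'"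
        "(y' \<longlongrightarrow> 0) (at_right 0)" "vanishing_tail y" "AE x in lborel. \<phi>1 x + (- 1) * \<phi>2 x = y (norm x)"
        by (rule radial_weak_solution_ode[where v="\<lambda>r. (- 1) * \<kappa> + b * (W (s * r))\<^sup>2",
              OF dim n radial_add_cmult[OF rad] comb[of "- 1", folded b_def] pot]) (simp, rule that)
      \<comment> \<open>This is the meaning of the bound on w(0). It keeps the coefficient 1 + kappa
        - b W^2 at or above 1 - kappa = s^2, so \<open>s\<close> is the coercivity constant.\<close>
      have "b * (W r)\<^sup>2 \<le> 2 * \<kappa>" for r
      proof (cases "\<beta> < 3")
        case True
        have b: "b = (3 - \<beta>) * (1 - \<kappa>) / (1 + \<beta>)" by (simp add: b_def a2)
        have "b \<ge> 0" using True \<kappa> \<beta> by (simp add: b)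
        then have "b * (W r)\<^sup>2 \<le> b * (w 0)\<^sup>2" using W2 by (intro mult_left_mono)
        also have "\<dots> \<le> 2 * \<kappa>" using small[OF True] \<beta> by (simp add: b field_simps)
        finally show ?thesis .
      next
        case False
        then have "b \<le> 0" by (simp add: b_def mult_le_0_iff)
        then have "b * (W r)\<^sup>2 \<le> 0" by (simp add: mult_le_0_iff)
        then show ?thesis using \<kappa> by simp
      qed
      then have q: "s\<^sup>2 \<le> 1 - ((- 1) * \<kappa> + b * (W (s * r))\<^sup>2)" for r
        using s(2) by (smt (verit))
      have "y r = 0" if "r > 0" for r
        by (rule coercive_radial_ode_zero[OF y(2) s(1) q lim0[OF y(1)] y(3,4) that])
      then show ?thesis by (rule AE_zero_of_radial[OF _ y(5)])
    qed
    show ?thesis using plus minus by eventually_elim auto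
  qed
  then have "radially_nondegenerate \<kappa> \<beta> U U"
    unfolding radially_nondegenerate_def using sol by blast
  then show ?thesis unfolding U_def s_def a_def .
qed

theorem lemma3p6:
  fixes w :: "real ^ 'n \<Rightarrow> real" and \<kappa>\<^sub>0 \<beta>\<^sub>0 :: real
  assumes "CARD('n) \<in> {1, 2, 3}"
    and "0 < \<kappa>\<^sub>0" and "\<kappa>\<^sub>0 < 1"
    and "ground_state w"
    and "3 \<le> \<beta>\<^sub>0 \<or>
         (-1 < \<beta>\<^sub>0 \<and> \<beta>\<^sub>0 < 3 \<and>
          w 0 \<le> sqrt (2 * \<kappa>\<^sub>0 * (1 + \<beta>\<^sub>0) / ((3 - \<beta>\<^sub>0) * (1 - \<kappa>\<^sub>0))))"
  shows "radially_nondegenerate \<kappa>\<^sub>0 \<beta>\<^sub>0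
           (\<lambda>x. sqrt ((1 - \<kappa>\<^sub>0) / (1 + \<beta>\<^sub>0)) * w (sqrt (1 - \<kappa>\<^sub>0) *\<^sub>R x))
           (\<lambda>x. sqrt ((1 - \<kappa>\<^sub>0) / (1 + \<beta>\<^sub>0)) * w (sqrt (1 - \<kappa>\<^sub>0) *\<^sub>R x))"
proof (rule synchronized_solution_nondegenerate)
  show "DIM(real ^ 'n) = Suc (CARD('n) - 1)" "CARD('n) - 1 \<le> 2"
    using assms(1) by auto
  show "-1 < \<beta>\<^sub>0" using assms(5) by auto
  show "(3 - \<beta>\<^sub>0) * (1 - \<kappa>\<^sub>0) * (w 0)\<^sup>2 \<le> 2 * \<kappa>\<^sub>0 * (1 + \<beta>\<^sub>0)" if "\<beta>\<^sub>0 < 3"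
  proof -
    have le: "w 0 \<le> sqrt (2 * \<kappa>\<^sub>0 * (1 + \<beta>\<^sub>0) / ((3 - \<beta>\<^sub>0) * (1 - \<kappa>\<^sub>0)))" and b: "-1 < \<beta>\<^sub>0"
      using assms(5) that by auto
    have p: "(3 - \<beta>\<^sub>0) * (1 - \<kappa>\<^sub>0) > 0" using that assms(3) by simp
    \<comment> \<open>Positivity of the maximum allows squaring the bound.\<close>
    have "0 < w 0" using assms(4) by (simp add: ground_state_def)
    then have "(w 0)\<^sup>2 \<le> (sqrt (2 * \<kappa>\<^sub>0 * (1 + \<beta>\<^sub>0) / ((3 - \<beta>\<^sub>0) * (1 - \<kappa>\<^sub>0))))\<^sup>2"
      using le by (intro power_mono) auto
    also have "\<dots> = 2 * \<kappa>\<^sub>0 * (1 + \<beta>\<^sub>0) / ((3 - \<beta>\<^sub>0) * (1 - \<kappa>\<^sub>0))"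
      using assms(2) b p by (intro real_sqrt_pow2 divide_nonneg_pos) auto
    finally show ?thesis using p by (simp add: pos_le_divide_eq mult.commute)
  qed
qed (use assms in auto)

end
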